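(* Let $\mathbb{G}=\mathbb{R}^q\times\mathbb{R}^m$ be a step-two group with heat kernel $p_h$ ($h>0$) of the canonical sub-Laplacian. There is a constant $\widetilde C(q,m)>0$, depending only on $q$ and $m$, such that for every $k\in\{0,1,2,\dots\}$, every $h>0$ and every $(x,t)\in\mathbb{G}$, $$p_h(x,t)=\frac{\widetilde C(q,m)}{\big((2\pi)^{q/2}\big)^k}\,e^{-\frac{|x|^2}{4h}}\int_{(\mathbb{R}^q)^k}\exp\Big\{-\sum_{j=1}^k\frac{2j+1}{2h}|\mathbf{s}_j|^2\Big\}\,\mathrm{P}_h^{\{k\}}\big(\mathfrak{F}_k(x,t,\mathbf{s})\big)\,d\mathbf{s},$$ where for $k=0$ the formula means $p_h(x,t)=\widetilde C(q,m)\,e^{-\frac{|x|^2}{4h}}\,\mathrm{P}_h^{\{0\}}\big(\tfrac{x}{\sqrt2},t\big)$, and $\mathrm{P}_h^{\{k\}}$ and $\mathfrak{F}_k$ are as defined in the context.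
   Context: **Step-two group and heat kernel.** Let $q,m\in\{1,2,\dots\}$ and let $\mathbb{U}=\{U^{(1)},\dots,U^{(m)}\}$ be linearly independent real skew-symmetric $q\times q$ matrices. For $x,x'\in\mathbb{R}^q$ put $\langle\mathbb{U}x,x'\rangle=(\langle U^{(1)}x,x'\rangle,\dots,\langle U^{(m)}x,x'\rangle)\in\mathbb{R}^m$. The step-two group $\mathbb{G}$ is $\mathbb{R}^q\times\mathbb{R}^m$ with the law $(x,t)\cdot(x',t')=(x+x',\,t+t'+\tfrac12\langle\mathbb{U}x,x'\rangle)$ and Haar measure $dg$ equal to Lebesgue measure. The canonical sub-Laplacian is $\Delta=\sum_{l=1}^qX_l^2$, $X_l(g)=\frac{\partial}{\partial x_l}+\frac12\sum_{j=1}^m\big(\sum_{i=1}^q U^{(j)}_{l,i}x_i\big)\frac{\partial}{\partial t_j}$. The heat kernel $p_h$ is the convolution kernel of $e^{h\Delta}$: $e^{h\Delta}u(g)=\int_{\mathbb{G}}u(g')\,p_h((g')^{-1}\cdot g)\,dg'$. It is known that $$p_h(x,t)=\frac{C(q,m)}{h^{q/2+m}}\int_{\mathbb{R}^m}\Big(\det\frac{U(\lambda)}{\sinh U(\lambda)}\Big)^{1/2}\exp\Big\{-\frac{\langle U(\lambda)\coth U(\lambda)\,x,x\rangle-4i\,t\cdot\lambda}{4h}\Big\}\,d\lambda$$ with a constant $C(q,m)>0$ depending only on $q,m$, where $U(\lambda)=i\sum_{j=1}^m\lambda_jU^{(j)}$ (a Hermitian matrix for $\lambda\in\mathbb{R}^m$);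 functions of $U(\lambda)$ are defined by functional calculus. **Bessel-related functions.** For $k\in\{0,1,2,\dots\}$, let $I_{k+1/2}$ be the modified Bessel function, $\mathrm{Q}_k(z)=z^{-(k+1/2)}I_{k+1/2}(z)$ (an even entire function, positive on $\mathbb{R}$), and $\mathrm{R}_k(z)=z^2\,\frac{\mathrm{Q}_{k+1}(z)}{\mathrm{Q}_k(z)}$. **Kernels.** For $h>0$ and $(X,T)\in\mathbb{R}^q\times\mathbb{R}^m$, $$\mathrm{P}_h^{\{k\}}(X,T)=h^{-\frac{(k+1)q}{2}-m}\int_{\mathbb{R}^m}\big(\det\mathrm{Q}_k(U(\lambda))\big)^{-1/2}\exp\Big\{-\frac{\langle\mathrm{R}_k(U(\lambda))X,X\rangle-2i\,T\cdot\lambda}{2h}\Big\}\,d\lambda .$$ For $k\ge1$ and $\mathbf{s}=(\mathbf{s}_1,\dots,\mathbf{s}_k)\in(\mathbb{R}^q)^k$, $$\mathfrak{F}_k(x,t,\mathbf{s})=\Big(\mathbf{s}_k,\ t+\tfrac1{\sqrt2}\langle\mathbb{U}x,\mathbf{s}_1\rangle+\sum_{j=2}^k\langle\mathbb{U}\mathbf{s}_{j-1},\mathbf{s}_j\rangle\Big)\in\mathbb{R}^q\times\mathbb{R}^m .$$ *)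

theory Defs
  imports "HOL-Analysis.Analysis"
begin

section \<open>Step-two groups\<close>

text \<open>The group is \<open>real^'q \<times> real^'m\<close>, with \<open>q = CARD('q)\<close>, \<open>m = CARD('m)\<close>; its Haar measure
  is \<open>lborel\<close>.\<close>

definition step_two :: "('m::finite \<Rightarrow> real^'q^'q) \<Rightarrow> bool" where
  "step_two U \<longleftrightarrow> (\<forall>j. transpose (U j) = - U j) \<and> inj U \<and> independent (range U)"

definition bracket ::
  "('m::finite \<Rightarrow> real^'q^'q) \<Rightarrow> real^'q \<Rightarrow> real^'q \<Rightarrow> real^'m" where
  "bracket U x y = (\<chi> j. (U j *v x) \<bullet> y)"

definition gmult ::
  "('m::finite \<Rightarrow> real^'q^'q) \<Rightarrow> (real^'q) \<times> (real^'m) \<Rightarrow> (real^'q) \<times> (real^'m)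
    \<Rightarrow> (real^'q) \<times> (real^'m)" where
  "gmult U g g' = (fst g + fst g', snd g + snd g' + (1/2) *\<^sub>R bracket U (fst g) (fst g'))"

definition ginv :: "(real^'q) \<times> (real^'m) \<Rightarrow> (real^'q) \<times> (real^'m)" where
  "ginv g = (- fst g, - snd g)"

lemma bracket_self:
  fixes U :: "'m::finite \<Rightarrow> real^'q^'q"
  assumes "step_two U"
  shows "bracket U x x = 0"
proof -
  have "(U j *v x) \<bullet> x = 0" for j
  proof -
    have "(U j *v x) \<bullet> x = x \<bullet> (transpose (U j) *v x)"
      by (metis dot_lmul_matrix inner_commute transpose_matrix_vector)
    also have "\<dots> = - (x \<bullet> (U j *v x))"
      using assms by (simp add: step_two_def matrix_vector_mult_def inner_vec_def sum_negf)
    finally show ?thesis by (simp add: inner_commute)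
  qed
  then show ?thesis by (simp add: bracket_def vec_eq_iff)
qed

lemma gmult_ginv:
  assumes "step_two U"
  shows "gmult U g (ginv g) = 0" "gmult U (ginv g) g = 0"
proof -
  have "bracket U x (- y) = - bracket U x y" "bracket U (- x) y = - bracket U x y" for x y
    by (simp_all add: bracket_def vec_eq_iff matrix_vector_mult_def inner_vec_def sum_negf)
  then show "gmult U g (ginv g) = 0" "gmult U (ginv g) g = 0"
    using bracket_self[OF assms] by (simp_all add: gmult_def ginv_def zero_prod_def)
qed


section \<open>Sub-Laplacian, heat semigroup and heat kernel\<close>

definition vfield ::
  "('m::finite \<Rightarrow> real^'q^'q) \<Rightarrow> 'q \<Rightarrow> ((real^'q) \<times> (real^'m) \<Rightarrow> real)
    \<Rightarrow> (real^'q) \<times> (real^'m) \<Rightarrow> real" where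
  "vfield U l f = (\<lambda>(x, t).
     frechet_derivative f (at (x, t)) (axis l 1, 0) +
     1/2 * (\<Sum>j\<in>UNIV. (\<Sum>i\<in>UNIV. U j $ l $ i * x $ i) *
                       frechet_derivative f (at (x, t)) (0, axis j 1)))"

definition sublaplacian ::
  "('m::finite \<Rightarrow> real^'q^'q) \<Rightarrow> ((real^'q) \<times> (real^'m) \<Rightarrow> real)
    \<Rightarrow> (real^'q) \<times> (real^'m) \<Rightarrow> real" where
  "sublaplacian U f g = (\<Sum>l\<in>UNIV. vfield U l (vfield U l f) g)"

fun C_n :: "nat \<Rightarrow> ('a::real_normed_vector \<Rightarrow> real) \<Rightarrow> bool" where
  "C_n 0 f = continuous_on UNIV f"
| "C_n (Suc n) f = ((\<forall>g. f differentiable (at g)) \<and>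
                    (\<forall>v. C_n n (\<lambda>g. frechet_derivative f (at g) v)))"

definition test_fun :: "('a::euclidean_space \<Rightarrow> real) set" where
  "test_fun = {f. (\<forall>n. C_n n f) \<and> compact (closure {g. f g \<noteq> 0})}"

definition C_zero :: "('a::euclidean_space \<Rightarrow> real) set" where
  "C_zero = {f. continuous_on UNIV f \<and> (f \<longlongrightarrow> 0) at_infinity}"

text \<open>The semigroup \<open>e^(h \<Delta>)\<close>, realised as a Feller semigroup: a strongly continuous semigroup of
  linear contractions on the Banach space of continuous functions vanishing at infinity (sup norm)
  whose generator extends \<open>\<Delta>\<close> on the compactly supported smooth functions. These properties
  determine \<open>T h\<close> on that space for \<open>h \<ge> 0\<close>, because the test functions are a core.\<close>

definition heat_semigroup ::
  "('m::finite \<Rightarrow> real^'q^'q) \<Rightarrow>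
   (real \<Rightarrow> ((real^'q) \<times> (real^'m) \<Rightarrow> real) \<Rightarrow> (real^'q) \<times> (real^'m) \<Rightarrow> real) \<Rightarrow> bool" where
  "heat_semigroup U T \<longleftrightarrow>
     (\<forall>h\<ge>0. \<forall>f\<in>C_zero. T h f \<in> C_zero) \<and>
     (\<forall>h\<ge>0. \<forall>f\<in>C_zero. \<forall>f'\<in>C_zero. \<forall>a b.
        T h (\<lambda>g. a * f g + b * f' g) = (\<lambda>g. a * T h f g + b * T h f' g)) \<and>
     (\<forall>h\<ge>0. \<forall>f\<in>C_zero. \<forall>B. (\<forall>g. \<bar>f g\<bar> \<le> B) \<longrightarrow> (\<forall>g. \<bar>T h f g\<bar> \<le> B)) \<and>
     (\<forall>f\<in>C_zero. T 0 f = f) \<and>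
     (\<forall>h\<ge>0. \<forall>h'\<ge>0. \<forall>f\<in>C_zero. T (h + h') f = T h (T h' f)) \<and>
     (\<forall>f\<in>C_zero. uniform_limit UNIV (\<lambda>h. T h f) f (at_right 0)) \<and>
     (\<forall>f\<in>test_fun.
        uniform_limit UNIV (\<lambda>h g. (T h f g - f g) / h) (sublaplacian U f) (at_right 0))"

text \<open>\<open>p h\<close> is required to be continuous so that the kernel is determined at every point and not just
  almost everywhere.\<close>

definition heat_kernel ::
  "('m::finite \<Rightarrow> real^'q^'q) \<Rightarrow> (real \<Rightarrow> (real^'q) \<times> (real^'m) \<Rightarrow> real) \<Rightarrow> bool" where
  "heat_kernel U p \<longleftrightarrow>
     (\<exists>T. heat_semigroup U T \<and>
        (\<forall>h>0. continuous_on UNIV (p h) \<and>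
           (\<forall>u\<in>C_zero. \<forall>g.
              T h u g = (LINT g'|lborel. u g' * p h (gmult U (ginv g') g)))))"


section \<open>Functional calculus for Hermitian matrices\<close>

definition ctranspose :: "complex^'n^'n \<Rightarrow> complex^'n^'n" where
  "ctranspose A = (\<chi> i j. cnj (A $ j $ i))"

definition unitary :: "complex^'n^'n \<Rightarrow> bool" where
  "unitary V \<longleftrightarrow> V ** ctranspose V = mat 1 \<and> ctranspose V ** V = mat 1"

definition diag_matrix :: "('n \<Rightarrow> real) \<Rightarrow> complex^'n^'n" where
  "diag_matrix d = (\<chi> i j. if i = j then of_real (d i) else 0)"

text \<open>Only meant for Hermitian \<open>A\<close>; the result does not depend on the chosen diagonalisation.\<close>

definition matrix_fun :: "(real \<Rightarrow> real) \<Rightarrow> complex^'n^'n \<Rightarrow> complex^'n^'n" where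
  "matrix_fun f A = (THE B. \<exists>V d. unitary V \<and>
     A = V ** diag_matrix d ** ctranspose V \<and>
     B = V ** diag_matrix (\<lambda>i. f (d i)) ** ctranspose V)"

definition U_mat :: "('m::finite \<Rightarrow> real^'q^'q) \<Rightarrow> real^'m \<Rightarrow> complex^'q^'q" where
  "U_mat U lam = (\<chi> a b. \<i> * of_real (\<Sum>j\<in>UNIV. lam $ j * U j $ a $ b))"

definition quad_form :: "complex^'q^'q \<Rightarrow> real^'q \<Rightarrow> complex" where
  "quad_form A x = (\<Sum>a\<in>UNIV. (A *v (\<chi> i. of_real (x $ i))) $ a * of_real (x $ a))"


section \<open>Bessel-related functions\<close>

text \<open>The modified Bessel function of the first kind, for positive argument.\<close>

definition bessel_I :: "real \<Rightarrow> real \<Rightarrow> real" where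
  "bessel_I \<nu> z = (\<Sum>n. (z / 2) powr (2 * real n + \<nu>) / (fact n * Gamma (real n + \<nu> + 1)))"

text \<open>The even entire function \<open>z^(-(k+1/2)) I_(k+1/2)(z)\<close> (restricted to the real line), given by
  its power series since it is also evaluated at arguments \<open>z \<le> 0\<close>.\<close>

definition Q_fun :: "nat \<Rightarrow> real \<Rightarrow> real" where
  "Q_fun k z = (\<Sum>n. z ^ (2 * n) /
     (2 powr (2 * real n + (real k + 1/2)) * (fact n * Gamma (real n + (real k + 1/2) + 1))))"

lemma summable_bessel_I:
  fixes z \<nu> :: real
  assumes z: "z > 0" and nu: "\<nu> \<ge> 0"
  shows "summable (\<lambda>n. (z / 2) powr (2 * real n + \<nu>) / (fact n * Gamma (real n + \<nu> + 1)))"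
proof (rule summable_comparison_test')
  show "summable (\<lambda>n. (z/2) powr \<nu> / Gamma (\<nu> + 1) * (inverse (fact n) * ((z/2)\<^sup>2) ^ n))"
    by (intro summable_mult summable_exp)
  fix n :: nat
  have g: "Gamma (\<nu> + 1) > 0" using nu by (intro Gamma_real_pos) auto
  have le: "Gamma (\<nu> + 1) \<le> Gamma (real n + \<nu> + 1)"
  proof (induction n)
    case (Suc n)
    have "Gamma (real n + \<nu> + 1 + 1) = (real n + \<nu> + 1) * Gamma (real n + \<nu> + 1)"
      using nu by (intro Gamma_plus1) (auto elim!: nonpos_Ints_cases)
    moreover have "(real n + \<nu> + 1) * Gamma (real n + \<nu> + 1) \<ge> 1 * Gamma (real n + \<nu> + 1)"
      using nu by (intro mult_right_mono) (auto intro!: less_imp_le Gamma_real_pos)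
    ultimately show ?case using Suc by (simp add: add_ac)
  qed simp
  have p: "(z / 2) powr (2 * real n + \<nu>) = (z/2) powr \<nu> * ((z/2)\<^sup>2) ^ n"
  proof -
    have "(z / 2) powr (2 * real n) = ((z/2)\<^sup>2) ^ n"
      using z powr_realpow[of "z/2" "2 * n"] by (simp add: power_mult)
    then show ?thesis by (simp add: powr_add)
  qed
  have "norm ((z / 2) powr (2 * real n + \<nu>) / (fact n * Gamma (real n + \<nu> + 1)))
      = (z / 2) powr (2 * real n + \<nu>) / (fact n * Gamma (real n + \<nu> + 1))"
    using g le by simp
  also have "\<dots> \<le> (z / 2) powr (2 * real n + \<nu>) / (fact n * Gamma (\<nu> + 1))"
    using g le by (intro divide_left_mono mult_left_mono mult_pos_pos) auto
  also have "\<dots> = (z/2) powr \<nu> / Gamma (\<nu> + 1) * (inverse (fact n) * ((z/2)\<^sup>2) ^ n)"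
    unfolding p by (simp add: field_simps)
  finally show "norm ((z / 2) powr (2 * real n + \<nu>) / (fact n * Gamma (real n + \<nu> + 1)))
     \<le> (z/2) powr \<nu> / Gamma (\<nu> + 1) * (inverse (fact n) * ((z/2)\<^sup>2) ^ n)" .
qed

lemma Q_fun_bessel_I:
  assumes "z > 0"
  shows "Q_fun k z = z powr (- (real k + 1/2)) * bessel_I (real k + 1/2) z"
proof -
  define \<nu> where "\<nu> = real k + 1/2"
  have *: "z ^ (2 * n) / (2 powr (2 * real n + \<nu>) * c)
      = z powr (- \<nu>) * ((z / 2) powr (2 * real n + \<nu>) / c)" for n and c :: real
  proof -
    have "z powr (- \<nu>) * z powr (2 * real n + \<nu>) = z powr (real (2 * n))"
      by (simp add: powr_add[symmetric])
    also have "\<dots> = z ^ (2 * n)"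
      using assms by (rule powr_realpow)
    finally show ?thesis
      using assms by (simp add: powr_divide)
  qed
  have "\<nu> \<ge> 0" by (simp add: \<nu>_def)
  from suminf_mult[OF summable_bessel_I[OF assms this], of "z powr (- \<nu>)"] show ?thesis
    unfolding Q_fun_def bessel_I_def \<nu>_def[symmetric] * .
qed

definition R_fun :: "nat \<Rightarrow> real \<Rightarrow> real" where
  "R_fun k z = z\<^sup>2 * Q_fun (Suc k) z / Q_fun k z"


section \<open>The kernels and the maps\<close>

text \<open>The determinant is real and positive, so the principal branch gives its positive power.\<close>

definition P_ker ::
  "('m::finite \<Rightarrow> real^'q^'q) \<Rightarrow> nat \<Rightarrow> real \<Rightarrow> (real^'q) \<times> (real^'m) \<Rightarrow> complex" where
  "P_ker U k h = (\<lambda>(X, T).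
     of_real (h powr (- (real (k + 1) * real CARD('q) / 2) - real CARD('m))) *
     (LINT lam|lborel.
        det (matrix_fun (Q_fun k) (U_mat U lam)) powr (-1/2) *
        exp (- (quad_form (matrix_fun (R_fun k) (U_mat U lam)) X - 2 * \<i> * of_real (T \<bullet> lam))
             / of_real (2 * h))))"

text \<open>The components of \<open>s\<close> are \<open>s 1, \<dots>, s k\<close>, and \<open>k \<ge> 1\<close>.\<close>

definition F_map ::
  "('m::finite \<Rightarrow> real^'q^'q) \<Rightarrow> nat \<Rightarrow> real^'q \<Rightarrow> real^'m \<Rightarrow> (nat \<Rightarrow> real^'q)
    \<Rightarrow> (real^'q) \<times> (real^'m)" where
  "F_map U k x t s =
     (s k, t + (1 / sqrt 2) *\<^sub>R bracket U x (s 1) + (\<Sum>j=2..k. bracket U (s (j - 1)) (s j)))"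

end

theory Submission
  imports Defs "HOL-Probability.Characteristic_Functions" "HOL-Probability.Sinc_Integral"
begin

text \<open>The Feller semigroup contracts the sup norm, so for a curve \<open>f\<^sub>s\<close> of test functions the function
  \<open>s \<mapsto> T\<^bsub>h - s\<^esub> f\<^sub>s\<close> varies at rate at most \<open>sup |\<partial>\<^sub>s f\<^sub>s - \<Delta> f\<^sub>s|\<close>. Apply this to cut-off versions of the explicit solutions
  \<open>cos (\<lambda> \<bullet> t) exp (c(s) - \<langle>M(s) x, x\<rangle> / 4)\<close>, \<open>M' = W\<^sup>T W - M\<^sup>2\<close> with \<open>W = \<Sum>\<^sub>j \<lambda>\<^sub>j U\<^sub>j\<close>, started from a Gaussian that does not depend on \<open>\<lambda>\<close>;
  removing the cutoff determines the integral of the heat kernel against such functions. Integrating over \<open>\<lambda>\<close> with a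
  Gaussian weight turns the initial datum into an approximate identity on the group, and its limit is Gaveau's formula,
  which is the case \<open>k = 0\<close> because \<open>z coth z = 1 + R\<^sub>0 z\<close> and \<open>Q\<^sub>0 z = (2/\<pi>)\<^bsup>1/2\<^esup> sinh z / z\<close>.

  The step from \<open>k\<close> to \<open>k + 1\<close> is the Gaussian integral in the new variable: its quadratic form is
  \<open>2 k + 3 + R\<^sub>k\<^sub>+\<^sub>1 = Q\<^sub>k / Q\<^sub>k\<^sub>+\<^sub>1\<close> at \<open>U(\<lambda>)\<close>, so its determinant turns \<open>det Q\<^sub>k\<^sub>+\<^sub>1\<close> into \<open>det Q\<^sub>k\<close>, and
  completing the square produces \<open>z\<^sup>2 Q\<^sub>k\<^sub>+\<^sub>1 / Q\<^sub>k = R\<^sub>k\<close>.\<close>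

section \<open>Hermitian matrices and skew-symmetric frames\<close>

text \<open>The hypotheses give no regularity of \<open>p h\<close> beyond continuity, neither
  integrability nor a heat equation, so the kernel can only be reached through the action of the
  semigroup on test functions. The explicit solutions are bounded but do not decay in the central
  variable, hence lie outside \<open>C_zero\<close>; this forces the cutoff. It works because the
  Gaussian decay in x beats the growth of the vector fields in x, while their growth in t costs only
  one of the two powers of the cutoff parameter. Starting from a Gaussian of parameter a > 0 keeps
  the Riccati rates bounded down to time 0, so one error constant serves the whole time interval.
  Cosines stand for complex exponentials because the semigroup acts on real functions; the limiting
  integrand is even in lam up to its phase, which makes this harmless. The frequency is taken as lam
  / h, so that time h times the eigenvalue z / h is the argument z of the Bessel-type functions. In
  the recursion on k the last variable is integrated first; the earlier ones enter only through the
  pair at which the kernel of index k is evaluated.\<close>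

lemma selfadjoint_eigenvector:
  fixes A :: "'a::euclidean_space \<Rightarrow> 'a"
  assumes lin: "linear A" and sa: "\<And>x y. A x \<bullet> y = x \<bullet> A y"
    and N: "subspace N" "\<And>x. x \<in> N \<Longrightarrow> A x \<in> N" "w \<in> N" "w \<noteq> 0"
  obtains v c where "v \<in> N" "norm v = 1" "A v = c *\<^sub>R v"
proof -
  interpret A: linear A by fact
  let ?K = "N \<inter> sphere 0 1"
  \<comment> \<open>Maximise the Rayleigh quotient over the unit sphere of N. Only a real inner
    product is involved, so the same argument serves real symmetric matrices and Hermitian ones, the
    latter acting on complex vectors viewed as a real Euclidean space.\<close>
  have "compact ?K"
    using closed_subspace[OF N(1)] by (metis compact_sphere closed_Int_compact)
  moreover have "w /\<^sub>R norm w \<in> ?K"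
    using N by (auto intro: subspace_scale)
  moreover have "continuous_on ?K (\<lambda>x. A x \<bullet> x)"
    using lin by (intro continuous_intros linear_continuous_on) (simp add: linear_linear)
  ultimately obtain v where v: "v \<in> ?K" and max: "\<And>x. x \<in> ?K \<Longrightarrow> A x \<bullet> x \<le> A v \<bullet> v"
    using continuous_attains_sup[of ?K "\<lambda>x. A x \<bullet> x"] by blast
  define c where "c = A v \<bullet> v"
  have vN: "v \<in> N" "v \<bullet> v = 1" using v by (auto simp: norm_eq_1)
  have le: "A x \<bullet> x \<le> c * (x \<bullet> x)" if "x \<in> N" for x
  proof (cases "x = 0")
    case True then show ?thesis by (simp add: A.zero)
  next
    case False
    have "A (x /\<^sub>R norm x) \<bullet> (x /\<^sub>R norm x) \<le> c"
      unfolding c_def using that False N(1) by (intro max) (auto intro: subspace_scale)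
    then show ?thesis
      using False by (simp add: A.scaleR field_simps power2_norm_eq_inner[symmetric] power2_eq_square)
  qed
  \<comment> \<open>First variation: if A v - c v had a component along y, moving from v in
    direction y would raise the quotient to first order, while the loss is only quadratic in the
    step.\<close>
  have orth: "A v \<bullet> y = c * (v \<bullet> y)" if y: "y \<in> N" for y
  proof (rule ccontr)
    assume ne: "A v \<bullet> y \<noteq> c * (v \<bullet> y)"
    define b where "b = A v \<bullet> y - c * (v \<bullet> y)"
    define d where "d = c * (y \<bullet> y) - A y \<bullet> y"
    have q: "2 * t * b \<le> t\<^sup>2 * d" for t
    proof -
      have "A (v + t *\<^sub>R y) \<bullet> (v + t *\<^sub>R y) \<le> c * ((v + t *\<^sub>R y) \<bullet> (v + t *\<^sub>R y))"
        using N y vN by (intro le) (auto intro: subspace_add subspace_scale)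
      moreover have "A y \<bullet> v = A v \<bullet> y" "A v \<bullet> v = c" by (metis sa inner_commute) (simp add: c_def)
      ultimately show ?thesis
        using vN by (simp add: A.add A.scaleR inner_simps b_def d_def algebra_simps
            power2_eq_square inner_commute[of v y])
    qed
    have "b \<noteq> 0" using ne by (simp add: b_def)
    have "d \<ge> 0" using le[OF y] by (simp add: d_def)
    \<comment> \<open>The step b / d would be the optimal one in \<open>q\<close>; the added 1
      covers d = 0.\<close>
    have "2 * (b / (d + 1)) * b \<le> (b / (d+1))\<^sup>2 * d" by (rule q)
    also have "\<dots> \<le> (b / (d+1))\<^sup>2 * (d + 1)" by (intro mult_left_mono) auto
    also have "\<dots> = b\<^sup>2 / (d + 1)" using \<open>d \<ge> 0\<close> by (simp add: power2_eq_square)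
    finally have "2 * b\<^sup>2 / (d+1) \<le> b\<^sup>2 / (d+1)" by (simp add: power2_eq_square)
    then show False using \<open>b \<noteq> 0\<close> \<open>d \<ge> 0\<close> by (simp add: divide_le_cancel)
  qed
  have "A v - c *\<^sub>R v \<in> N" using N vN by (auto intro!: subspace_diff subspace_scale)
  from orth[OF this] have "(A v - c *\<^sub>R v) \<bullet> (A v - c *\<^sub>R v) = 0"
    by (simp add: inner_simps algebra_simps)
  then show thesis using that[of v c] v by auto
qed

section \<open>Real and complex spectral theorems\<close>

lemma inner_matrix_transpose: "((A::real^'n^'m) *v x) \<bullet> y = x \<bullet> (transpose A *v y)"
  using dot_lmul_matrix[of y A x] by (simp add: inner_commute)

text \<open>Deflation: the orthogonal complement of the eigenvectors already found is invariant by
  symmetry and nonzero by dimension, so it contains the next one. The count runs over the naturals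
  and is carried over to the index type at the end.\<close>

lemma real_spectral:
  fixes S :: "real^'n^'n"
  assumes sym: "transpose S = S"
  obtains e :: "'n \<Rightarrow> real^'n" and c where
    "\<And>i j. e i \<bullet> e j = (if i = j then 1 else 0)" "\<And>i. S *v e i = c i *\<^sub>R e i"
proof -
  have sa: "(S *v x) \<bullet> y = x \<bullet> (S *v y)" for x y
    using inner_matrix_transpose[of S x y] unfolding sym .
  have "\<exists>v c. (\<forall>i<k. \<forall>j<k. v i \<bullet> v j = (if i = j then 1 else 0)) \<and> (\<forall>i<k. S *v v i = c i *\<^sub>R v i)"
    if "k \<le> CARD('n)" for k :: nat using that
  proof (induction k)
    case (Suc k)
    then obtain v c where "(\<forall>i<k. \<forall>j<k. v i \<bullet> v j = (if i = j then 1 else 0)) \<and> (\<forall>i<k. S *v v i = c i *\<^sub>R v i)"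
      using Suc_leD by blast
    then have v: "\<And>i j. i < k \<Longrightarrow> j < k \<Longrightarrow> v i \<bullet> v j = (if i = j then 1 else 0)"
      "\<And>i. i < k \<Longrightarrow> S *v v i = c i *\<^sub>R v i" by blast+
    define N where "N = {x. \<forall>i<k. v i \<bullet> x = 0}"
    have "dim (v ` {..<k}) \<le> card (v ` {..<k})" by (rule dim_le_card) (auto intro: span_base)
    also have "\<dots> \<le> k" using card_image_le[of "{..<k}" v] by simp
    also have "k < DIM(real^'n)" using Suc.prems by simp
    finally obtain w where w: "w \<noteq> 0" "\<And>y. y \<in> span (v ` {..<k}) \<Longrightarrow> orthogonal w y"
      using orthogonal_to_subspace_exists by blast
    have "v i \<bullet> w = 0" if "i < k" for i
      using w(2)[of "v i"] that by (auto simp: orthogonal_def inner_commute span_base)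
    then have wN: "w \<in> N" by (simp add: N_def)
    have sub: "subspace N" by (auto simp: N_def subspace_def inner_simps)
    have inv: "S *v x \<in> N" if "x \<in> N" for x
      using that v(2) by (auto simp: N_def sa[symmetric])
    obtain u d where u: "u \<in> N" "norm u = 1" "S *v u = d *\<^sub>R u"
      by (rule selfadjoint_eigenvector[OF matrix_vector_mul_linear sa sub inv wN w(1)])
    show ?case
      by (rule exI[of _ "v(k := u)"], rule exI[of _ "c(k := d)"])
        (use u v in \<open>auto simp: less_Suc_eq N_def inner_commute norm_eq_1\<close>)
  qed auto
  from this[OF order_refl] obtain v c where v: "\<And>i j. i < CARD('n) \<Longrightarrow> j < CARD('n) \<Longrightarrow> v i \<bullet> v j = (if i = j then 1 else 0)"
      "\<And>i. i < CARD('n) \<Longrightarrow> S *v v i = c i *\<^sub>R v i" by blast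
  obtain h where h: "bij_betw h (UNIV::'n set) {0..<CARD('n)}"
    using ex_bij_betw_finite_nat[of "UNIV::'n set"] by auto
  have "h i < CARD('n)" "h i = h j \<longleftrightarrow> i = j" for i j
    using h by (auto simp: bij_betw_def inj_on_def)
  then show thesis by (intro that[of "\<lambda>i. v (h i)" "\<lambda>i. c (h i)"]) (auto simp: v)
qed

definition hinner :: "complex^'n \<Rightarrow> complex^'n \<Rightarrow> complex" where
  "hinner x y = (\<Sum>i\<in>UNIV. x $ i * cnj (y $ i))"

lemma Re_hinner: "Re (hinner x y) = x \<bullet> y"
  by (simp add: hinner_def inner_vec_def inner_complex_def)

text \<open>Together with \<open>Re_hinner\<close> this translates complex orthogonality to y into
  real orthogonality to y and to i y, the form in which dimension arguments in the real Euclidean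
  space apply.\<close>

lemma Im_hinner: "Im (hinner x y) = ((\<i> *s y) \<bullet> x)"
  by (simp add: hinner_def inner_vec_def inner_complex_def vector_scalar_mult_def algebra_simps)

lemma hinner_commute: "hinner y x = cnj (hinner x y)"
  by (simp add: hinner_def mult.commute)

text \<open>Deflation as in \<open>real_spectral\<close>. A Hermitian matrix is self-adjoint for the
  real inner product too, so its eigenvectors come with real eigenvalues; orthogonality, however,
  must be complex to yield a unitary matrix.\<close>

lemma hermitian_spectral:
  fixes A :: "complex^'n^'n"
  assumes A: "ctranspose A = A"
  obtains V d where "unitary V" "A = V ** diag_matrix d ** ctranspose V"
proof -
  have Aij: "cnj (A $ j $ i) = A $ i $ j" for i j
    using A by (metis (no_types, lifting) ctranspose_def vec_lambda_beta)
  have saH: "hinner (A *v x) y = hinner x (A *v y)" for x y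
  proof -
    have "hinner (A *v x) y = (\<Sum>i\<in>UNIV. \<Sum>j\<in>UNIV. A $ i $ j * x $ j * cnj (y $ i))"
      by (simp add: hinner_def matrix_vector_mult_def sum_distrib_right)
    also have "\<dots> = (\<Sum>j\<in>UNIV. \<Sum>i\<in>UNIV. x $ j * cnj (A $ j $ i * y $ i))"
      by (subst sum.swap) (simp add: Aij mult_ac)
    also have "\<dots> = hinner x (A *v y)"
      by (simp add: hinner_def matrix_vector_mult_def sum_distrib_left)
    finally show ?thesis .
  qed
  have sa: "(A *v x) \<bullet> y = x \<bullet> (A *v y)" for x y
    using arg_cong[OF saH[of x y], of Re] by (simp only: Re_hinner)
  have lin: "linear (\<lambda>x. A *v x)"
    by (rule linearI, rule matrix_vector_right_distrib)
      (simp add: vec_eq_iff matrix_vector_mult_def scaleR_sum_right)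
  have "\<exists>v c. (\<forall>i<k. \<forall>j<k. hinner (v i) (v j) = (if i = j then 1 else 0)) \<and> (\<forall>i<k. A *v v i = (c i::real) *\<^sub>R v i)"
    if "k \<le> CARD('n)" for k :: nat using that
  proof (induction k)
    case (Suc k)
    then obtain v and c :: "nat \<Rightarrow> real" where "(\<forall>i<k. \<forall>j<k. hinner (v i) (v j) = (if i = j then 1 else 0)) \<and> (\<forall>i<k. A *v v i = c i *\<^sub>R v i)"
      using Suc_leD by blast
    then have v: "\<And>i j. i < k \<Longrightarrow> j < k \<Longrightarrow> hinner (v i) (v j) = (if i = j then 1 else 0)"
      "\<And>i. i < k \<Longrightarrow> A *v v i = c i *\<^sub>R v i" by blast+
    define N where "N = {x. \<forall>i<k. hinner x (v i) = 0}"
    \<comment> \<open>Complex orthogonality to k vectors amounts to 2 k real conditions, fewer than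
      the real dimension 2 n.\<close>
    let ?B = "v ` {..<k} \<union> (\<lambda>i. \<i> *s v i) ` {..<k}"
    have "dim ?B \<le> card ?B" by (rule dim_le_card) (auto intro: span_base)
    also have "\<dots> \<le> card (v ` {..<k}) + card ((\<lambda>i. \<i> *s v i) ` {..<k})" by (rule card_Un_le)
    also have "\<dots> \<le> k + k"
      using card_image_le[of "{..<k}" v] card_image_le[of "{..<k}" "\<lambda>i. \<i> *s v i"] by simp
    also have "\<dots> < DIM(complex^'n)" using Suc.prems by simp
    finally obtain w where w: "w \<noteq> 0" "\<And>y. y \<in> span ?B \<Longrightarrow> orthogonal w y"
      using orthogonal_to_subspace_exists by blast
    have "w \<bullet> v i = 0" "(\<i> *s v i) \<bullet> w = 0" if "i < k" for i
      using w(2)[of "v i"] w(2)[of "\<i> *s v i"] that by (auto simp: orthogonal_def inner_commute span_base)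
    then have wN: "w \<in> N" by (simp add: N_def complex_eq_iff Re_hinner Im_hinner)
    have sub: "subspace N"
      by (auto simp: N_def subspace_def hinner_def ring_distribs sum.distrib
          scaleR_sum_right[symmetric])
    have inv: "A *v x \<in> N" if "x \<in> N" for x
    proof -
      have "hinner x (d *\<^sub>R y) = of_real d * hinner x y" for d y
        by (simp add: hinner_def sum_distrib_left scaleR_conv_of_real[where 'a=complex] mult_ac)
      then show ?thesis using that v(2) by (simp add: N_def saH)
    qed
    obtain u d where u: "u \<in> N" "norm u = 1" "A *v u = d *\<^sub>R u"
      by (rule selfadjoint_eigenvector[OF lin sa sub inv wN w(1)])
    have uu: "hinner u u = 1"
    proof -
      have "Im (hinner u u) = 0" using hinner_commute[of u u] by (metis cnj.sel(2) eq_neg_iff_add_eq_0 neg_equal_zero)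
      then show ?thesis using u(2) by (simp add: complex_eq_iff Re_hinner norm_eq_1)
    qed
    have uv: "hinner u (v i) = 0" "hinner (v i) u = 0" if "i < k" for i
      using u(1) that hinner_commute[of u "v i"] hinner_commute[of "v i" u] by (auto simp: N_def)
    show ?case
      by (rule exI[of _ "v(k := u)"], rule exI[of _ "c(k := d)"])
        (use u v uu uv in \<open>auto simp: less_Suc_eq\<close>)
  qed auto
  from this[OF order_refl] obtain v and c :: "nat \<Rightarrow> real" where v: "\<And>i j. i < CARD('n) \<Longrightarrow> j < CARD('n) \<Longrightarrow> hinner (v i) (v j) = (if i = j then 1 else 0)"
      "\<And>i. i < CARD('n) \<Longrightarrow> A *v v i = c i *\<^sub>R v i" by blast
  obtain h where h: "bij_betw h (UNIV::'n set) {0..<CARD('n)}"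
    using ex_bij_betw_finite_nat[of "UNIV::'n set"] by auto
  have hh: "h i < CARD('n)" "h i = h j \<longleftrightarrow> i = j" for i j
    using h by (auto simp: bij_betw_def inj_on_def)
  define V :: "complex^'n^'n" where "V = (\<chi> a b. v (h b) $ a)"
  have "ctranspose V ** V = mat 1"
  proof -
    have "(ctranspose V ** V) $ a $ b = hinner (v (h b)) (v (h a))" for a b
      by (simp add: V_def ctranspose_def matrix_matrix_mult_def hinner_def mult.commute)
    then show ?thesis using v(1) hh by (auto simp: vec_eq_iff mat_def)
  qed
  then have V: "unitary V" by (simp add: unitary_def matrix_left_right_inverse)
  have "A ** V = V ** diag_matrix (\<lambda>i. c (h i))"
  proof -
    have "(A ** V) $ a $ b = (A *v v (h b)) $ a" for a b
      by (simp add: V_def matrix_matrix_mult_def matrix_vector_mult_def)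
    moreover have "(V ** diag_matrix (\<lambda>i. c (h i))) $ a $ b = (c (h b) *\<^sub>R v (h b)) $ a" for a b
      by (simp add: V_def matrix_matrix_mult_def diag_matrix_def if_distrib[of "\<lambda>x. _ * x"] sum.delta
          scaleR_conv_of_real[where 'a=complex] cong: if_cong)
    ultimately show ?thesis using v(2) hh by (simp add: vec_eq_iff)
  qed
  then have "A = V ** diag_matrix (\<lambda>i. c (h i)) ** ctranspose V"
    using V unfolding unitary_def by (metis matrix_mul_assoc matrix_mul_rid)
  with V show thesis by (rule that)
qed

text \<open>The matrix X intertwines the two diagonal matrices, so an entry of X can be nonzero only
  where the two eigenvalues agree, and there the values of f agree as well. Hence the functional
  calculus does not depend on the diagonalisation, for arbitrary f.\<close>

lemma diag_conj_cong:
  fixes V V' :: "complex^'n^'n"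
  assumes V: "unitary V" "unitary V'"
    and eq: "V ** diag_matrix d ** ctranspose V = V' ** diag_matrix d' ** ctranspose V'"
  shows "V ** diag_matrix (\<lambda>i. f (d i)) ** ctranspose V = V' ** diag_matrix (\<lambda>i. f (d' i)) ** ctranspose V'"
proof -
  define X where "X = ctranspose V' ** V"
  have dl: "(diag_matrix g ** Y) $ i $ j = of_real (g i) * Y $ i $ j"
    and dr: "(Y ** diag_matrix g) $ i $ j = Y $ i $ j * of_real (g j)" for g and Y :: "complex^'n^'n" and i j
    by (simp_all add: matrix_matrix_mult_def diag_matrix_def if_distrib[of "\<lambda>x. x * _"]
        if_distrib[of "\<lambda>x. _ * x"] cong: if_cong)
  have c: "ctranspose V' ** (V ** diag_matrix d ** ctranspose V) ** V = X ** diag_matrix d"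
    using V unfolding unitary_def X_def by (metis matrix_mul_assoc matrix_mul_rid)
  have "ctranspose V' ** (V' ** diag_matrix d' ** ctranspose V') ** V = diag_matrix d' ** X"
    using V unfolding unitary_def X_def by (metis matrix_mul_assoc matrix_mul_lid)
  then have "X ** diag_matrix d = diag_matrix d' ** X" using c eq by simp
  then have "X $ i $ j * of_real (d j) = of_real (d' i) * X $ i $ j" for i j
    by (metis dl dr)
  then have "X $ i $ j = 0 \<or> d j = d' i" for i j
    by (metis mult.commute mult_cancel_left of_real_eq_iff)
  then have "X $ i $ j * of_real (f (d j)) = of_real (f (d' i)) * X $ i $ j" for i j
    by (metis mult.commute mult_zero_left)
  then have X: "X ** diag_matrix (\<lambda>i. f (d i)) = diag_matrix (\<lambda>i. f (d' i)) ** X"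
    by (simp add: vec_eq_iff dl dr)
  have "V' ** (X ** diag_matrix (\<lambda>i. f (d i))) ** ctranspose V = V ** diag_matrix (\<lambda>i. f (d i)) ** ctranspose V"
    using V unfolding unitary_def X_def by (metis matrix_mul_assoc matrix_mul_lid)
  moreover have "V' ** (diag_matrix (\<lambda>i. f (d' i)) ** X) ** ctranspose V = V' ** diag_matrix (\<lambda>i. f (d' i)) ** ctranspose V'"
    using V unfolding unitary_def X_def by (metis matrix_mul_assoc matrix_mul_rid)
  ultimately show ?thesis using X by simp
qed

lemma matrix_fun_diag:
  assumes "unitary V" "A = V ** diag_matrix d ** ctranspose V"
  shows "matrix_fun f A = V ** diag_matrix (\<lambda>i. f (d i)) ** ctranspose V"
  unfolding matrix_fun_def
proof (rule the_equality)
  show "\<exists>V' d'. unitary V' \<and> A = V' ** diag_matrix d' ** ctranspose V' \<and>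
     V ** diag_matrix (\<lambda>i. f (d i)) ** ctranspose V = V' ** diag_matrix (\<lambda>i. f (d' i)) ** ctranspose V'"
    using assms by blast
next
  fix B assume "\<exists>V' d'. unitary V' \<and> A = V' ** diag_matrix d' ** ctranspose V' \<and>
     B = V' ** diag_matrix (\<lambda>i. f (d' i)) ** ctranspose V'"
  then show "B = V ** diag_matrix (\<lambda>i. f (d i)) ** ctranspose V"
    using diag_conj_cong[OF _ assms(1)] assms(2) by metis
qed

lemma unitary_mul_cancel:
  assumes "unitary V"
  shows "(V ** D ** ctranspose V) ** (V ** E ** ctranspose V) = V ** (D ** E) ** ctranspose V"
  using assms unfolding unitary_def by (metis matrix_mul_assoc matrix_mul_rid)

lemma diag_matrix_mul: "diag_matrix d ** diag_matrix e = diag_matrix (\<lambda>i. d i * e i)"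
  by (simp add: vec_eq_iff diag_matrix_def matrix_matrix_mult_def if_distrib[of "\<lambda>x. x * _"] cong: if_cong)

lemma conj_diag_nth:
  "(V ** diag_matrix d ** ctranspose V) $ a $ b = (\<Sum>i\<in>UNIV. V $ a $ i * of_real (d i) * cnj (V $ b $ i))"
  by (simp add: matrix_matrix_mult_def diag_matrix_def ctranspose_def if_distrib[of "\<lambda>x. _ * x"]
      cong: if_cong)

lemma det_conj_diag:
  fixes V :: "complex^'n^'n"
  assumes "unitary V"
  shows "det (V ** diag_matrix d ** ctranspose V) = of_real (\<Prod>i\<in>UNIV. d i)"
proof -
  have "det V * det (ctranspose V) = 1"
    using assms by (metis unitary_def det_I det_mul)
  moreover have "det (diag_matrix d :: complex^'n^'n) = of_real (\<Prod>i\<in>UNIV. d i)"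
    by (subst det_diagonal) (auto simp: diag_matrix_def)
  ultimately show ?thesis by (simp add: det_mul mult_ac)
qed

text \<open>Orthonormal eigenbasis \<open>e\<close> of \<open>- W\<^sup>2 = W\<^sup>T W\<close> with eigenvalues \<open>z\<^sup>2\<close>; even functions of the Hermitian
  matrix \<open>\<i> W\<close> are diagonal in this real basis.\<close>

definition frame :: "real^'q^'q \<Rightarrow> ('q \<Rightarrow> real^'q) \<Rightarrow> ('q \<Rightarrow> real) \<Rightarrow> bool" where
  "frame W e z \<longleftrightarrow> transpose W = - W \<and> (\<forall>i j. e i \<bullet> e j = (if i = j then 1 else 0)) \<and> (\<forall>i. 0 \<le> z i) \<and>
     (\<forall>i. transpose W *v (W *v e i) = (z i)\<^sup>2 *\<^sub>R e i)"

lemma frame_exists: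
  fixes W :: "real^'q^'q"
  assumes "transpose W = - W"
  obtains e z where "frame W e z"
proof -
  have "transpose (transpose W ** W) = transpose W ** W"
    by (simp add: matrix_transpose_mul)
  then obtain e c where e: "\<And>i j. e i \<bullet> e j = (if i = j then 1 else 0)"
     "\<And>i::'q. (transpose W ** W) *v e i = c i *\<^sub>R e i" by (rule real_spectral) blast
  have "c i \<ge> 0" for i
  proof -
    have "c i = ((transpose W ** W) *v e i) \<bullet> e i" by (simp add: e)
    also have "\<dots> = (W *v e i) \<bullet> (W *v e i)"
      using inner_matrix_transpose[of W "e i" "W *v e i"]
      by (simp add: matrix_vector_mul_assoc[symmetric] inner_commute)
    finally show ?thesis by simp
  qed
  then have "frame W e (\<lambda>i. sqrt (c i))" using assms e by (simp add: frame_def matrix_vector_mul_assoc)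
  then show thesis by (rule that)
qed

section \<open>Quadratic forms in an eigenbasis of W^T W\<close>

context
  fixes W :: "real^'q^'q" and e z
  assumes fr: "frame W e z"
begin

lemma frame_orthonormal: "e i \<bullet> e j = (if i = j then 1 else 0)"
  using fr by (simp add: frame_def)

lemma frame_complete: "(\<Sum>i\<in>UNIV. e i $ a * e i $ b) = (if a = b then 1 else 0)"
proof -
  define E where "E = (\<chi> a i. e i $ a)"
  have "transpose E ** E = mat 1"
    using frame_orthonormal
    by (simp add: E_def transpose_def matrix_matrix_mult_def mat_def vec_eq_iff inner_vec_def)
  then have "E ** transpose E = mat 1" using matrix_left_right_inverse by blast
  then have "(E ** transpose E) $ a $ b = mat 1 $ a $ b" by simp
  then show ?thesis by (simp add: E_def transpose_def matrix_matrix_mult_def mat_def)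
qed

lemma frame_expand: "x = (\<Sum>i\<in>UNIV. (e i \<bullet> x) *\<^sub>R e i)"
proof -
  have "(\<Sum>i\<in>UNIV. (e i \<bullet> x) *\<^sub>R e i) $ b = x $ b" for b
  proof -
    have "(\<Sum>i\<in>UNIV. (e i \<bullet> x) *\<^sub>R e i) $ b = (\<Sum>i\<in>UNIV. \<Sum>a\<in>UNIV. x $ a * (e i $ a * e i $ b))"
      by (simp add: inner_vec_def sum_distrib_right sum_distrib_left mult_ac)
    also have "\<dots> = (\<Sum>a\<in>UNIV. x $ a * (\<Sum>i\<in>UNIV. e i $ a * e i $ b))"
      by (subst sum.swap) (simp add: sum_distrib_left)
    also have "\<dots> = x $ b" by (simp add: frame_complete if_distrib[of "\<lambda>x. _ * x"] cong: if_cong)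
    finally show ?thesis .
  qed
  then show ?thesis by (simp add: vec_eq_iff)
qed

lemma frame_inner: "x \<bullet> y = (\<Sum>i\<in>UNIV. (e i \<bullet> x) * (e i \<bullet> y))"
  by (subst frame_expand[of x]) (simp add: inner_sum_left)

lemma frame_skew: "(W *v x) \<bullet> y = - (x \<bullet> (W *v y))"
proof -
  have "(W *v x) \<bullet> y = x \<bullet> (transpose W *v y)"
    by (rule inner_matrix_transpose)
  also have "transpose W *v y = - (W *v y)"
    using fr by (simp add: frame_def vec_eq_iff matrix_vector_mult_def sum_negf)
  finally show ?thesis by simp
qed

lemma frame_norm: "(W *v x) \<bullet> (W *v y) = (\<Sum>i\<in>UNIV. (z i)\<^sup>2 * (e i \<bullet> x) * (e i \<bullet> y))"
proof -
  have W2: "(W *v e i) \<bullet> (W *v y) = (z i)\<^sup>2 * (e i \<bullet> y)" for i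
  proof -
    have "transpose W *v (W *v e i) = (z i)\<^sup>2 *\<^sub>R e i" using fr unfolding frame_def by blast
    then show ?thesis
      using inner_matrix_transpose[of W y "W *v e i"] by (simp add: inner_commute)
  qed
  have "W *v x = W *v (\<Sum>i\<in>UNIV. (e i \<bullet> x) *\<^sub>R e i)" using frame_expand[of x] by simp
  also have "\<dots> = (\<Sum>i\<in>UNIV. (e i \<bullet> x) *\<^sub>R (W *v e i))"
    by (simp add: linear_sum[OF matrix_vector_mul_linear] matrix_vector_mult_scaleR)
  finally have "W *v x = (\<Sum>i\<in>UNIV. (e i \<bullet> x) *\<^sub>R (W *v e i))" .
  then show ?thesis by (simp add: inner_sum_left W2 mult_ac)
qed

text \<open>W commutes with its own square, hence preserves the eigenspaces of W^T W. Entrywise this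
  comes from evaluating the inner product of W e_i and W W e_j in two ways, one producing z_i^2 and
  the other z_j^2.\<close>

lemma frame_commute: "((z i)\<^sup>2 - (z j)\<^sup>2) * (e i \<bullet> (W *v e j)) = 0"
proof -
  have "(W *v e i) \<bullet> (W *v (W *v e j)) = (z i)\<^sup>2 * (e i \<bullet> (W *v e j))"
    by (simp add: frame_norm frame_orthonormal if_distrib[of "\<lambda>x. x * _"] if_distrib[of "\<lambda>x. _ * x"] cong: if_cong)
  moreover have "(W *v e i) \<bullet> (W *v (W *v e j)) = - ((W *v (W *v e i)) \<bullet> (W *v e j))"
    by (simp add: frame_skew)
  moreover have "(W *v (W *v e i)) \<bullet> (W *v e j) = (z j)\<^sup>2 * (e j \<bullet> (W *v e i))"
    by (simp add: frame_norm frame_orthonormal if_distrib[of "\<lambda>x. x * _"] if_distrib[of "\<lambda>x. _ * x"] cong: if_cong)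
  moreover have "e j \<bullet> (W *v e i) = - (e i \<bullet> (W *v e j))"
    by (metis frame_skew inner_commute)
  ultimately show ?thesis by (auto simp: algebra_simps)
qed

text \<open>Nonnegativity of z turns equal squares into equal arguments. So f(Z), with Z the square
  root of W^T W, commutes with W for any f.\<close>

lemma frame_commute_fun: "f (z i) * (e i \<bullet> (W *v e j)) = f (z j) * (e i \<bullet> (W *v e j))"
proof -
  have "z i = z j \<or> e i \<bullet> (W *v e j) = 0"
    using frame_commute[of i j] fr by (auto simp: frame_def power2_eq_iff_nonneg)
  then show ?thesis by auto
qed

lemma frame_eW: "e i \<bullet> (W *v x) = (\<Sum>j\<in>UNIV. (e j \<bullet> x) * (e i \<bullet> (W *v e j)))"
  by (subst frame_expand[of x])
    (simp add: linear_sum[OF matrix_vector_mul_linear] linear_scale[OF matrix_vector_mul_linear] inner_sum_right)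

text \<open>f(Z) commutes with W, and W^T W = Z^2. This produces the factor z^2 of
  \<open>R_fun\<close> when the square is completed in the recursion.\<close>

lemma frame_quad_W:
  "(\<Sum>i\<in>UNIV. f (z i) * (e i \<bullet> (W *v x))\<^sup>2) = (\<Sum>i\<in>UNIV. (z i)\<^sup>2 * f (z i) * (e i \<bullet> x)\<^sup>2)"
proof -
  have "(\<Sum>i\<in>UNIV. f (z i) * (e i \<bullet> (W *v x))\<^sup>2)
      = (\<Sum>i\<in>UNIV. \<Sum>j\<in>UNIV. f (z i) * (e i \<bullet> (W *v e j)) * (e j \<bullet> x) * (e i \<bullet> (W *v x)))"
    unfolding power2_eq_square by (subst frame_eW) (simp add: sum_distrib_left sum_distrib_right mult_ac)
  also have "\<dots> = (\<Sum>i\<in>UNIV. \<Sum>j\<in>UNIV. f (z j) * (e j \<bullet> x) * ((e i \<bullet> (W *v e j)) * (e i \<bullet> (W *v x))))"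
  proof (intro sum.cong refl)
    fix i j
    show "f (z i) * (e i \<bullet> (W *v e j)) * (e j \<bullet> x) * (e i \<bullet> (W *v x))
        = f (z j) * (e j \<bullet> x) * ((e i \<bullet> (W *v e j)) * (e i \<bullet> (W *v x)))"
      using frame_commute_fun[of f i j] by auto
  qed
  also have "\<dots> = (\<Sum>j\<in>UNIV. f (z j) * (e j \<bullet> x) * ((W *v e j) \<bullet> (W *v x)))"
    by (subst sum.swap) (simp add: frame_inner[of "W *v _"] sum_distrib_left)
  also have "\<dots> = (\<Sum>i\<in>UNIV. (z i)\<^sup>2 * f (z i) * (e i \<bullet> x)\<^sup>2)"
    by (simp add: frame_norm frame_orthonormal if_distrib[of "\<lambda>x. x * _"] if_distrib[of "\<lambda>x. _ * x"]
        power2_eq_square mult_ac cong: if_cong)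
  finally show ?thesis .
qed

text \<open>f(Z) W is skew-symmetric, being the product of a symmetric and a skew matrix that
  commute. It removes the sine term from the sub-Laplacian of the explicit solutions.\<close>

lemma frame_skew_zero:
  "(\<Sum>i\<in>UNIV. f (z i) * (e i \<bullet> x) * (e i \<bullet> (W *v x))) = 0" (is "?S = 0")
proof -
  have *: "?S = (\<Sum>i\<in>UNIV. \<Sum>j\<in>UNIV. f (z i) * (e i \<bullet> (W *v e j)) * (e i \<bullet> x) * (e j \<bullet> x))"
    by (subst frame_eW) (simp add: sum_distrib_left mult_ac)
  also have "\<dots> = (\<Sum>i\<in>UNIV. \<Sum>j\<in>UNIV. f (z j) * (e i \<bullet> (W *v e j)) * (e i \<bullet> x) * (e j \<bullet> x))"
  proof (intro sum.cong refl)
    fix i j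
    show "f (z i) * (e i \<bullet> (W *v e j)) * (e i \<bullet> x) * (e j \<bullet> x)
        = f (z j) * (e i \<bullet> (W *v e j)) * (e i \<bullet> x) * (e j \<bullet> x)"
      using frame_commute_fun[of f i j] by simp
  qed
  also have "\<dots> = (\<Sum>i\<in>UNIV. \<Sum>j\<in>UNIV. - (f (z j) * (e j \<bullet> (W *v e i)) * (e j \<bullet> x) * (e i \<bullet> x)))"
  proof (intro sum.cong refl)
    fix i j
    have "e i \<bullet> (W *v e j) = - (e j \<bullet> (W *v e i))" by (metis frame_skew inner_commute)
    then show "f (z j) * (e i \<bullet> (W *v e j)) * (e i \<bullet> x) * (e j \<bullet> x)
        = - (f (z j) * (e j \<bullet> (W *v e i)) * (e j \<bullet> x) * (e i \<bullet> x))" by simp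
  qed
  also have "\<dots> = - ?S" unfolding * by (subst sum.swap) (simp add: sum_negf)
  finally show ?thesis by simp
qed

text \<open>Both sides are the squared Hilbert-Schmidt norm of W. The right one is a quadratic form
  in the entries, so it can be bounded below in lam although the z_i are not explicit.\<close>

lemma frame_trace: "(\<Sum>i\<in>UNIV. (z i)\<^sup>2) = (\<Sum>a\<in>UNIV. \<Sum>b\<in>UNIV. (W $ a $ b)\<^sup>2)"
proof -
  have "(\<Sum>i\<in>UNIV. (z i)\<^sup>2) = (\<Sum>i\<in>UNIV. \<Sum>b\<in>UNIV. (z i)\<^sup>2 * (e i \<bullet> axis b 1) * (e i \<bullet> axis b 1))"
  proof -
    have "(\<Sum>b\<in>UNIV. (e i \<bullet> axis b 1) * (e i \<bullet> axis b 1)) = 1" for i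
      using frame_orthonormal[of i i] by (simp add: inner_axis) (simp add: inner_vec_def)
    then show ?thesis by (simp add: mult.assoc sum_distrib_left[symmetric])
  qed
  also have "\<dots> = (\<Sum>b\<in>UNIV. (W *v axis b 1) \<bullet> (W *v axis b 1))"
    by (subst sum.swap) (simp add: frame_norm)
  also have "\<dots> = (\<Sum>b\<in>UNIV. \<Sum>a\<in>UNIV. (W $ a $ b)\<^sup>2)"
    by (simp add: inner_vec_def matrix_vector_mult_basis column_def power2_eq_square)
  finally show ?thesis by (subst sum.swap)
qed

lemma frame_unitary: "unitary (\<chi> a i. complex_of_real (e i $ a))" (is "unitary ?O")
proof -
  have "(ctranspose ?O ** ?O) $ i $ j = of_real (e i \<bullet> e j)" for i j
    by (simp add: ctranspose_def matrix_matrix_mult_def inner_vec_def)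
  then have "ctranspose ?O ** ?O = mat 1" by (simp add: vec_eq_iff mat_def frame_orthonormal)
  then show ?thesis by (simp add: unitary_def matrix_left_right_inverse)
qed

text \<open>An even function of the Hermitian matrix i W is a function of its square. That square is
  the real symmetric matrix W^T W and is diagonal in the real frame, which i W itself in general is
  not.\<close>

lemma matrix_fun_frame:
  assumes even: "\<And>x. f (- x) = f x"
  shows "matrix_fun f (\<chi> a b. \<i> * of_real (W $ a $ b)) =
    (\<chi> a i. of_real (e i $ a)) ** diag_matrix (\<lambda>i. f (z i)) ** ctranspose (\<chi> a i. of_real (e i $ a))"
proof -
  define A where "A = (\<chi> a b. \<i> * of_real (W $ a $ b))"
  define O' where "O' = (\<chi> a i. complex_of_real (e i $ a))"
  have skew: "W $ b $ a = - (W $ a $ b)" for a b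
  proof -
    have "transpose W $ a $ b = (- W) $ a $ b" using fr by (simp only: frame_def)
    then show ?thesis by (simp add: transpose_def)
  qed
  have "ctranspose A $ a $ b = A $ a $ b" for a b
    using skew[of a b] by (simp add: A_def ctranspose_def)
  then have "ctranspose A = A" by (simp add: vec_eq_iff)
  then obtain V d where V: "unitary V" "A = V ** diag_matrix d ** ctranspose V"
    by (rule hermitian_spectral) blast
  have O: "unitary O'" unfolding O'_def by (rule frame_unitary)
  have "A ** A = V ** diag_matrix (\<lambda>i. (d i)\<^sup>2) ** ctranspose V"
    using unitary_mul_cancel[OF V(1)] V(2) by (simp add: diag_matrix_mul power2_eq_square)
  moreover have "A ** A = O' ** diag_matrix (\<lambda>i. (z i)\<^sup>2) ** ctranspose O'"
  proof -
    have "(A ** A) $ a $ b = of_real (\<Sum>c\<in>UNIV. W $ c $ a * W $ c $ b)" for a b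
    proof -
      have "(A ** A) $ a $ b = (\<Sum>c\<in>UNIV. \<i> * of_real (W $ a $ c) * (\<i> * of_real (W $ c $ b)))"
        by (simp add: A_def matrix_matrix_mult_def)
      also have "\<dots> = (\<Sum>c\<in>UNIV. of_real (W $ c $ a * W $ c $ b))"
      proof (rule sum.cong[OF refl])
        fix c show "\<i> * complex_of_real (W $ a $ c) * (\<i> * of_real (W $ c $ b)) = of_real (W $ c $ a * W $ c $ b)"
          using skew[of a c] by (simp add: algebra_simps)
      qed
      finally show ?thesis by simp
    qed
    moreover have "(\<Sum>c\<in>UNIV. W $ c $ a * W $ c $ b) = (W *v axis a 1) \<bullet> (W *v axis b 1)" for a b
      by (simp add: inner_vec_def matrix_vector_mult_basis column_def)
    ultimately show ?thesis
      by (simp add: vec_eq_iff conj_diag_nth frame_norm O'_def inner_axis mult_ac)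
  qed
  ultimately have "V ** diag_matrix (\<lambda>i. f (sqrt ((d i)\<^sup>2))) ** ctranspose V
      = O' ** diag_matrix (\<lambda>i. f (sqrt ((z i)\<^sup>2))) ** ctranspose O'"
    using diag_conj_cong[OF V(1) O, of "\<lambda>i. (d i)\<^sup>2" "\<lambda>i. (z i)\<^sup>2" "\<lambda>r. f (sqrt r)"] by simp
  moreover have "f (sqrt (x\<^sup>2)) = f x" for x
    by (cases "x \<ge> 0") (use even[of x] in auto)
  ultimately have "V ** diag_matrix (\<lambda>i. f (d i)) ** ctranspose V = O' ** diag_matrix (\<lambda>i. f (z i)) ** ctranspose O'"
    by (simp only:)
  then show ?thesis
    using matrix_fun_diag[OF V] by (simp only: A_def O'_def)
qed

lemma det_matrix_fun_frame:
  assumes even: "\<And>x. f (- x) = f x"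
  shows "det (matrix_fun f (\<chi> a b. \<i> * of_real (W $ a $ b))) = of_real (\<Prod>i\<in>UNIV. f (z i))"
  by (subst matrix_fun_frame[of f, OF even]) (rule det_conj_diag[OF frame_unitary])

lemma quad_form_matrix_fun_frame:
  assumes even: "\<And>x. f (- x) = f x"
  shows "quad_form (matrix_fun f (\<chi> a b. \<i> * of_real (W $ a $ b))) x = of_real (\<Sum>i\<in>UNIV. f (z i) * (e i \<bullet> x)\<^sup>2)"
proof -
  have "quad_form (matrix_fun f (\<chi> a b. \<i> * of_real (W $ a $ b))) x
     = (\<Sum>a\<in>UNIV. \<Sum>b\<in>UNIV. \<Sum>i\<in>UNIV. of_real (f (z i) * (e i $ a * x $ a) * (e i $ b * x $ b)))"
    by (subst matrix_fun_frame[of f, OF even])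
      (simp add: quad_form_def matrix_vector_mult_def conj_diag_nth sum_distrib_right sum_distrib_left mult_ac)
  also have "\<dots> = (\<Sum>a\<in>UNIV. \<Sum>i\<in>UNIV. \<Sum>b\<in>UNIV. of_real (f (z i) * (e i $ a * x $ a) * (e i $ b * x $ b)))"
    by (intro sum.cong refl sum.swap)
  also have "\<dots> = (\<Sum>i\<in>UNIV. \<Sum>a\<in>UNIV. \<Sum>b\<in>UNIV. of_real (f (z i) * (e i $ a * x $ a) * (e i $ b * x $ b)))"
    by (rule sum.swap)
  also have "\<dots> = of_real (\<Sum>i\<in>UNIV. f (z i) * (e i \<bullet> x)\<^sup>2)"
    by (simp add: inner_vec_def power2_eq_square sum_distrib_left sum_distrib_right mult_ac)
  finally show ?thesis .
qed

end

section \<open>The linear family W(lam)\<close>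

definition W_mat :: "('m::finite \<Rightarrow> real^'q^'q) \<Rightarrow> real^'m \<Rightarrow> real^'q^'q" where
  "W_mat U lam = (\<Sum>j\<in>UNIV. lam $ j *\<^sub>R U j)"

lemma W_mat_nth: "W_mat U lam $ a $ b = (\<Sum>j\<in>UNIV. lam $ j * U j $ a $ b)"
  by (simp add: W_mat_def)

lemma U_mat_eq: "U_mat U lam = (\<chi> a b. \<i> * of_real (W_mat U lam $ a $ b))"
  by (simp add: U_mat_def W_mat_nth)

lemma W_mat_skew:
  assumes "step_two U"
  shows "transpose (W_mat U lam) = - W_mat U lam"
proof -
  have U: "U j $ b $ a = - (U j $ a $ b)" for j a b
  proof -
    have "transpose (U j) $ a $ b = (- U j) $ a $ b" using assms by (simp only: step_two_def)
    then show ?thesis by (simp add: transpose_def)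
  qed
  have "W_mat U lam $ b $ a = - (W_mat U lam $ a $ b)" for a b
    unfolding W_mat_nth by (subst U) (simp add: sum_negf)
  then have "transpose (W_mat U lam) $ a $ b = (- W_mat U lam) $ a $ b" for a b
    unfolding transpose_def vec_lambda_beta vector_uminus_component .
  then show ?thesis by (simp add: vec_eq_iff)
qed

text \<open>Moves the bracket to the Fourier side: a central shift by a bracket, paired with lam, is
  a linear form in y with coefficient vector W(lam) x.\<close>

lemma bracket_inner: "bracket U x y \<bullet> lam = (W_mat U lam *v x) \<bullet> y"
proof -
  have "bracket U x y \<bullet> lam = (\<Sum>j\<in>UNIV. \<Sum>a\<in>UNIV. \<Sum>b\<in>UNIV. lam $ j * U j $ a $ b * x $ b * y $ a)"
    by (simp add: bracket_def inner_vec_def matrix_vector_mult_def sum_distrib_left sum_distrib_right mult_ac)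
  also have "\<dots> = (\<Sum>a\<in>UNIV. \<Sum>j\<in>UNIV. \<Sum>b\<in>UNIV. lam $ j * U j $ a $ b * x $ b * y $ a)"
    by (rule sum.swap)
  also have "\<dots> = (\<Sum>a\<in>UNIV. \<Sum>b\<in>UNIV. \<Sum>j\<in>UNIV. lam $ j * U j $ a $ b * x $ b * y $ a)"
    by (intro sum.cong refl sum.swap)
  also have "\<dots> = (W_mat U lam *v x) \<bullet> y"
    by (simp add: inner_vec_def matrix_vector_mult_def W_mat_nth sum_distrib_left sum_distrib_right mult_ac)
  finally show ?thesis .
qed

text \<open>Linear independence of the U_j makes lam -> W(lam) injective, and an injective linear
  map in finite dimension is bounded below. This makes the integrals over lam converge.\<close>

lemma W_mat_coercive:
  fixes U :: "'m::finite \<Rightarrow> real^'q^'q"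
  assumes "step_two U"
  obtains c where "0 < c" "\<And>lam. c * (norm lam)\<^sup>2 \<le> (\<Sum>a\<in>UNIV. \<Sum>b\<in>UNIV. (W_mat U lam $ a $ b)\<^sup>2)"
proof -
  have lin: "linear (W_mat U)"
    by (rule linearI) (simp_all add: W_mat_def scaleR_left_distrib sum.distrib scaleR_sum_right)
  have "lam = 0" if "W_mat U lam = 0" for lam
  proof -
    have ind: "independent (range U)" "inj U" using assms by (auto simp: step_two_def)
    have "(\<Sum>v\<in>range U. lam $ (inv U v) *\<^sub>R v) = (\<Sum>j\<in>UNIV. lam $ j *\<^sub>R U j)"
      using ind(2) by (subst sum.reindex) auto
    then have "(\<Sum>v\<in>range U. lam $ (inv U v) *\<^sub>R v) = 0" using that by (simp add: W_mat_def)
    then have "\<forall>v\<in>range U. lam $ (inv U v) = 0"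
      using independentD[OF ind(1), of "range U" "\<lambda>v. lam $ (inv U v)"] by auto
    then have "lam $ j = 0" for j using ind(2) by auto
    then show ?thesis by (simp add: vec_eq_iff)
  qed
  then have "inj (W_mat U)" using lin linear_injective_0 by blast
  then obtain B where B: "B > 0" "\<And>lam. B * norm lam \<le> norm (W_mat U lam)"
    using linear_inj_bounded_below_pos[OF lin] by blast
  show thesis
  proof (rule that[of "B\<^sup>2"])
    show "0 < B\<^sup>2" using B by simp
    fix lam
    have "B\<^sup>2 * (norm lam)\<^sup>2 \<le> (norm (W_mat U lam))\<^sup>2"
      unfolding power_mult_distrib[symmetric] using B by (intro power_mono) auto
    also have "\<dots> = (\<Sum>a\<in>UNIV. \<Sum>b\<in>UNIV. (W_mat U lam $ a $ b)\<^sup>2)"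
      unfolding power2_norm_eq_inner inner_vec_def by (simp add: power2_eq_square)
    finally show "B\<^sup>2 * (norm lam)\<^sup>2 \<le> (\<Sum>a\<in>UNIV. \<Sum>b\<in>UNIV. (W_mat U lam $ a $ b)\<^sup>2)" .
  qed
qed

section \<open>Measurability of the functional calculus in lam\<close>

lemma U_mat_diag:
  assumes "step_two U"
  obtains V d where "unitary V" "U_mat U lam = V ** diag_matrix d ** ctranspose V"
proof -
  have skew: "W_mat U lam $ b $ a = - (W_mat U lam $ a $ b)" for a b
  proof -
    have "transpose (W_mat U lam) $ a $ b = (- W_mat U lam) $ a $ b" by (simp only: W_mat_skew[OF assms])
    then show ?thesis by (simp add: transpose_def)
  qed
  have "ctranspose (U_mat U lam) $ a $ b = U_mat U lam $ a $ b" for a b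
    using skew[of a b] unfolding U_mat_eq by (simp add: ctranspose_def)
  then have "ctranspose (U_mat U lam) = U_mat U lam" by (simp add: vec_eq_iff)
  then show thesis using that by (rule hermitian_spectral)
qed

text \<open>The diagonalisation is chosen separately for each lam, with no regularity in lam.
  Polynomials avoid it: the functional calculus respects sums and products, so their entries are
  polynomial in the entries of U(lam).\<close>

lemma measurable_matrix_fun_polynomial:
  assumes U: "step_two U" and f: "real_polynomial_function f"
  shows "(\<lambda>lam. matrix_fun f (U_mat U lam) $ a $ b) \<in> borel_measurable borel"
  using f
proof (induction f arbitrary: a b rule: real_polynomial_function.induct)
  case (linear f)
  then have f: "f x = x * f 1" for x
    using linear_scale[OF bounded_linear.linear[OF linear], of x 1] by simp
  have "matrix_fun f (U_mat U lam) $ a $ b = U_mat U lam $ a $ b * of_real (f 1)" for lam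
  proof (rule U_mat_diag[OF U, of lam])
    fix V d assume V: "unitary V" "U_mat U lam = V ** diag_matrix d ** ctranspose V"
    have *: "complex_of_real (f x) = of_real x * of_real (f 1)" for x by (subst f) simp
    show ?thesis
      unfolding matrix_fun_diag[OF V] unfolding V(2) conj_diag_nth
      by (subst *) (simp add: sum_distrib_left sum_distrib_right mult_ac)
  qed
  then show ?case by (simp add: U_mat_def)
next
  case (const c)
  have "matrix_fun (\<lambda>_. c) (U_mat U lam) $ a $ b = of_real c * mat 1 $ a $ b" for lam
  proof (rule U_mat_diag[OF U, of lam])
    fix V d assume V: "unitary V" "U_mat U lam = V ** diag_matrix d ** ctranspose V"
    have "mat 1 $ a $ b = (V ** ctranspose V) $ a $ b" using V(1) by (simp add: unitary_def)
    then show ?thesis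
      unfolding matrix_fun_diag[OF V] conj_diag_nth
      by (simp add: matrix_matrix_mult_def ctranspose_def sum_distrib_left mult_ac)
  qed
  then show ?case by simp
next
  case (add f g)
  have "matrix_fun (\<lambda>x. f x + g x) (U_mat U lam) $ a $ b
      = matrix_fun f (U_mat U lam) $ a $ b + matrix_fun g (U_mat U lam) $ a $ b" for lam
  proof (rule U_mat_diag[OF U, of lam])
    fix V d assume V: "unitary V" "U_mat U lam = V ** diag_matrix d ** ctranspose V"
    show ?thesis
      unfolding matrix_fun_diag[OF V] conj_diag_nth by (simp add: sum.distrib algebra_simps)
  qed
  then show ?case using add by simp
next
  case (mult f g)
  have "matrix_fun (\<lambda>x. f x * g x) (U_mat U lam)
      = matrix_fun f (U_mat U lam) ** matrix_fun g (U_mat U lam)" for lam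
  proof (rule U_mat_diag[OF U, of lam])
    fix V d assume V: "unitary V" "U_mat U lam = V ** diag_matrix d ** ctranspose V"
    show ?thesis
      unfolding matrix_fun_diag[OF V] unitary_mul_cancel[OF V(1)] diag_matrix_mul ..
  qed
  then show ?case using mult by (simp add: matrix_matrix_mult_def)
qed

text \<open>A continuous function is a pointwise limit of polynomials.\<close>

lemma measurable_matrix_fun:
  assumes U: "step_two U" and f: "continuous_on UNIV f"
  shows "(\<lambda>lam. matrix_fun f (U_mat U lam) $ a $ b) \<in> borel_measurable borel"
proof -
  have "\<exists>g. real_polynomial_function g \<and> (\<forall>x\<in>{- real n..real n}. \<bar>f x - g x\<bar> < 1 / real (Suc n))" for n
  proof -
    have "continuous_on {- real n..real n} f" using f continuous_on_subset by blast
    moreover have "0 < 1 / real (Suc n)" by simp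
    ultimately show ?thesis
      using Stone_Weierstrass_real_polynomial_function[OF compact_Icc, of "- real n" "real n" f "1 / real (Suc n)"]
      by metis
  qed
  \<comment> \<open>The intervals exhaust the line, so at a fixed lam each of the finitely many
    eigenvalues is eventually covered and the matrix entries converge.\<close>
  then obtain g where g: "\<And>n. real_polynomial_function (g n)"
    "\<And>n x. x \<in> {- real n..real n} \<Longrightarrow> \<bar>f x - g n x\<bar> < 1 / real (Suc n)" by metis
  have lim: "(\<lambda>n. g n x) \<longlonglongrightarrow> f x" for x
  proof (rule LIMSEQ_I)
    fix r :: real assume "r > 0"
    then obtain N where N: "1 / real (Suc N) < r" using nat_approx_posE by blast
    obtain M where M: "\<bar>x\<bar> \<le> real M" using real_arch_simple by blast
    have "norm (g n x - f x) < r" if "n \<ge> max N M" for n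
    proof -
      have "real M \<le> real n" using that by simp
      then have "x \<in> {- real n..real n}" using M by auto
      then have "\<bar>f x - g n x\<bar> < 1 / real (Suc n)" by (rule g(2))
      also have "\<dots> \<le> 1 / real (Suc N)" using that by (intro divide_left_mono) auto
      finally show ?thesis using N by (simp add: abs_minus_commute)
    qed
    then show "\<exists>no. \<forall>n\<ge>no. norm (g n x - f x) < r" by blast
  qed
  show ?thesis
  proof (rule borel_measurable_LIMSEQ_metric)
    show "(\<lambda>lam. matrix_fun (g n) (U_mat U lam) $ a $ b) \<in> borel_measurable borel" for n
      by (rule measurable_matrix_fun_polynomial[OF U g(1)])
    fix lam
    show "(\<lambda>n. matrix_fun (g n) (U_mat U lam) $ a $ b) \<longlonglongrightarrow> matrix_fun f (U_mat U lam) $ a $ b"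
    proof (rule U_mat_diag[OF U, of lam])
      fix V d assume V: "unitary V" "U_mat U lam = V ** diag_matrix d ** ctranspose V"
      show ?thesis
        unfolding matrix_fun_diag[OF V] conj_diag_nth by (intro tendsto_intros lim)
    qed
  qed
qed

section \<open>Bessel-related functions\<close>

text \<open>Coefficients in the variable z^2 rather than z: evenness is then built in, and general
  facts on power series apply to z^2.\<close>

definition Q_coeff :: "nat \<Rightarrow> nat \<Rightarrow> real" where
  "Q_coeff k n = 1 / (2 powr (2 * real n + (real k + 1/2)) * (fact n * Gamma (real n + (real k + 1/2) + 1)))"

lemma Q_coeff_pos: "0 < Q_coeff k n"
  unfolding Q_coeff_def by (intro divide_pos_pos mult_pos_pos Gamma_real_pos) auto

lemma two_powr: "2 * 2 powr y = (2::real) powr (1 + y)"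
  by (simp add: powr_add)

text \<open>Functional equation of Gamma at y = n + k + 3/2; the power of 2 supplies the other
  factor of 2 y = 2 n + 2 k + 3.\<close>

lemma Q_coeff_Suc_index: "Q_coeff k n = (2 * real n + 2 * real k + 3) * Q_coeff (Suc k) n"
proof -
  define y P where "y = real n + (real k + 1/2) + 1" and "P = (2::real) powr (2 * real n + (real k + 1/2))"
  have y: "y > 0" by (simp add: y_def)
  have "Gamma (y + 1) = y * Gamma y" using y by (intro Gamma_plus1) (auto elim!: nonpos_Ints_cases)
  moreover have "real n + (real (Suc k) + 1/2) + 1 = y + 1" by (simp add: y_def)
  moreover have "(2::real) powr (2 * real n + (real (Suc k) + 1/2)) = 2 * P"
    unfolding two_powr P_def by (rule arg_cong[where f="(powr) 2"]) simp
  ultimately have 1: "Q_coeff (Suc k) n = 1 / (2 * P * (fact n * (y * Gamma y)))"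
    unfolding Q_coeff_def by simp
  have 2: "Q_coeff k n = 1 / (P * (fact n * Gamma y))" by (simp add: Q_coeff_def y_def P_def)
  have 3: "2 * real n + 2 * real k + 3 = 2 * y" by (simp add: y_def)
  show ?thesis unfolding 1 2 3 using y by simp
qed

text \<open>Coefficient form of the Bessel derivative rule Q_k'(z) = z Q_(k+1)(z).\<close>

lemma Q_coeff_Suc: "2 * (real n + 1) * Q_coeff k (Suc n) = Q_coeff (Suc k) n"
proof -
  define G P where "G = Gamma (real n + (real (Suc k) + 1/2) + 1)"
    and "P = (2::real) powr (2 * real n + (real (Suc k) + 1/2))"
  have a: "real (Suc n) + (real k + 1/2) + 1 = real n + (real (Suc k) + 1/2) + 1" by simp
  have "(2::real) powr (2 * real (Suc n) + (real k + 1/2)) = 2 * P"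
    unfolding two_powr P_def by (rule arg_cong[where f="(powr) 2"]) simp
  then have 1: "Q_coeff k (Suc n) = 1 / (2 * P * ((real n + 1) * fact n * G))"
    unfolding Q_coeff_def a G_def by (simp add: add.commute)
  have 2: "Q_coeff (Suc k) n = 1 / (P * (fact n * G))" by (simp add: Q_coeff_def G_def P_def)
  have n: "real n + 1 > 0" by linarith
  have "2 * (real n + 1) / (2 * P * ((real n + 1) * fact n * G)) = (2 * (real n + 1) * 1) / ((2 * (real n + 1)) * (P * (fact n * G)))"
    by (simp add: mult_ac)
  then show ?thesis unfolding 1 2 using n by (subst (asm) mult_divide_mult_cancel_left) auto
qed

text \<open>The two recurrences together make consecutive ratios at most 1 / (n + 1); comparison
  with the exponential series then gives convergence everywhere.\<close>

lemma Q_coeff_le: "Q_coeff k n \<le> Q_coeff k 0 * inverse (fact n)"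
proof (induction n)
  case (Suc n)
  have "Q_coeff k n = (2 * real n + 2 * real k + 3) * (2 * (real n + 1) * Q_coeff k (Suc n))"
    by (simp only: Q_coeff_Suc Q_coeff_Suc_index[of k n])
  also have "\<dots> \<ge> 1 * (1 * (real n + 1) * Q_coeff k (Suc n))"
    using Q_coeff_pos[of k "Suc n"] by (intro mult_mono) auto
  finally have "(real n + 1) * Q_coeff k (Suc n) \<le> Q_coeff k 0 * inverse (fact n)"
    using Suc by simp
  then have "Q_coeff k (Suc n) \<le> Q_coeff k 0 * inverse (fact n) / (real n + 1)"
    by (subst pos_le_divide_eq) (simp_all add: mult.commute)
  also have "\<dots> = Q_coeff k 0 * inverse (fact (Suc n))"
    by (simp add: divide_inverse add.commute)
  finally show ?case .
qed auto

lemma Q_summable: "summable (\<lambda>n. Q_coeff k n * w ^ n)"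
proof (rule summable_comparison_test')
  show "summable (\<lambda>n. Q_coeff k 0 * (inverse (fact n) * \<bar>w\<bar> ^ n))"
    by (intro summable_mult summable_exp)
  show "norm (Q_coeff k n * w ^ n) \<le> Q_coeff k 0 * (inverse (fact n) * \<bar>w\<bar> ^ n)" for n
    using Q_coeff_le[of k n] Q_coeff_pos[of k n]
    by (auto simp: abs_mult power_abs mult.assoc[symmetric] intro!: mult_right_mono)
qed

lemma Q_fun_powser: "Q_fun k z = (\<Sum>n. Q_coeff k n * (z\<^sup>2) ^ n)"
  unfolding Q_fun_def Q_coeff_def by (simp add: power_mult)

lemma Q_fun_even: "Q_fun k (- z) = Q_fun k z"
  by (simp add: Q_fun_powser)

lemma continuous_Q_fun: "continuous_on UNIV (Q_fun k)"
proof -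
  have "continuous_on UNIV (\<lambda>w. \<Sum>n. Q_coeff k n * w ^ n)"
    by (intro continuous_at_imp_continuous_on ballI isCont_powser_converges_everywhere Q_summable)
  then have "continuous_on UNIV ((\<lambda>w. \<Sum>n. Q_coeff k n * w ^ n) \<circ> (\<lambda>z::real. z\<^sup>2))"
    by (intro continuous_on_compose) (auto intro!: continuous_intros elim: continuous_on_subset)
  then show ?thesis by (simp add: o_def Q_fun_powser[abs_def])
qed

lemma Q_fun_ge_term: "Q_coeff k N * (z\<^sup>2) ^ N \<le> Q_fun k z"
proof -
  have "sum (\<lambda>n. Q_coeff k n * (z\<^sup>2) ^ n) {N} \<le> Q_fun k z"
    unfolding Q_fun_powser using Q_coeff_pos[of k]
    by (intro sum_le_suminf Q_summable) (auto intro!: mult_nonneg_nonneg simp: less_imp_le)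
  then show ?thesis by simp
qed

lemma Q_fun_pos: "0 < Q_fun k z"
  using Q_fun_ge_term[of k 0 z] Q_coeff_pos[of k 0] by simp

lemma R_fun_even: "R_fun k (- z) = R_fun k z"
  by (simp add: R_fun_def Q_fun_even)

lemma R_fun_nonneg: "0 \<le> R_fun k z"
  using Q_fun_pos[of k z] Q_fun_pos[of "Suc k" z] by (simp add: R_fun_def)

lemma continuous_R_fun: "continuous_on UNIV (R_fun k)"
  unfolding R_fun_def[abs_def] using Q_fun_pos[of k]
  by (intro continuous_intros continuous_Q_fun) (auto simp: less_le)

text \<open>The Bessel recurrence I_(nu-1) - I_(nu+1) = (2 nu / z) I_nu at nu = k + 3/2. On
  coefficients, \<open>Q_coeff_Suc_index\<close> contributes 2 k + 3 and an excess proportional to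
  the index, which \<open>Q_coeff_Suc\<close> turns into a coefficient of Q_(k+2).\<close>

lemma Q_fun_recurrence: "Q_fun k z = (2 * real k + 3) * Q_fun (Suc k) z + z\<^sup>2 * Q_fun (Suc (Suc k)) z"
proof -
  let ?w = "z\<^sup>2"
  have c: "Q_coeff k (Suc n) = (2 * real k + 3) * Q_coeff (Suc k) (Suc n) + Q_coeff (Suc (Suc k)) n" for n
    using Q_coeff_Suc_index[of k "Suc n"] Q_coeff_Suc[of n "Suc k"] by (simp add: algebra_simps)
  have s: "summable (\<lambda>n. Q_coeff k (Suc n) * ?w ^ n)" for k
    by (rule powser_split_head(3)[OF Q_summable])
  have "Q_fun k z = Q_coeff k 0 + (\<Sum>n. Q_coeff k (Suc n) * ?w ^ n) * ?w"
    unfolding Q_fun_powser by (rule powser_split_head(1)[OF Q_summable])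
  also have "(\<Sum>n. Q_coeff k (Suc n) * ?w ^ n)
      = (\<Sum>n. (2 * real k + 3) * (Q_coeff (Suc k) (Suc n) * ?w ^ n) + Q_coeff (Suc (Suc k)) n * ?w ^ n)"
    by (simp add: c algebra_simps)
  also have "\<dots> = (2 * real k + 3) * (\<Sum>n. Q_coeff (Suc k) (Suc n) * ?w ^ n) + Q_fun (Suc (Suc k)) z"
    unfolding Q_fun_powser by (subst suminf_add[symmetric]) (auto intro!: summable_mult s Q_summable simp: suminf_mult[OF s])
  also have "Q_coeff k 0 = (2 * real k + 3) * Q_coeff (Suc k) 0"
    using Q_coeff_Suc_index[of k 0] by simp
  also have "(2 * real k + 3) * Q_coeff (Suc k) 0 +
      ((2 * real k + 3) * (\<Sum>n. Q_coeff (Suc k) (Suc n) * ?w ^ n) + Q_fun (Suc (Suc k)) z) * ?w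
     = (2 * real k + 3) * (Q_coeff (Suc k) 0 + (\<Sum>n. Q_coeff (Suc k) (Suc n) * ?w ^ n) * ?w) + ?w * Q_fun (Suc (Suc k)) z"
    by (simp add: algebra_simps)
  also have "Q_coeff (Suc k) 0 + (\<Sum>n. Q_coeff (Suc k) (Suc n) * ?w ^ n) * ?w = Q_fun (Suc k) z"
    unfolding Q_fun_powser by (rule powser_split_head(1)[OF Q_summable, symmetric])
  finally show ?thesis .
qed

section \<open>Elementary closed forms for k = 0 and k = 1\<close>

lemma Q_coeff_0: "Q_coeff 0 n = sqrt (2 / pi) / fact (2 * n + 1)"
proof (induction n)
  case 0
  have "Gamma (1/2 + 1 :: real) = 1/2 * Gamma (1/2)"
    by (intro Gamma_plus1) (auto elim!: nonpos_Ints_cases)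
  then have g: "Gamma (3/2 :: real) = sqrt pi / 2" by (simp add: Gamma_one_half_real)
  have "2 / sqrt 2 = sqrt 2" by (simp add: real_div_sqrt)
  then show ?case
    by (simp add: Q_coeff_def powr_half_sqrt real_sqrt_divide g divide_divide_eq_left[symmetric]
        del: divide_divide_eq_left)
next
  case (Suc n)
  \<comment> \<open>Both recurrences combined pass from n to n + 1 at fixed k = 0, with the factor
    (2 n + 2) (2 n + 3) that separates the two factorials.\<close>
  have "Q_coeff 0 n = (2 * real n + 3) * (2 * (real n + 1) * Q_coeff 0 (Suc n))"
    by (simp only: Q_coeff_Suc Q_coeff_Suc_index[of 0 n]) simp
  then have "Q_coeff 0 n = (2 * real n + 3) * (2 * (real n + 1)) * Q_coeff 0 (Suc n)"
    by (simp only: mult.assoc)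
  moreover have "(2 * real n + 3) * (2 * (real n + 1)) \<noteq> 0" by (simp add: add_nonneg_eq_0_iff)
  ultimately have "Q_coeff 0 (Suc n) = Q_coeff 0 n / ((2 * real n + 3) * (2 * (real n + 1)))"
    by simp
  also have "\<dots> = sqrt (2 / pi) / fact (2 * Suc n + 1)"
    unfolding Suc by (simp add: field_simps)
  finally show ?case .
qed

lemma sinh_sums: "(\<lambda>n. (z::real) ^ (2 * n + 1) / fact (2 * n + 1)) sums sinh z"
proof -
  have "(\<lambda>n. (\<lambda>n. if even n then 0 else z ^ n /\<^sub>R fact n) (2 * n + 1)) sums sinh z"
    by (subst sums_mono_reindex) (auto simp: strict_mono_def sinh_converges elim!: oddE)
  then show ?thesis by (simp add: field_simps)
qed

lemma cosh_sums: "(\<lambda>n. (z::real) ^ (2 * n) / fact (2 * n)) sums cosh z"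
proof -
  have "(\<lambda>n. (\<lambda>n. if even n then z ^ n /\<^sub>R fact n else 0) (2 * n)) sums cosh z"
    by (subst sums_mono_reindex) (auto simp: strict_mono_def cosh_converges elim!: evenE)
  then show ?thesis by (simp add: field_simps)
qed

lemma Q_fun_0: "z * Q_fun 0 z = sqrt (2 / pi) * sinh z"
proof -
  have "(\<lambda>n. z * (Q_coeff 0 n * (z\<^sup>2) ^ n)) sums (z * Q_fun 0 z)"
    unfolding Q_fun_powser by (intro sums_mult summable_sums Q_summable)
  moreover have "z * (Q_coeff 0 n * (z\<^sup>2) ^ n) = sqrt (2 / pi) * (z ^ (2 * n + 1) / fact (2 * n + 1))" for n
    by (simp only: Q_coeff_0 power_mult[symmetric] power_add power_one_right) (simp del: fact_Suc)
  ultimately show ?thesis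
    using sums_mult[OF sinh_sums, of "sqrt (2 / pi)" z] sums_unique2 by auto
qed

text \<open>The series of z cosh z - sinh z starts at z^3, since its terms of index 0 cancel;
  shifting the index by one matches it with z^3 Q_1. Nothing is divided by z, so z = 0 is
  included.\<close>

lemma Q_fun_1: "z ^ 3 * Q_fun 1 z = sqrt (2 / pi) * (z * cosh z - sinh z)"
proof -
  let ?f = "\<lambda>n. z * (z ^ (2 * n) / fact (2 * n)) - z ^ (2 * n + 1) / fact (2 * n + 1)"
  have "?f sums (z * cosh z - sinh z)"
    by (intro sums_diff sums_mult cosh_sums sinh_sums)
  then have "(\<lambda>n. ?f (Suc n)) sums (z * cosh z - sinh z)"
    by (subst sums_Suc_iff) simp
  then have "(\<lambda>n. sqrt (2 / pi) * ?f (Suc n)) sums (sqrt (2 / pi) * (z * cosh z - sinh z))"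
    by (rule sums_mult)
  moreover have "sqrt (2 / pi) * ?f (Suc n) = z ^ 3 * (Q_coeff 1 n * (z\<^sup>2) ^ n)" for n
  proof -
    have "Q_coeff 1 n = Q_coeff 0 n / (2 * real n + 3)"
      using Q_coeff_Suc_index[of 0 n] by (simp add: field_simps)
    moreover have "?f (Suc n) = z ^ 3 * (z\<^sup>2) ^ n / (fact (2 * n + 1) * (2 * real n + 3))"
    proof -
      define u F where "u = z ^ 3 * (z\<^sup>2) ^ n" and "F = (fact (2 * n + 1) :: real)"
      have p: "z * z ^ (2 * Suc n) = u" "z ^ (2 * Suc n + 1) = u"
        by (simp_all add: u_def power_mult eval_nat_numeral power_add power_mult_distrib)
      have f2: "fact (2 * Suc n) = (2 * real n + 2) * F" by (simp add: F_def)
      have f3: "fact (2 * Suc n + 1) = (2 * real n + 3) * fact (2 * Suc n)" by simp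
      have "F > 0" "2 * real n + 2 > 0" "2 * real n + 3 > 0" by (auto simp: F_def simp del: fact_Suc)
      then show ?thesis
        unfolding times_divide_eq_right p f3 f2 u_def[symmetric] F_def[symmetric]
        by (simp add: divide_simps) (simp add: algebra_simps)
    qed
    ultimately show ?thesis
      by (simp add: Q_coeff_0 mult_ac del: fact_Suc)
  qed
  ultimately have "(\<lambda>n. z ^ 3 * (Q_coeff 1 n * (z\<^sup>2) ^ n)) sums (sqrt (2 / pi) * (z * cosh z - sinh z))"
    by simp
  moreover have "(\<lambda>n. z ^ 3 * (Q_coeff 1 n * (z\<^sup>2) ^ n)) sums (z ^ 3 * Q_fun 1 z)"
    unfolding Q_fun_powser by (intro sums_mult summable_sums Q_summable)
  ultimately show ?thesis by (rule sums_unique2[symmetric])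
qed

text \<open>All coefficients in z^2 are positive, so Q_k dominates every polynomial. The exponent N
  stays free because integrability over lam asks for one that grows with the dimension of the
  centre.\<close>

lemma Q_fun_growth: obtains c where "0 < c" "\<And>z. c * (1 + z\<^sup>2) ^ N \<le> Q_fun k z"
proof
  \<comment> \<open>The bound averages the single-term bounds of index 0 and N, whence a factor 2
    besides the 2 ^ N from (1 + w) ^ N \<le> 2 ^ N (1 + w ^ N) with w = z^2.\<close>
  define m where "m = min (Q_coeff k 0) (Q_coeff k N)"
  have m: "m > 0" using Q_coeff_pos by (simp add: m_def)
  show "0 < m / 2 ^ (N + 1)" using m by simp
  fix z :: real
  have "(1 + z\<^sup>2) ^ N \<le> 2 ^ N * (1 + (z\<^sup>2) ^ N)"
  proof (cases "z\<^sup>2 \<le> 1")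
    case True
    then have "(1 + z\<^sup>2) ^ N \<le> 2 ^ N" by (intro power_mono) auto
    moreover have "0 \<le> 2 ^ N * (z\<^sup>2) ^ N" by (intro mult_nonneg_nonneg) auto
    ultimately show ?thesis unfolding ring_distribs by linarith
  next
    case False
    then have "(1 + z\<^sup>2) ^ N \<le> (2 * z\<^sup>2) ^ N" by (intro power_mono) auto
    moreover have "(2 * z\<^sup>2) ^ N = 2 ^ N * (z\<^sup>2) ^ N" by (rule power_mult_distrib)
    moreover have "0 \<le> (2::real) ^ N" by simp
    ultimately show ?thesis unfolding ring_distribs by linarith
  qed
  then have "m / 2 ^ (N + 1) * (1 + z\<^sup>2) ^ N \<le> m / 2 ^ (N + 1) * (2 ^ N * (1 + (z\<^sup>2) ^ N))"
    using m by (intro mult_left_mono) auto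
  also have "\<dots> = (m + m * (z\<^sup>2) ^ N) / 2" by (simp add: field_simps)
  also have "\<dots> \<le> Q_fun k z"
  proof -
    have "m \<le> Q_fun k z" using Q_fun_ge_term[of k 0 z] by (simp add: m_def)
    moreover have "m * (z\<^sup>2) ^ N \<le> Q_coeff k N * (z\<^sup>2) ^ N" by (intro mult_right_mono) (auto simp: m_def)
    ultimately show ?thesis using Q_fun_ge_term[of k N z] by simp
  qed
  finally show "m / 2 ^ (N + 1) * (1 + z\<^sup>2) ^ N \<le> Q_fun k z" .
qed

section \<open>Gaussian integrals\<close>

lemma integral_lborel_prod:
  fixes f :: "'a::euclidean_space \<Rightarrow> real \<Rightarrow> 'c::{real_normed_field,banach,second_countable_topology}"
  assumes f: "\<And>b. b \<in> Basis \<Longrightarrow> integrable lborel (f b)"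
  shows "integrable lborel (\<lambda>x::'a. \<Prod>b\<in>Basis. f b (x \<bullet> b))"
    and "(LINT x|lborel. (\<Prod>b\<in>Basis. f b ((x::'a) \<bullet> b))) = (\<Prod>b\<in>Basis. LINT s|lborel. f b s)"
proof -
  interpret product_sigma_finite "\<lambda>_::'a. lborel :: real measure" by standard
  have [measurable]: "b \<in> Basis \<Longrightarrow> f b \<in> borel_measurable borel" for b
    using f[THEN borel_measurable_integrable] by simp
  have T [measurable]: "(\<lambda>g. \<Sum>b\<in>Basis. g b *\<^sub>R b) \<in> measurable (\<Pi>\<^sub>M b\<in>Basis. lborel) (borel :: 'a measure)"
    by measurable
  have m: "(\<lambda>x::'a. \<Prod>b\<in>Basis. f b (x \<bullet> b)) \<in> borel_measurable borel" by measurable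
  have e: "(\<Prod>b\<in>Basis. f b ((\<Sum>c\<in>Basis. g c *\<^sub>R c) \<bullet> b)) = (\<Prod>b\<in>Basis. f b (g b))" for g :: "'a \<Rightarrow> real"
    by (intro prod.cong) auto
  show "integrable lborel (\<lambda>x::'a. \<Prod>b\<in>Basis. f b (x \<bullet> b))"
    by (subst lborel_eq, subst integrable_distr_eq[OF T m], subst e, rule product_integrable_prod[OF finite_Basis f])
  show "(LINT x|lborel. (\<Prod>b\<in>Basis. f b ((x::'a) \<bullet> b))) = (\<Prod>b\<in>Basis. LINT s|lborel. f b s)"
    by (subst lborel_eq, subst integral_distr[OF T m], subst e, rule product_integral_prod[OF finite_Basis f])
qed

lemma prod_Basis_vec:
  "(\<Prod>b\<in>(Basis :: (real^'n) set). f b) = (\<Prod>i\<in>UNIV. f (axis i 1))"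
proof -
  have B: "(Basis :: (real^'n) set) = (\<lambda>i. axis i 1) ` UNIV"
    by (auto simp: Basis_vec_def)
  have "inj (\<lambda>i::'n. axis i (1::real))" by (auto simp: inj_on_def axis_eq_axis)
  then show ?thesis unfolding B by (subst prod.reindex) auto
qed

lemma integral_lborel_vec_prod:
  fixes f :: "'n::finite \<Rightarrow> real \<Rightarrow> 'c::{real_normed_field,banach,second_countable_topology}"
  assumes f: "\<And>i. integrable lborel (f i)"
  shows "integrable lborel (\<lambda>x::real^'n. \<Prod>i\<in>UNIV. f i (x $ i))"
    and "(LINT x|lborel. (\<Prod>i\<in>UNIV. f i ((x::real^'n) $ i))) = (\<Prod>i\<in>UNIV. LINT s|lborel. f i s)"
proof -
  define F where "F = (\<lambda>b::real^'n. f (THE i. b = axis i 1))"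
  have F: "F (axis i 1) = f i" for i
    by (auto simp: F_def axis_eq_axis)
  have i: "integrable lborel (F b)" for b by (simp add: F_def f)
  have c: "x \<bullet> axis i 1 = x $ i" for x :: "real^'n" and i by (simp add: inner_axis)
  show "integrable lborel (\<lambda>x::real^'n. \<Prod>i\<in>UNIV. f i (x $ i))"
    using integral_lborel_prod(1)[of F, OF i] by (simp add: prod_Basis_vec F c)
  show "(LINT x|lborel. (\<Prod>i\<in>UNIV. f i ((x::real^'n) $ i))) = (\<Prod>i\<in>UNIV. LINT s|lborel. f i s)"
    using integral_lborel_prod(2)[of F, OF i] by (simp add: prod_Basis_vec F c)
qed

section \<open>Rotation invariance of Lebesgue measure\<close>

lemma nn_integral_lborel_affine:
  fixes g :: "'a::euclidean_space \<Rightarrow> ennreal"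
  assumes g [measurable]: "g \<in> borel_measurable borel" and c: "c = 1 \<or> c = -1"
  shows "(\<integral>\<^sup>+x. g (t + c *\<^sub>R x) \<partial>lborel) = (\<integral>\<^sup>+x. g x \<partial>lborel)"
proof -
  have "lborel = density (distr lborel borel (\<lambda>x::'a. t + c *\<^sub>R x)) (\<lambda>_. 1)"
    using lborel_affine[of c t] c by auto
  then have "(\<integral>\<^sup>+x. g x \<partial>lborel) = (\<integral>\<^sup>+x. g x \<partial>distr lborel borel (\<lambda>x::'a. t + c *\<^sub>R x))"
    by (simp add: density_1)
  then show ?thesis by (simp add: nn_integral_distr)
qed

text \<open>Both Lebesgue measure and its image under \<open>T\<close> are invariant under translations and reflection;
  as in the uniqueness proof for Haar measure they are proportional, and they agree on the unit ball.\<close>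

lemma lborel_distr_orthogonal:
  fixes T :: "'a::euclidean_space \<Rightarrow> 'a"
  assumes T: "orthogonal_transformation T"
  shows "distr lborel borel T = lborel"
proof -
  have lin: "linear T" using T by (rule orthogonal_transformation_linear)
  have [measurable]: "T \<in> borel_measurable borel"
    by (intro borel_measurable_continuous_onI linear_continuous_on) (simp add: lin linear_linear)
  have TS: "T (inv T x) = x" for x
    using orthogonal_transformation_bij[OF T] by (simp add: bij_is_surj surj_f_inv_f)
  have swap: "(\<integral>\<^sup>+x. f x \<partial>lborel) * (\<integral>\<^sup>+x. g (T x) \<partial>lborel) = (\<integral>\<^sup>+x. g x \<partial>lborel) * (\<integral>\<^sup>+x. f (T x) \<partial>lborel)"
    if [measurable]: "f \<in> borel_measurable borel" "g \<in> borel_measurable borel" for f g :: "'a \<Rightarrow> ennreal"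
  proof -
    have 1: "(\<integral>\<^sup>+y. g (T y + x) \<partial>lborel) = (\<integral>\<^sup>+x. g (T x) \<partial>lborel)" for x
      using nn_integral_lborel_affine[of "\<lambda>y. g (T y)" 1 "inv T x"]
      by (simp add: linear_add[OF lin] TS add.commute)
    have 2: "(\<integral>\<^sup>+y. f (x - T y) \<partial>lborel) = (\<integral>\<^sup>+x. f (T x) \<partial>lborel)" for x
      using nn_integral_lborel_affine[of "\<lambda>y. f (T y)" "-1" "inv T x"]
      by (simp add: linear_diff[OF lin] TS)
    have 3: "(\<integral>\<^sup>+x. f x * g (T y + x) \<partial>lborel) = (\<integral>\<^sup>+x. f (x - T y) * g x \<partial>lborel)" for y
      using nn_integral_lborel_affine[of "\<lambda>x. f (x - T y) * g x" 1 "T y"] by simp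
    have "(\<integral>\<^sup>+x. f x \<partial>lborel) * (\<integral>\<^sup>+x. g (T x) \<partial>lborel) = (\<integral>\<^sup>+x. \<integral>\<^sup>+y. f x * g (T y + x) \<partial>lborel \<partial>lborel)"
      by (simp add: nn_integral_cmult nn_integral_multc 1)
    also have "\<dots> = (\<integral>\<^sup>+y. \<integral>\<^sup>+x. f (x - T y) * g x \<partial>lborel \<partial>lborel)"
      by (subst lborel_pair.Fubini') (simp_all add: 3)
    also have "\<dots> = (\<integral>\<^sup>+x. \<integral>\<^sup>+y. f (x - T y) * g x \<partial>lborel \<partial>lborel)"
      by (rule lborel_pair.Fubini') simp
    also have "\<dots> = (\<integral>\<^sup>+x. g x \<partial>lborel) * (\<integral>\<^sup>+x. f (T x) \<partial>lborel)"
      by (simp add: nn_integral_multc nn_integral_cmult 2) (simp add: mult.commute)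
    finally show ?thesis .
  qed
  show ?thesis
  proof (rule measure_eqI)
    fix A assume "A \<in> sets (distr lborel borel T)"
    then have A [measurable]: "A \<in> sets borel" by simp
    let ?B = "ball 0 1 :: 'a set"
    have "(indicator ?B (T x) :: ennreal) = indicator ?B x" for x
      using orthogonal_transformation_norm[OF T] by (simp add: indicator_def)
    then have "emeasure lborel ?B * (\<integral>\<^sup>+x. indicator A (T x) \<partial>lborel) = emeasure lborel ?B * emeasure lborel A"
      using swap[OF borel_measurable_indicator borel_measurable_indicator, of ?B A] A by (simp add: mult.commute)
    moreover have "emeasure lborel ?B \<noteq> 0"
      by (simp add: emeasure_ball less_imp_neq[OF unit_ball_vol_pos, symmetric])
    moreover have "emeasure lborel ?B < \<infinity>" by (rule emeasure_bounded_finite) simp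
    ultimately have "(\<integral>\<^sup>+x. indicator A (T x) \<partial>lborel) = emeasure lborel A"
      by (subst (asm) ennreal_mult_cancel_left) auto
    moreover have "(\<integral>\<^sup>+x. indicator A (T x) \<partial>lborel) = emeasure (distr lborel borel T) A"
      by (subst nn_integral_indicator[symmetric], simp, subst nn_integral_distr) simp_all
    ultimately show "emeasure (distr lborel borel T) A = emeasure lborel A" by simp
  qed simp
qed

lemma integral_lborel_orthonormal_prod:
  fixes f :: "'n::finite \<Rightarrow> real \<Rightarrow> 'c::{real_normed_field,banach,second_countable_topology}"
    and e :: "'n \<Rightarrow> real^'n"
  assumes f: "\<And>i. integrable lborel (f i)"
    and e: "\<And>i j. e i \<bullet> e j = (if i = j then 1 else 0)"
  shows "integrable lborel (\<lambda>x. \<Prod>i\<in>UNIV. f i (e i \<bullet> x))"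
    and "(LINT x|lborel. (\<Prod>i\<in>UNIV. f i (e i \<bullet> x))) = (\<Prod>i\<in>UNIV. LINT s|lborel. f i s)"
proof -
  define E where "E = (\<chi> a i. e i $ a)"
  have "transpose E ** E = mat 1"
    using e by (simp add: E_def transpose_def matrix_matrix_mult_def mat_def vec_eq_iff inner_vec_def)
  then have "orthogonal_matrix (transpose E)"
    by (simp add: orthogonal_matrix_def matrix_left_right_inverse)
  then have T: "orthogonal_transformation (\<lambda>x. transpose E *v x)"
    unfolding orthogonal_transformation_matrix matrix_of_matrix_vector_mul
    by (intro conjI matrix_vector_mul_linear)
  have Ti: "(transpose E *v x) $ i = e i \<bullet> x" for x i
    by (simp add: E_def transpose_def matrix_vector_mult_def inner_vec_def)
  have [measurable]: "(\<lambda>x. transpose E *v x) \<in> borel_measurable borel"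
    using matrix_vector_mul_linear[of "transpose E"]
    by (intro borel_measurable_continuous_onI linear_continuous_on) (simp only: linear_linear)
  have [measurable]: "f b \<in> borel_measurable borel" for b
    using f[THEN borel_measurable_integrable] by simp
  have [measurable]: "(\<lambda>x::real^'n. \<Prod>i\<in>UNIV. f i (x $ i)) \<in> borel_measurable borel"
    using integral_lborel_vec_prod(1)[of f, OF f, THEN borel_measurable_integrable] by simp
  have i: "integrable (distr lborel borel (\<lambda>x. transpose E *v x)) (\<lambda>x::real^'n. \<Prod>i\<in>UNIV. f i (x $ i))"
    unfolding lborel_distr_orthogonal[OF T] by (rule integral_lborel_vec_prod(1)[OF f])
  then show "integrable lborel (\<lambda>x. \<Prod>i\<in>UNIV. f i (e i \<bullet> x))"
    by (subst (asm) integrable_distr_eq) (simp_all add: Ti del: transpose_matrix_vector)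
  have "(LINT x|distr lborel borel (\<lambda>x. transpose E *v x). (\<Prod>i\<in>UNIV. f i (x $ i))) = (\<Prod>i\<in>UNIV. LINT s|lborel. f i s)"
    unfolding lborel_distr_orthogonal[OF T] by (rule integral_lborel_vec_prod(2)[OF f])
  then show "(LINT x|lborel. (\<Prod>i\<in>UNIV. f i (e i \<bullet> x))) = (\<Prod>i\<in>UNIV. LINT s|lborel. f i s)"
    by (subst (asm) integral_distr) (simp_all add: Ti del: transpose_matrix_vector)
qed

section \<open>Fourier transforms of Gaussians\<close>

lemma gaussian_fourier_std:
  "has_bochner_integral lborel (\<lambda>s. complex_of_real (exp (- s\<^sup>2 / 2)) * iexp (b * s))
     (complex_of_real (sqrt (2 * pi) * exp (- b\<^sup>2 / 2)))"
proof -
  have int: "integrable lborel (\<lambda>s. complex_of_real (exp (- s\<^sup>2 / 2)) * iexp (b * s))"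
  proof (rule Bochner_Integration.integrable_bound)
    have "integrable lborel (\<lambda>s. sqrt (2 * pi) * normal_density 0 1 s)"
      by (intro integrable_mult_right integrable_normal_density) auto
    then show "integrable lborel (\<lambda>s::real. exp (- s\<^sup>2 / 2))" by (simp add: normal_density_def)
  qed (auto simp: norm_mult)
  \<comment> \<open>The value is the characteristic function of the standard normal law; only the
    factor 1 / sqrt (2 pi) of its density has to be removed.\<close>
  have "complex_of_real (exp (- b\<^sup>2 / 2)) = (CLINT s|std_normal_distribution. iexp (b * s))"
    using fun_cong[OF char_std_normal_distribution, of b] by (simp add: char_def)
  also have "\<dots> = (LINT s|lborel. std_normal_density s *\<^sub>R iexp (b * s))"
    by (subst integral_density) auto
  also have "\<dots> = (LINT s|lborel. complex_of_real (1 / sqrt (2 * pi)) * (complex_of_real (exp (- s\<^sup>2 / 2)) * iexp (b * s)))"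
    by (intro Bochner_Integration.integral_cong) (auto simp: std_normal_density_def scaleR_conv_of_real)
  also have "\<dots> = complex_of_real (1 / sqrt (2 * pi)) * (LINT s|lborel. complex_of_real (exp (- s\<^sup>2 / 2)) * iexp (b * s))"
    by (rule integral_mult_right_zero)
  finally have *: "complex_of_real (exp (- b\<^sup>2 / 2)) = complex_of_real (1 / sqrt (2 * pi)) * (LINT s|lborel. complex_of_real (exp (- s\<^sup>2 / 2)) * iexp (b * s))" .
  define L where "L = (LINT s|lborel. complex_of_real (exp (- s\<^sup>2 / 2)) * iexp (b * s))"
  have "L = complex_of_real (sqrt (2 * pi)) * (complex_of_real (1 / sqrt (2 * pi)) * L)" by simp
  then have "L = complex_of_real (sqrt (2 * pi) * exp (- b\<^sup>2 / 2))"
    unfolding *[folded L_def, symmetric] by simp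
  with int show ?thesis by (simp add: has_bochner_integral_iff L_def)
qed

lemma gaussian_fourier_1:
  assumes a: "a > 0"
  shows "has_bochner_integral lborel (\<lambda>s. complex_of_real (exp (- a * s\<^sup>2 / 2)) * iexp (b * s))
     (complex_of_real (sqrt (2 * pi / a) * exp (- b\<^sup>2 / (2 * a))))"
proof -
  have "has_bochner_integral lborel (\<lambda>s. (\<lambda>s. complex_of_real (exp (- a * s\<^sup>2 / 2)) * iexp (b * s)) (0 + (1 / sqrt a) * s))
     (complex_of_real (sqrt (2 * pi) * exp (- (b / sqrt a)\<^sup>2 / 2)))"
    using gaussian_fourier_std[of "b / sqrt a"] a by (simp add: power_divide power_mult_distrib)
  then have "has_bochner_integral lborel (\<lambda>s. complex_of_real (exp (- a * s\<^sup>2 / 2)) * iexp (b * s))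
     (\<bar>1 / sqrt a\<bar> *\<^sub>R complex_of_real (sqrt (2 * pi) * exp (- (b / sqrt a)\<^sup>2 / 2)))"
    using a by (subst lborel_has_bochner_integral_real_affine_iff[of "1 / sqrt a" _ _ 0])
      (simp_all add: scaleR_conv_of_real)
  moreover have "\<bar>1 / sqrt a\<bar> *\<^sub>R complex_of_real (sqrt (2 * pi) * exp (- (b / sqrt a)\<^sup>2 / 2))
      = complex_of_real (sqrt (2 * pi / a) * exp (- b\<^sup>2 / (2 * a)))"
    using a by (simp add: scaleR_conv_of_real power_divide real_sqrt_divide)
  ultimately show ?thesis by simp
qed

lemma prod_exp_mult:
  "(\<Prod>i\<in>UNIV. complex_of_real (c i * exp (A i)) * exp (B i)) = complex_of_real ((\<Prod>i\<in>UNIV. c i) * exp (\<Sum>i\<in>UNIV. A i)) * exp (\<Sum>i\<in>(UNIV::'n::finite set). B i)"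
  by (simp add: prod.distrib exp_sum)

text \<open>Fubini in orthonormal coordinates. The form is given by its eigenvalues in the frame, so
  its determinant and inverse appear as products and quotients of the a_i.\<close>

lemma gaussian_fourier_frame:
  fixes e :: "'n::finite \<Rightarrow> real^'n"
  assumes a: "\<And>i. a i > 0" and e: "\<And>i j. e i \<bullet> e j = (if i = j then 1 else 0)"
  shows "has_bochner_integral lborel
     (\<lambda>s. complex_of_real (exp (- (\<Sum>i\<in>UNIV. a i * (e i \<bullet> s)\<^sup>2) / 2)) * iexp (\<Sum>i\<in>UNIV. b i * (e i \<bullet> s)))
     (complex_of_real ((\<Prod>i\<in>UNIV. sqrt (2 * pi / a i)) * exp (- (\<Sum>i\<in>UNIV. (b i)\<^sup>2 / a i) / 2)))"
proof -
  let ?f = "\<lambda>i s. complex_of_real (exp (- a i * s\<^sup>2 / 2)) * iexp (b i * s)"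
  have i: "integrable lborel (?f i)" and v: "integral\<^sup>L lborel (?f i) = complex_of_real (sqrt (2 * pi / a i) * exp (- (b i)\<^sup>2 / (2 * a i)))" for i
    using gaussian_fourier_1[OF a, of i "b i"] by (auto simp: has_bochner_integral_iff)
  have "has_bochner_integral lborel (\<lambda>s. \<Prod>i\<in>UNIV. ?f i (e i \<bullet> s)) (\<Prod>i\<in>UNIV. LINT s|lborel. ?f i s)"
    using integral_lborel_orthonormal_prod[OF i e] by (simp add: has_bochner_integral_iff)
  moreover have "(\<Prod>i\<in>UNIV. ?f i (e i \<bullet> s)) = complex_of_real (exp (- (\<Sum>i\<in>UNIV. a i * (e i \<bullet> s)\<^sup>2) / 2)) * iexp (\<Sum>i\<in>UNIV. b i * (e i \<bullet> s))" for s
    using prod_exp_mult[of "\<lambda>_. 1" "\<lambda>i. - a i * (e i \<bullet> s)\<^sup>2 / 2" "\<lambda>i. \<i> * complex_of_real (b i * (e i \<bullet> s))"]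
    by (simp add: sum_negf sum_divide_distrib[symmetric] sum_distrib_left[symmetric])
  moreover have "(\<Prod>i\<in>UNIV. LINT s|lborel. ?f i s) = complex_of_real ((\<Prod>i\<in>UNIV. sqrt (2 * pi / a i)) * exp (- (\<Sum>i\<in>UNIV. (b i)\<^sup>2 / a i) / 2))"
  proof -
    have h: "- (b i)\<^sup>2 / (2 * a i) = - ((b i)\<^sup>2 / a i) / 2" for i by simp
    show ?thesis
      unfolding v h using prod_exp_mult[of "\<lambda>i. sqrt (2 * pi / a i)" "\<lambda>i. - ((b i)\<^sup>2 / a i) / 2" "\<lambda>i. 0"]
      by (simp add: sum_negf sum_divide_distrib[symmetric] del: divide_divide_eq_left)
  qed
  ultimately show ?thesis by simp
qed

lemma gaussian_fourier:
  fixes b :: "real^'n"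
  assumes a: "a > 0"
  shows "has_bochner_integral lborel
     (\<lambda>s. complex_of_real (exp (- a * (norm s)\<^sup>2 / 2)) * iexp (b \<bullet> s))
     (complex_of_real (sqrt (2 * pi / a) ^ CARD('n) * exp (- (norm b)\<^sup>2 / (2 * a))))"
proof -
  have n: "(norm x)\<^sup>2 = (\<Sum>i\<in>UNIV. (x $ i)\<^sup>2)" for x :: "real^'n"
    unfolding power2_norm_eq_inner inner_vec_def by (simp add: power2_eq_square)
  have ax: "axis i 1 \<bullet> s = s $ i" for i and s :: "real^'n" by (simp add: inner_axis')
  have d: "axis i 1 \<bullet> (axis j 1 :: real^'n) = (if i = j then 1 else 0)" for i j
    by (simp add: inner_axis_axis)
  have bs: "(\<Sum>i\<in>UNIV. b $ i * s $ i) = b \<bullet> s" for s by (simp add: inner_vec_def)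
  show ?thesis
    using gaussian_fourier_frame[of "\<lambda>_. a" "\<lambda>i. axis i 1 :: real^'n" "\<lambda>i. b $ i", OF a d]
    unfolding ax bs sum_distrib_left[symmetric] sum_divide_distrib[symmetric] n[symmetric]
    by (simp add: mult.commute)
qed

lemma gaussian_cos:
  fixes b :: "real^'n"
  assumes a: "a > 0"
  shows "has_bochner_integral lborel (\<lambda>s. exp (- a * (norm s)\<^sup>2 / 2) * cos (b \<bullet> s))
     (sqrt (2 * pi / a) ^ CARD('n) * exp (- (norm b)\<^sup>2 / (2 * a)))"
proof -
  have R: "Re (complex_of_real u * iexp v) = u * cos v" for u v by (simp add: Re_exp)
  show ?thesis
    using has_bochner_integral_bounded_linear[OF bounded_linear_Re gaussian_fourier[OF a, of b]]
    unfolding R by (simp only: Re_complex_of_real)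
qed

section \<open>Smooth functions, vector fields and the semigroup\<close>

text \<open>The functions z^(-n) exp (-1/z), extended by 0, form a family closed under
  differentiation up to linear combinations; n = 0 is the standard flat function.\<close>

definition flat :: "nat \<Rightarrow> real \<Rightarrow> real" where
  "flat n z = (if 0 < z then (1 / z) ^ n * exp (- (1 / z)) else 0)"

lemma flat_nonneg: "0 \<le> flat n z"
  by (simp add: flat_def)

lemma flat_nonpos_arg: "z \<le> 0 \<Longrightarrow> flat n z = 0"
  by (simp add: flat_def)

text \<open>With u = 1 / z this is the single term u^(n+k) / (n+k)! of the series of exp u. Taking k
  = 0 gives boundedness, k = 2 the derivative at 0, and k = 1 the decay in
  \<open>exp_decay_times_power\<close>.\<close>

lemma flat_le: "flat n z \<le> fact (n + k) * \<bar>z\<bar> ^ k"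
proof (cases "0 < z")
  case True
  define u where "u = 1 / z"
  have u: "u > 0" using True by (simp add: u_def)
  have "u ^ (n + k) / fact (n + k) \<le> exp u"
  proof -
    have "sum (\<lambda>j. u ^ j /\<^sub>R fact j) {n + k} \<le> (\<Sum>j. u ^ j /\<^sub>R fact j)"
      using u by (intro sum_le_suminf summable_exp_generic) auto
    then show ?thesis by (simp add: exp_def divide_inverse mult.commute)
  qed
  then have "u ^ n * exp (- u) * u ^ k \<le> fact (n + k)"
    by (simp add: exp_minus field_simps power_add)
  then have "u ^ n * exp (- u) * u ^ k * z ^ k \<le> fact (n + k) * z ^ k"
    using True by (intro mult_right_mono) auto
  moreover have "u ^ k * z ^ k = 1" using True by (simp add: u_def power_one_over)
  ultimately show ?thesis using True by (simp add: flat_def u_def[symmetric] mult.assoc)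
qed (simp add: flat_def)

lemma flat_bounded: "\<bar>flat n z\<bar> \<le> fact n"
  using flat_le[of n z 0] flat_nonneg[of n z] by simp

lemma DERIV_flat: "(flat n has_real_derivative (flat (n + 2) z - real n * flat (n + 1) z)) (at z)"
proof -
  consider "z > 0" | "z < 0" | "z = 0" by linarith
  then show ?thesis
  proof cases
    case 1
    have "((\<lambda>z. (1 / z) ^ n * exp (- (1 / z))) has_real_derivative (flat (n + 2) z - real n * flat (n + 1) z)) (at z)"
    proof -
      have u: "((\<lambda>z. 1 / z) has_real_derivative - ((1 / z)\<^sup>2)) (at z)"
        using 1 by (auto intro!: derivative_eq_intros simp: power2_eq_square)
      have E: "((\<lambda>z. exp (- (1 / z))) has_real_derivative exp (- (1 / z)) * (1 / z)\<^sup>2) (at z)"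
        by (rule derivative_eq_intros refl u | simp)+
      show ?thesis
      proof (cases n)
        case 0
        then show ?thesis using E 1 by (simp add: flat_def mult.commute power2_eq_square)
      next
        case (Suc k)
        show ?thesis
          unfolding Suc
          by (rule DERIV_cong[OF DERIV_mult[OF DERIV_power_Suc[OF u] E]])
            (use 1 in \<open>simp add: flat_def algebra_simps power2_eq_square\<close>)
      qed
    qed
    then show ?thesis
      by (rule has_field_derivative_transform_within_open[of _ _ _ "{0<..}"]) (use 1 in \<open>auto simp: flat_def\<close>)
  next
    case 2
    have "((\<lambda>z. 0) has_real_derivative (flat (n + 2) z - real n * flat (n + 1) z)) (at z)"
      using 2 by (simp add: flat_def)
    then show ?thesis
      by (rule has_field_derivative_transform_within_open[of _ _ _ "{..<0}"]) (use 2 in \<open>auto simp: flat_def\<close>)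
  next
    case 3
    have "(\<lambda>h. flat n h / h) \<midarrow>0\<rightarrow> 0"
    proof (rule Lim_null_comparison)
      show "\<forall>\<^sub>F h in at 0. norm (flat n h / h) \<le> fact (n + 2) * \<bar>h\<bar>"
      proof (intro eventually_at_filter[THEN iffD2] always_eventually allI impI)
        fix h :: real assume "h \<noteq> 0"
        then show "norm (flat n h / h) \<le> fact (n + 2) * \<bar>h\<bar>"
          using flat_le[of n h 2] flat_nonneg[of n h] by (simp add: abs_mult divide_le_eq power2_eq_square mult.assoc del: fact_Suc)
      qed
      show "((\<lambda>h. fact (n + 2) * \<bar>h\<bar>) \<longlongrightarrow> (0::real)) (at 0)"
        by (rule tendsto_eq_intros | simp)+
    qed
    then show ?thesis using 3 by (simp add: DERIV_def flat_def[of _ 0])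
  qed
qed

text \<open>Smoothness in the sense of \<open>C_n\<close> is proved by induction on \<open>n\<close> for a whole class closed under differentiation.\<close>

inductive smooth_fn :: "('a::euclidean_space \<Rightarrow> real) \<Rightarrow> bool" where
  smooth_const: "smooth_fn (\<lambda>_. c)"
| smooth_inner: "smooth_fn (\<lambda>x. x \<bullet> b)"
| smooth_add: "smooth_fn f \<Longrightarrow> smooth_fn g \<Longrightarrow> smooth_fn (\<lambda>x. f x + g x)"
| smooth_mult: "smooth_fn f \<Longrightarrow> smooth_fn g \<Longrightarrow> smooth_fn (\<lambda>x. f x * g x)"
| smooth_exp: "smooth_fn f \<Longrightarrow> smooth_fn (\<lambda>x. exp (f x))"
| smooth_cos: "smooth_fn f \<Longrightarrow> smooth_fn (\<lambda>x. cos (f x))"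
| smooth_sin: "smooth_fn f \<Longrightarrow> smooth_fn (\<lambda>x. sin (f x))"
| smooth_flat: "smooth_fn f \<Longrightarrow> smooth_fn (\<lambda>x. flat n (f x))"

lemma smooth_sum: "(\<And>i. i \<in> A \<Longrightarrow> smooth_fn (f i)) \<Longrightarrow> smooth_fn (\<lambda>x. \<Sum>i\<in>A. f i x)"
  by (induction A rule: infinite_finite_induct) (auto intro: smooth_const smooth_add)

lemma smooth_fn_derivative:
  "smooth_fn f \<Longrightarrow> \<exists>D. (\<forall>x. (f has_derivative D x) (at x)) \<and> (\<forall>v. smooth_fn (\<lambda>x. D x v))"
proof (induction rule: smooth_fn.induct)
  case (smooth_const c)
  show ?case by (rule exI[of _ "\<lambda>_ _. 0"]) (auto intro: smooth_fn.smooth_const)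
next
  case (smooth_inner b)
  show ?case
    by (rule exI[of _ "\<lambda>_ v. v \<bullet> b"])
      (auto intro!: smooth_fn.smooth_const bounded_linear.has_derivative[OF bounded_linear_inner_left] derivative_intros)
next
  case (smooth_add f g)
  then obtain D E where "\<forall>x. (f has_derivative D x) (at x)" "\<forall>v. smooth_fn (\<lambda>x. D x v)"
    "\<forall>x. (g has_derivative E x) (at x)" "\<forall>v. smooth_fn (\<lambda>x. E x v)" by blast
  then show ?case
    by (intro exI[of _ "\<lambda>x v. D x v + E x v"] conjI allI has_derivative_add smooth_fn.smooth_add) auto
next
  case (smooth_mult f g)
  then obtain D E where "\<forall>x. (f has_derivative D x) (at x)" "\<forall>v. smooth_fn (\<lambda>x. D x v)"
    "\<forall>x. (g has_derivative E x) (at x)" "\<forall>v. smooth_fn (\<lambda>x. E x v)" by blast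
  with smooth_mult.hyps show ?case
    by (intro exI[of _ "\<lambda>x v. f x * E x v + D x v * g x"] conjI allI has_derivative_mult
        smooth_fn.smooth_add smooth_fn.smooth_mult) auto
next
  case (smooth_exp f)
  then obtain D where "\<forall>x. (f has_derivative D x) (at x)" "\<forall>v. smooth_fn (\<lambda>x. D x v)" by blast
  with smooth_exp.hyps show ?case
    by (intro exI[of _ "\<lambda>x v. D x v * exp (f x)"] conjI allI smooth_fn.smooth_mult smooth_fn.smooth_exp
        DERIV_compose_FDERIV[OF DERIV_exp]) auto
next
  case (smooth_cos f)
  then obtain D where "\<forall>x. (f has_derivative D x) (at x)" "\<forall>v. smooth_fn (\<lambda>x. D x v)" by blast
  with smooth_cos.hyps have "(\<forall>x. ((\<lambda>x. cos (f x)) has_derivative (\<lambda>v. D x v * - sin (f x))) (at x)) \<and>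
      (\<forall>v. smooth_fn (\<lambda>x. D x v * ((- 1) * sin (f x))))"
    by (intro conjI allI smooth_fn.smooth_mult smooth_fn.smooth_sin smooth_fn.smooth_const
        DERIV_compose_FDERIV[OF DERIV_cos]) auto
  then show ?case by (intro exI[of _ "\<lambda>x v. D x v * - sin (f x)"]) simp
next
  case (smooth_sin f)
  then obtain D where "\<forall>x. (f has_derivative D x) (at x)" "\<forall>v. smooth_fn (\<lambda>x. D x v)" by blast
  with smooth_sin.hyps show ?case
    by (intro exI[of _ "\<lambda>x v. D x v * cos (f x)"] conjI allI smooth_fn.smooth_mult smooth_fn.smooth_cos
        DERIV_compose_FDERIV[OF DERIV_sin]) auto
next
  case (smooth_flat f n)
  then obtain D where "\<forall>x. (f has_derivative D x) (at x)" "\<forall>v. smooth_fn (\<lambda>x. D x v)" by blast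
  with smooth_flat.hyps have "(\<forall>x. ((\<lambda>x. flat n (f x)) has_derivative (\<lambda>v. D x v * (flat (n + 2) (f x) - real n * flat (n + 1) (f x)))) (at x)) \<and>
      (\<forall>v. smooth_fn (\<lambda>x. D x v * (flat (n + 2) (f x) + (- real n) * flat (n + 1) (f x))))"
    by (intro conjI allI smooth_fn.smooth_mult smooth_fn.smooth_add smooth_fn.smooth_flat smooth_fn.smooth_const
        DERIV_compose_FDERIV[OF DERIV_flat]) auto
  then show ?case by (intro exI[of _ "\<lambda>x v. D x v * (flat (n + 2) (f x) - real n * flat (n + 1) (f x))"]) simp
qed

lemma smooth_fn_C_n: "smooth_fn f \<Longrightarrow> C_n n f"
proof (induction n arbitrary: f)
  case 0
  from smooth_fn_derivative[OF this] have "f differentiable at x" for x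
    unfolding differentiable_def by blast
  then show ?case
    by (auto intro!: continuous_at_imp_continuous_on differentiable_imp_continuous_within)
next
  case (Suc n)
  obtain D where D: "\<And>x. (f has_derivative D x) (at x)" "\<And>v. smooth_fn (\<lambda>x. D x v)"
    using smooth_fn_derivative[OF Suc.prems] by blast
  have "frechet_derivative f (at x) = D x" for x using frechet_derivative_at[OF D(1)] by simp
  moreover have "f differentiable at x" for x using D(1) unfolding differentiable_def by blast
  ultimately show ?case using Suc.IH D(2) by simp
qed

lemma smooth_fn_test_fun:
  assumes "smooth_fn f" "\<And>x. R < norm x \<Longrightarrow> f x = 0"
  shows "f \<in> test_fun"
proof -
  have "{x. f x \<noteq> 0} \<subseteq> cball 0 R" using assms(2) by (force simp: not_less)
  then have "closure {x. f x \<noteq> 0} \<subseteq> cball 0 R" by (intro closure_minimal) auto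
  then have "compact (closure {x. f x \<noteq> 0})"
    by (meson bounded_cball bounded_subset closed_closure compact_eq_bounded_closed)
  then show ?thesis using smooth_fn_C_n[OF assms(1)] by (simp add: test_fun_def)
qed

lemma C_zero_compact_support:
  fixes f :: "'a::euclidean_space \<Rightarrow> real"
  assumes "continuous_on UNIV f" "\<And>x. R < norm x \<Longrightarrow> f x = 0"
  shows "f \<in> C_zero"
proof -
  have "\<forall>\<^sub>F x in at_infinity. f x = 0"
    unfolding eventually_at_infinity using assms(2) by (intro exI[of _ "R + 1"]) auto
  then have "(f \<longlongrightarrow> 0) at_infinity" by (rule tendsto_eventually)
  then show ?thesis using assms(1) by (simp add: C_zero_def)
qed

lemma test_fun_C_zero: "f \<in> test_fun \<Longrightarrow> f \<in> C_zero"
proof -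
  assume f: "f \<in> test_fun"
  then have "bounded (closure {g. f g \<noteq> 0})" by (simp add: test_fun_def compact_imp_bounded)
  then obtain R where R: "\<And>x. x \<in> closure {g. f g \<noteq> 0} \<Longrightarrow> norm x \<le> R"
    unfolding bounded_iff by blast
  have "continuous_on UNIV f" using f by (auto simp: test_fun_def dest: spec[of _ 0])
  moreover have "f x = 0" if "R < norm x" for x
    using R[of x] that closure_subset[of "{g. f g \<noteq> 0}"] by fastforce
  ultimately show ?thesis by (rule C_zero_compact_support)
qed

lemma C_zero_lincomb: "f \<in> C_zero \<Longrightarrow> g \<in> C_zero \<Longrightarrow> (\<lambda>x. a * f x + b * g x) \<in> C_zero"
  by (auto simp: C_zero_def intro!: continuous_intros tendsto_eq_intros)

subsection \<open>Calculus of the horizontal vector fields\<close>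

text \<open>The tangent vector of the field X_l at a point over x: X_l f is the derivative of f in
  this direction. It does not depend on t.\<close>

definition horiz :: "('m::finite \<Rightarrow> real^'q^'q) \<Rightarrow> 'q \<Rightarrow> real^'q \<Rightarrow> (real^'q) \<times> (real^'m)" where
  "horiz U l x = (axis l 1, (1/2) *\<^sub>R (\<chi> j. (U j *v x) $ l))"

text \<open>A relation in place of the function \<open>vfield\<close>: it carries differentiability
  along, so that sums, products and compositions can be differentiated by rules.\<close>

definition hasX :: "('m::finite \<Rightarrow> real^'q^'q) \<Rightarrow> 'q \<Rightarrow> ((real^'q) \<times> (real^'m) \<Rightarrow> real)
    \<Rightarrow> ((real^'q) \<times> (real^'m) \<Rightarrow> real) \<Rightarrow> bool" where
  "hasX U l f f' \<longleftrightarrow> (\<forall>g. \<exists>D. (f has_derivative D) (at g) \<and> f' g = D (horiz U l (fst g)))"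

lemma hasX_vfield: "hasX U l f f' \<Longrightarrow> vfield U l f = f'"
proof
  fix g assume "hasX U l f f'"
  then obtain D where D: "(f has_derivative D) (at g)" "f' g = D (horiz U l (fst g))"
    unfolding hasX_def by blast
  obtain x t where g: "g = (x, t)" by (cases g)
  have fd: "frechet_derivative f (at (x, t)) = D"
    using frechet_derivative_at[OF D(1)] g by simp
  have lin: "linear D" using D(1) by (rule has_derivative_linear)
  have "horiz U l x = (axis l 1, 0) + (\<Sum>j\<in>UNIV. ((1/2) * (U j *v x) $ l) *\<^sub>R (0, axis j 1))"
  proof -
    have "(\<Sum>j\<in>UNIV. ((1/2) * (U j *v x) $ l) *\<^sub>R axis j 1) = (1/2) *\<^sub>R (\<chi> j. (U j *v x) $ l)"
      by (simp add: vec_eq_iff axis_def if_distrib[of "\<lambda>u. _ * u"] cong: if_cong)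
    then show ?thesis by (simp add: horiz_def prod_eq_iff fst_sum snd_sum)
  qed
  then have "D (horiz U l x) = D (axis l 1, 0) + (\<Sum>j\<in>UNIV. ((1/2) * (U j *v x) $ l) *\<^sub>R D (0, axis j 1))"
    by (simp add: linear_add[OF lin] linear_sum[OF lin] linear_scale[OF lin] del: scaleR_Pair)
  also have "\<dots> = vfield U l f (x, t)"
    by (simp add: vfield_def fd matrix_vector_mult_def sum_distrib_left mult_ac)
  finally show "vfield U l f g = f' g" using D(2) g by simp
qed

lemma hasX_sublaplacian:
  assumes "\<And>l. hasX U l f (f1 l)" "\<And>l. hasX U l (f1 l) (f2 l)"
  shows "sublaplacian U f g = (\<Sum>l\<in>UNIV. f2 l g)"
  unfolding sublaplacian_def using hasX_vfield[OF assms(1)] hasX_vfield[OF assms(2)] by simp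

lemma hasX_cong: "hasX U l f f' \<Longrightarrow> (\<And>g. f' g = f'' g) \<Longrightarrow> hasX U l f f''"
  by (simp add: hasX_def)

lemma hasX_const: "hasX U l (\<lambda>_. c) (\<lambda>_. 0)"
  unfolding hasX_def by (auto intro!: exI[of _ "\<lambda>_. 0"])

lemma hasX_add: "hasX U l f f' \<Longrightarrow> hasX U l h h' \<Longrightarrow> hasX U l (\<lambda>g. f g + h g) (\<lambda>g. f' g + h' g)"
  unfolding hasX_def
proof
  fix g assume "\<forall>g. \<exists>D. (f has_derivative D) (at g) \<and> f' g = D (horiz U l (fst g))"
    "\<forall>g. \<exists>D. (h has_derivative D) (at g) \<and> h' g = D (horiz U l (fst g))"
  then obtain D E where "(f has_derivative D) (at g)" "f' g = D (horiz U l (fst g))"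
    "(h has_derivative E) (at g)" "h' g = E (horiz U l (fst g))" by blast
  then show "\<exists>D. ((\<lambda>g. f g + h g) has_derivative D) (at g) \<and> f' g + h' g = D (horiz U l (fst g))"
    by (intro exI[of _ "\<lambda>v. D v + E v"]) (auto intro: has_derivative_add)
qed

lemma hasX_mult:
  "hasX U l f f' \<Longrightarrow> hasX U l h h' \<Longrightarrow> hasX U l (\<lambda>g. f g * h g) (\<lambda>g. f g * h' g + f' g * h g)"
  unfolding hasX_def
proof
  fix g assume "\<forall>g. \<exists>D. (f has_derivative D) (at g) \<and> f' g = D (horiz U l (fst g))"
    "\<forall>g. \<exists>D. (h has_derivative D) (at g) \<and> h' g = D (horiz U l (fst g))"
  then obtain D E where "(f has_derivative D) (at g)" "f' g = D (horiz U l (fst g))"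
    "(h has_derivative E) (at g)" "h' g = E (horiz U l (fst g))" by blast
  then show "\<exists>D. ((\<lambda>g. f g * h g) has_derivative D) (at g) \<and> f g * h' g + f' g * h g = D (horiz U l (fst g))"
    by (intro exI[of _ "\<lambda>v. f g * E v + D v * h g"]) (auto intro: has_derivative_mult)
qed

lemma hasX_cmult: "hasX U l f f' \<Longrightarrow> hasX U l (\<lambda>g. c * f g) (\<lambda>g. c * f' g)"
  by (rule hasX_cong[OF hasX_mult[OF hasX_const]]) auto

lemma hasX_sum: "(\<And>i. i \<in> A \<Longrightarrow> hasX U l (f i) (f' i)) \<Longrightarrow> hasX U l (\<lambda>g. \<Sum>i\<in>A. f i g) (\<lambda>g. \<Sum>i\<in>A. f' i g)"
  by (induction A rule: infinite_finite_induct) (auto intro: hasX_const hasX_add)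

lemma hasX_chain:
  assumes "hasX U l f f'" "\<And>y. (\<phi> has_real_derivative \<phi>' y) (at y)"
  shows "hasX U l (\<lambda>g. \<phi> (f g)) (\<lambda>g. \<phi>' (f g) * f' g)"
  unfolding hasX_def
proof
  fix g
  from assms(1) obtain D where "(f has_derivative D) (at g)" "f' g = D (horiz U l (fst g))"
    unfolding hasX_def by blast
  then show "\<exists>D. ((\<lambda>g. \<phi> (f g)) has_derivative D) (at g) \<and> \<phi>' (f g) * f' g = D (horiz U l (fst g))"
    by (intro exI[of _ "\<lambda>v. D v * \<phi>' (f g)"]) (auto intro: DERIV_compose_FDERIV[OF assms(2)])
qed

lemma hasX_fst:
  fixes U :: "'m::finite \<Rightarrow> real^'q^'q"
  shows "hasX U l (\<lambda>g. b \<bullet> fst g) (\<lambda>_. b $ l)"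
  unfolding hasX_def
proof
  fix g :: "(real^'q) \<times> (real^'m)"
  show "\<exists>D. ((\<lambda>g. b \<bullet> fst g) has_derivative D) (at g) \<and> b $ l = D (horiz U l (fst g))"
    by (intro exI[of _ "\<lambda>v. b \<bullet> fst v"])
      (auto intro!: derivative_eq_intros simp: horiz_def inner_axis)
qed

lemma hasX_snd:
  fixes U :: "'m::finite \<Rightarrow> real^'q^'q"
  shows "hasX U l (\<lambda>g. c \<bullet> snd g) (\<lambda>g. 1/2 * (W_mat U c *v fst g) $ l)"
  unfolding hasX_def
proof
  fix g :: "(real^'q) \<times> (real^'m)"
  have "c \<bullet> (\<chi> j. (U j *v fst g) $ l) = (W_mat U c *v fst g) $ l"
  proof -
    have "(\<Sum>j\<in>UNIV. \<Sum>i\<in>UNIV. c $ j * (U j $ l $ i * fst g $ i)) = (\<Sum>i\<in>UNIV. \<Sum>j\<in>UNIV. c $ j * (U j $ l $ i * fst g $ i))"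
      by (rule sum.swap)
    then show ?thesis
      by (simp add: inner_vec_def matrix_vector_mult_def W_mat_nth sum_distrib_left sum_distrib_right mult_ac)
  qed
  then have "c \<bullet> ((1/2) *\<^sub>R (\<chi> j. (U j *v fst g) $ l)) = 1/2 * (W_mat U c *v fst g) $ l"
    by (simp only: inner_scaleR_right)
  then show "\<exists>D. ((\<lambda>g. c \<bullet> snd g) has_derivative D) (at g) \<and> 1/2 * (W_mat U c *v fst g) $ l = D (horiz U l (fst g))"
    by (intro exI[of _ "\<lambda>v. c \<bullet> snd v"])
      (auto intro!: derivative_eq_intros simp: horiz_def)
qed

subsection \<open>A Duhamel estimate for the semigroup\<close>

text \<open>The last time up to which the bound with slope B + \<eta> persists must be h: left
  continuity carries the bound to the supremum, and the one-sided estimate carries it beyond. In the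
  application only right difference quotients are controlled, hence this form of the mean value
  inequality.\<close>

lemma dini_bound:
  fixes F :: "real \<Rightarrow> real"
  assumes h: "0 \<le> h" and B: "0 \<le> B"
    and right: "\<And>s \<eta>. 0 \<le> s \<Longrightarrow> s < h \<Longrightarrow> 0 < \<eta> \<Longrightarrow> \<forall>\<^sub>F d in at_right 0. \<bar>F (s + d) - F s\<bar> \<le> (B + \<eta>) * d"
    and left: "\<And>s. 0 < s \<Longrightarrow> s \<le> h \<Longrightarrow> (F \<longlongrightarrow> F s) (at_left s)"
  shows "\<bar>F h - F 0\<bar> \<le> B * h"
proof -
  have main: "\<bar>F h - F 0\<bar> \<le> (B + \<eta>) * h" if \<eta>: "\<eta> > 0" for \<eta>
  proof -
    define S where "S = {s\<in>{0..h}. \<forall>r\<in>{0..s}. \<bar>F r - F 0\<bar> \<le> (B + \<eta>) * r}"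
    have S0: "0 \<in> S" using h by (simp add: S_def)
    have bdd: "bdd_above S" by (rule bdd_aboveI[of _ h]) (auto simp: S_def)
    define c where "c = Sup S"
    have c0: "0 \<le> c" unfolding c_def using S0 bdd by (rule cSup_upper)
    have ch: "c \<le> h" unfolding c_def using S0 by (intro cSup_least) (auto simp: S_def)
    have below: "\<bar>F r - F 0\<bar> \<le> (B + \<eta>) * r" if "0 \<le> r" "r < c" for r
    proof -
      have "\<exists>s\<in>S. r < s" using that S0 bdd by (subst less_cSup_iff[symmetric]) (auto simp: c_def)
      then obtain s where "s \<in> S" "r < s" by blast
      then show ?thesis using that by (auto simp: S_def)
    qed
    have atc: "\<bar>F c - F 0\<bar> \<le> (B + \<eta>) * c"
    proof (cases "c = 0")
      case False
      with c0 have "c > 0" by simp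
      show ?thesis
      proof (rule tendsto_le[of "at_left c"])
        show "((\<lambda>r. (B + \<eta>) * r) \<longlongrightarrow> (B + \<eta>) * c) (at_left c)" by (intro tendsto_intros)
        show "((\<lambda>r. \<bar>F r - F 0\<bar>) \<longlongrightarrow> \<bar>F c - F 0\<bar>) (at_left c)"
          by (intro tendsto_intros left) (use \<open>c > 0\<close> ch in auto)
        show "\<forall>\<^sub>F r in at_left c. \<bar>F r - F 0\<bar> \<le> (B + \<eta>) * r"
          using eventually_at_left_real[OF \<open>c > 0\<close>] by eventually_elim (auto intro: below)
      qed simp
    qed simp
    have "c = h"
    proof (rule ccontr)
      assume "c \<noteq> h"
      then have "c < h" using ch by simp
      from right[OF c0 this \<eta>] obtain b where b: "b > 0"
        "\<And>d. 0 < d \<Longrightarrow> d < b \<Longrightarrow> \<bar>F (c + d) - F c\<bar> \<le> (B + \<eta>) * d"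
        by (auto simp: eventually_at_right_field)
      define d where "d = min (b / 2) (h - c)"
      have d: "0 < d" "d < b" "c + d \<le> h" using b(1) \<open>c < h\<close> by (auto simp: d_def min_def)
      have "c + d \<in> S"
        unfolding S_def
      proof (clarsimp, intro conjI ballI)
        show "0 \<le> c + d" "c + d \<le> h" using c0 d by auto
        fix r assume r: "r \<in> {0..c + d}"
        show "\<bar>F r - F 0\<bar> \<le> (B + \<eta>) * r"
        proof (cases "r \<le> c")
          case True
          then show ?thesis using below[of r] atc r by (cases "r = c") auto
        next
          case False
          then have "\<bar>F (c + (r - c)) - F c\<bar> \<le> (B + \<eta>) * (r - c)" using r d by (intro b(2)) auto
          then show ?thesis using atc by (simp add: algebra_simps)
        qed
      qed
      then have "c + d \<le> c" unfolding c_def using bdd by (rule cSup_upper)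
      then show False using d by simp
    qed
    then show ?thesis using atc by simp
  qed
  show ?thesis
  proof (rule field_le_epsilon)
    fix e :: real assume e: "e > 0"
    have "\<bar>F h - F 0\<bar> \<le> (B + e / (h + 1)) * h" using e h by (intro main) auto
    also have "\<dots> = B * h + e * (h / (h + 1))" by (simp add: algebra_simps)
    also have "\<dots> \<le> B * h + e * 1" using e h by (intro add_left_mono mult_left_mono) auto
    finally show "\<bar>F h - F 0\<bar> \<le> B * h + e" by simp
  qed
qed

text \<open>The increment of s -> T (h - s) (f s) over d is T (h - s - d) applied to f (s + d) - T d
  (f s). By contraction only this inner difference matters, so the generator is used on the test
  functions f s alone and never on their images under T.\<close>

lemma semigroup_duhamel:
  assumes T: "heat_semigroup U T" and h: "0 < h" and B: "0 \<le> B"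
    and test: "\<And>s. s \<in> {0..h} \<Longrightarrow> f s \<in> test_fun"
    and deriv: "\<And>s. 0 \<le> s \<Longrightarrow> s < h \<Longrightarrow> uniform_limit UNIV (\<lambda>d g. (f (s + d) g - f s g) / d) (f' s) (at_right 0)"
    and err: "\<And>s g. 0 \<le> s \<Longrightarrow> s < h \<Longrightarrow> \<bar>f' s g - sublaplacian U (f s) g\<bar> \<le> B"
    and left: "\<And>s. 0 < s \<Longrightarrow> s \<le> h \<Longrightarrow> uniform_limit UNIV f (f s) (at_left s)"
  shows "\<bar>f h g - T h (f 0) g\<bar> \<le> B * h"
proof -
  have CT: "\<And>s f. 0 \<le> s \<Longrightarrow> f \<in> C_zero \<Longrightarrow> T s f \<in> C_zero"
    and lin: "\<And>s f f' a b. 0 \<le> s \<Longrightarrow> f \<in> C_zero \<Longrightarrow> f' \<in> C_zero \<Longrightarrow>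
        T s (\<lambda>g. a * f g + b * f' g) = (\<lambda>g. a * T s f g + b * T s f' g)"
    and contr: "\<And>s f B g. 0 \<le> s \<Longrightarrow> f \<in> C_zero \<Longrightarrow> (\<And>g. \<bar>f g\<bar> \<le> B) \<Longrightarrow> \<bar>T s f g\<bar> \<le> B"
    and T0: "\<And>f. f \<in> C_zero \<Longrightarrow> T 0 f = f"
    and semi: "\<And>s s' f. 0 \<le> s \<Longrightarrow> 0 \<le> s' \<Longrightarrow> f \<in> C_zero \<Longrightarrow> T (s + s') f = T s (T s' f)"
    and strong: "\<And>f. f \<in> C_zero \<Longrightarrow> uniform_limit UNIV (\<lambda>h. T h f) f (at_right 0)"
    and gen: "\<And>f. f \<in> test_fun \<Longrightarrow> uniform_limit UNIV (\<lambda>h g. (T h f g - f g) / h) (sublaplacian U f) (at_right 0)"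
    using T unfolding heat_semigroup_def by auto
  have fC: "f s \<in> C_zero" if "s \<in> {0..h}" for s using test[OF that] by (rule test_fun_C_zero)
  have Tdiff: "T s (\<lambda>g. f1 g - f2 g) = (\<lambda>g. T s f1 g - T s f2 g)" and Cdiff: "(\<lambda>g. f1 g - f2 g) \<in> C_zero"
    if "0 \<le> s" "f1 \<in> C_zero" "f2 \<in> C_zero" for s f1 f2
    using lin[OF that(1,2,3), of 1 "-1"] C_zero_lincomb[OF that(2,3), of 1 "-1"] by simp_all
  define F where "F s = T (h - s) (f s) g" for s
  have "\<bar>F h - F 0\<bar> \<le> B * h"
  proof (rule dini_bound)
    fix s \<eta> :: real assume s: "0 \<le> s" "s < h" and \<eta>: "0 < \<eta>"
    have sI: "s \<in> {0..h}" using s by auto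
    have "\<forall>\<^sub>F d in at_right 0. \<forall>g. \<bar>(f (s + d) g - f s g) / d - f' s g\<bar> < \<eta> / 2"
      using uniform_limitD[OF deriv[OF s], of "\<eta> / 2"] \<eta> by (simp add: dist_real_def)
    moreover have "\<forall>\<^sub>F d in at_right 0. \<forall>g. \<bar>(T d (f s) g - f s g) / d - sublaplacian U (f s) g\<bar> < \<eta> / 2"
      using uniform_limitD[OF gen[OF test[OF sI]], of "\<eta> / 2"] \<eta> by (simp add: dist_real_def)
    moreover have "\<forall>\<^sub>F d in at_right 0. d \<in> {0<..<h - s}"
      using s by (intro eventually_at_right_real) auto
    ultimately show "\<forall>\<^sub>F d in at_right 0. \<bar>F (s + d) - F s\<bar> \<le> (B + \<eta>) * d"
    proof eventually_elim
      case (elim d)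
      have d: "0 < d" "s + d \<in> {0..h}" "0 \<le> h - (s + d)" using elim s by auto
      have "F s = T ((h - (s + d)) + d) (f s) g" by (simp add: F_def)
      also have "\<dots> = T (h - (s + d)) (T d (f s)) g" using d fC[OF sI] by (subst semi) auto
      finally have "F (s + d) - F s = T (h - (s + d)) (\<lambda>g. f (s + d) g - T d (f s) g) g"
        using d fC[OF d(2)] CT[OF _ fC[OF sI], of d] by (simp add: F_def Tdiff)
      moreover have "\<bar>f (s + d) y - T d (f s) y\<bar> \<le> (B + \<eta>) * d" for y
      proof -
        \<comment> \<open>Errors of the time derivative and of the generator, each below \<eta> / 2,
          plus the residual of the heat equation.\<close>
        have "f (s + d) y - T d (f s) y = d * (((f (s + d) y - f s y) / d - f' s y)
            - ((T d (f s) y - f s y) / d - sublaplacian U (f s) y) + (f' s y - sublaplacian U (f s) y))"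
          using d by (simp add: field_simps)
        moreover have "\<bar>((f (s + d) y - f s y) / d - f' s y)
            - ((T d (f s) y - f s y) / d - sublaplacian U (f s) y) + (f' s y - sublaplacian U (f s) y)\<bar> \<le> B + \<eta>"
        proof -
          have "\<bar>(f (s + d) y - f s y) / d - f' s y\<bar> < \<eta> / 2"
            "\<bar>(T d (f s) y - f s y) / d - sublaplacian U (f s) y\<bar> < \<eta> / 2"
            using elim by blast+
          with err[OF s, of y] show ?thesis by linarith
        qed
        ultimately show ?thesis using d by (simp add: abs_mult mult.commute)
      qed
      ultimately show ?case
        using d fC[OF d(2)] CT[OF _ fC[OF sI], of d] by (auto intro!: contr Cdiff)
    qed
  next
    fix s assume s: "0 < s" "s \<le> h"
    have sI: "s \<in> {0..h}" using s by auto
    show "(F \<longlongrightarrow> F s) (at_left s)"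
    proof (rule tendstoI)
      fix e :: real assume e: "0 < e"
      have "\<forall>\<^sub>F d in at_right 0. \<forall>y. \<bar>T d (f s) y - f s y\<bar> < e / 3"
        using uniform_limitD[OF strong[OF fC[OF sI]], of "e / 3"] e by (simp add: dist_real_def)
      then obtain b where b: "b > 0" "\<And>d y. 0 < d \<Longrightarrow> d < b \<Longrightarrow> \<bar>T d (f s) y - f s y\<bar> < e / 3"
        by (auto simp: eventually_at_right_field)
      have "\<forall>\<^sub>F r in at_left s. \<forall>y. \<bar>f r y - f s y\<bar> < e / 3"
        using uniform_limitD[OF left[OF s], of "e / 3"] e by (simp add: dist_real_def)
      moreover have "\<forall>\<^sub>F r in at_left s. r \<in> {max 0 (s - b)<..<s}"
        using s b by (intro eventually_at_left_real) auto
      ultimately show "\<forall>\<^sub>F r in at_left s. dist (F r) (F s) < e"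
      proof eventually_elim
        case (elim r)
        have r: "r \<in> {0..h}" "0 < s - r" "s - r < b" "0 \<le> h - s" using elim s by auto
        have Tr: "T (s - r) (f r) \<in> C_zero" using r fC by (auto intro: CT)
        \<comment> \<open>Both values are compared under the common operator T (h - s); strong
          continuity is then used only at the fixed function f s.\<close>
        have "F r = T ((h - s) + (s - r)) (f r) g" by (simp add: F_def)
        also have "\<dots> = T (h - s) (T (s - r) (f r)) g" using r fC[OF r(1)] by (subst semi) auto
        finally have "F r - F s = T (h - s) (\<lambda>g. T (s - r) (f r) g - f s g) g"
          using r fC[OF sI] Tr by (simp add: F_def Tdiff)
        moreover have "\<bar>T (s - r) (f r) y - f s y\<bar> \<le> 2 * e / 3" for y
        proof -
          have "\<bar>T (s - r) (\<lambda>g. f r g - f s g) y\<bar> \<le> e / 3"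
            using r elim fC[OF sI] fC[OF r(1)] by (intro contr Cdiff[of 0]) (auto intro: less_imp_le)
          then have "\<bar>T (s - r) (f r) y - T (s - r) (f s) y\<bar> \<le> e / 3"
            using r fC[OF sI] fC[OF r(1)] by (simp add: Tdiff)
          moreover have "\<bar>T (s - r) (f s) y - f s y\<bar> < e / 3" using r by (intro b(2)) auto
          ultimately show ?thesis by linarith
        qed
        moreover have "(\<lambda>g. T (s - r) (f r) g - f s g) \<in> C_zero"
          by (rule Cdiff[of 0]) (use Tr fC[OF sI] in auto)
        ultimately have "\<bar>F r - F s\<bar> \<le> 2 * e / 3"
          by (simp only:) (rule contr[OF \<open>0 \<le> h - s\<close>])
        then show ?case using e by (simp add: dist_real_def)
      qed
    qed
  qed (use h B in auto)
  moreover have "F h = f h g" using T0[OF fC, of h] h by (simp add: F_def)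
  ultimately show ?thesis by (simp add: F_def)
qed

text \<open>Mean value theorem in s, with f' uniformly continuous on the product of {0..h} and K;
  outside K everything vanishes. It upgrades the pointwise time derivative to the uniform limits
  that a semigroup in the sup norm asks for.\<close>

lemma uniform_derivative_compact:
  fixes f f' :: "real \<Rightarrow> 'a::euclidean_space \<Rightarrow> real"
  assumes K: "compact K" and out: "\<And>s g. g \<notin> K \<Longrightarrow> f s g = 0" "\<And>s g. g \<notin> K \<Longrightarrow> f' s g = 0"
    and D: "\<And>s g. s \<in> {0..h} \<Longrightarrow> ((\<lambda>s. f s g) has_real_derivative f' s g) (at s)"
    and cont: "continuous_on ({0..h} \<times> K) (\<lambda>(s, g). f' s g)"
  shows "0 \<le> s \<Longrightarrow> s < h \<Longrightarrow> uniform_limit UNIV (\<lambda>d g. (f (s + d) g - f s g) / d) (f' s) (at_right 0)"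
    and "0 < s \<Longrightarrow> s \<le> h \<Longrightarrow> uniform_limit UNIV f (f s) (at_left s)"
proof -
  have uc: "uniformly_continuous_on ({0..h} \<times> K) (\<lambda>(s, g). f' s g)"
    using cont K by (intro compact_uniformly_continuous compact_Times) auto
  {
    assume s: "0 \<le> s" "s < h"
    show "uniform_limit UNIV (\<lambda>d g. (f (s + d) g - f s g) / d) (f' s) (at_right 0)"
    proof (rule uniform_limitI)
      fix e :: real assume e: "0 < e"
      obtain b where b: "b > 0" "\<And>x y. x \<in> {0..h} \<times> K \<Longrightarrow> y \<in> {0..h} \<times> K \<Longrightarrow> dist y x < b \<Longrightarrow>
          dist ((\<lambda>(s, g). f' s g) y) ((\<lambda>(s, g). f' s g) x) < e"
        using uc e unfolding uniformly_continuous_on_def by metis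
      have "\<forall>\<^sub>F d in at_right 0. d \<in> {0<..<min b (h - s)}"
        using s b by (intro eventually_at_right_real) auto
      then show "\<forall>\<^sub>F d in at_right 0. \<forall>g\<in>UNIV. dist ((f (s + d) g - f s g) / d) (f' s g) < e"
      proof eventually_elim
        case (elim d)
        show ?case
        proof
          fix g
          show "dist ((f (s + d) g - f s g) / d) (f' s g) < e"
          proof (cases "g \<in> K")
            case True
            have "\<exists>r. s < r \<and> r < s + d \<and> f (s + d) g - f s g = (s + d - s) * f' r g"
              using elim s by (intro MVT2 D) auto
            then obtain r where r: "s < r" "r < s + d" "f (s + d) g - f s g = d * f' r g" by auto
            have "dist (f' r g) (f' s g) < e"
              using b(2)[of "(s, g)" "(r, g)"] True r s elim by (auto simp: dist_Pair_Pair dist_real_def)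
            then show ?thesis using r elim by simp
          qed (use out e in auto)
        qed
      qed
    qed
  }
  {
    assume s: "0 < s" "s \<le> h"
    have "bounded ((\<lambda>(s, g). f' s g) ` ({0..h} \<times> K))"
      using cont K by (intro compact_imp_bounded compact_continuous_image compact_Times) auto
    then obtain M where M: "\<And>r g. r \<in> {0..h} \<Longrightarrow> g \<in> K \<Longrightarrow> \<bar>f' r g\<bar> \<le> M"
      unfolding bounded_iff by fastforce
    show "uniform_limit UNIV f (f s) (at_left s)"
    proof (rule uniform_limitI)
      fix e :: real assume e: "0 < e"
      define b where "b = e / (\<bar>M\<bar> + 1)"
      have b: "b > 0" using e by (simp add: b_def)
      have "\<forall>\<^sub>F r in at_left s. r \<in> {max 0 (s - b)<..<s}"
        using s b by (intro eventually_at_left_real) auto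
      then show "\<forall>\<^sub>F r in at_left s. \<forall>g\<in>UNIV. dist (f r g) (f s g) < e"
      proof eventually_elim
        case (elim r)
        show ?case
        proof
          fix g
          show "dist (f r g) (f s g) < e"
          proof (cases "g \<in> K")
            case True
            have "\<exists>q. r < q \<and> q < s \<and> f s g - f r g = (s - r) * f' q g"
              using elim s by (intro MVT2 D) auto
            then obtain q where q: "r < q" "q < s" "f s g - f r g = (s - r) * f' q g" by auto
            have "\<bar>f' q g\<bar> \<le> M" using q s elim True by (intro M) auto
            then have "\<bar>f s g - f r g\<bar> \<le> (s - r) * \<bar>M\<bar>"
              using q elim by (simp add: abs_mult mult_left_mono)
            also have "\<dots> \<le> (s - r) * (\<bar>M\<bar> + 1)" using elim by (intro mult_left_mono) auto
            also have "\<dots> < b * (\<bar>M\<bar> + 1)" using elim by (intro mult_strict_right_mono) auto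
            also have "\<dots> = e" by (simp add: b_def)
            finally show ?thesis by (simp add: dist_real_def abs_minus_commute)
          qed (use out e in auto)
        qed
      qed
    qed
  }
qed

section \<open>Explicit solutions of the heat equation\<close>

text \<open>The rates \<open>m = y'/y\<close> of the solutions \<open>y\<close> of \<open>y'' = z\<^sup>2 y\<close> solve \<open>m' = z\<^sup>2 - m\<^sup>2\<close>. Mehler's formula starts from a
  point mass, \<open>y(0) = 0\<close>; with \<open>y(0) = a\<close>, \<open>y'(0) = 1\<close> the initial value is the Gaussian \<open>exp (- |x|\<^sup>2 / (4 a))\<close> for every \<open>z\<close>.\<close>

definition mehler :: "real \<Rightarrow> real \<Rightarrow> real \<Rightarrow> real" where
  "mehler a z s = a * cosh (s * z) + (if z = 0 then s else sinh (s * z) / z)"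

definition mehler' :: "real \<Rightarrow> real \<Rightarrow> real \<Rightarrow> real" where
  "mehler' a z s = a * z * sinh (s * z) + cosh (s * z)"

definition mrate :: "real \<Rightarrow> real \<Rightarrow> real \<Rightarrow> real" where
  "mrate a z s = mehler' a z s / mehler a z s"

lemma DERIV_mehler: "(mehler a z has_real_derivative mehler' a z s) (at s)"
  unfolding mehler_def[abs_def] mehler'_def
  by (cases "z = 0") (auto intro!: derivative_eq_intros)

lemma DERIV_mehler': "(mehler' a z has_real_derivative z\<^sup>2 * mehler a z s) (at s)"
  unfolding mehler_def mehler'_def[abs_def]
  by (cases "z = 0") (auto intro!: derivative_eq_intros simp: field_simps power2_eq_square)

lemma mehler_pos:
  assumes "0 < a" "0 \<le> z" "0 \<le> s"
  shows "0 < mehler a z s" "0 < mehler' a z s"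
proof -
  have c: "0 < cosh (s * z)" "0 \<le> sinh (s * z)" using assms by auto
  then have "0 < a * cosh (s * z)" "0 \<le> (if z = 0 then s else sinh (s * z) / z)" "0 \<le> a * z * sinh (s * z)"
    using assms by auto
  then show "0 < mehler a z s" "0 < mehler' a z s"
    using c unfolding mehler_def mehler'_def by linarith+
qed

lemma DERIV_mrate:
  assumes "0 < a" "0 \<le> z" "0 \<le> s"
  shows "(mrate a z has_real_derivative z\<^sup>2 - (mrate a z s)\<^sup>2) (at s)"
proof -
  have "mehler a z s \<noteq> 0" using mehler_pos[OF assms] by simp
  then show ?thesis
    unfolding mrate_def[abs_def]
    by (intro DERIV_cong[OF DERIV_divide[OF DERIV_mehler' DERIV_mehler]])
      (auto simp: field_simps power2_eq_square)
qed

lemma continuous_mrate: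
  assumes "0 < a" "0 \<le> z"
  shows "continuous_on {0..h} (mrate a z)" "continuous_on {0..h} (\<lambda>s. ln (mehler a z s))"
proof -
  have "isCont (mrate a z) s" if "s \<in> {0..h}" for s
    using DERIV_mrate[OF assms, of s] that DERIV_isCont by auto
  then show "continuous_on {0..h} (mrate a z)" by (intro continuous_at_imp_continuous_on) auto
  have "isCont (mehler a z) s" for s using DERIV_mehler DERIV_isCont by blast
  then have "continuous_on {0..h} (mehler a z)" by (intro continuous_at_imp_continuous_on) auto
  then show "continuous_on {0..h} (\<lambda>s. ln (mehler a z s))"
    using mehler_pos[OF assms] by (intro continuous_on_ln) (auto simp: less_imp_neq[symmetric])
qed

subsection \<open>Gaussian solutions of the heat equation\<close>

text \<open>The pair e, m diagonalises the matrix M of the Gaussian. m and c are free parameters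
  instead of functions of time, because spatial derivatives ignore time and the cutoff error must be
  uniform over the range of both.\<close>

definition gsol :: "real^'m::finite \<Rightarrow> ('q::finite \<Rightarrow> real^'q) \<Rightarrow> ('q \<Rightarrow> real) \<Rightarrow> real \<Rightarrow> (real^'q) \<times> (real^'m) \<Rightarrow> real" where
  "gsol lam e m c g = cos (lam \<bullet> snd g) * exp (c - 1/4 * (\<Sum>i\<in>UNIV. m i * (e i \<bullet> fst g)\<^sup>2))"

definition Mvec :: "('q::finite \<Rightarrow> real^'q) \<Rightarrow> ('q \<Rightarrow> real) \<Rightarrow> real^'q \<Rightarrow> real^'q" where
  "Mvec e m x = (\<Sum>i\<in>UNIV. (m i * (e i \<bullet> x)) *\<^sub>R e i)"

text \<open>The closed forms of X_l and of its square on \<open>gsol\<close> are kept for each l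
  separately, because the first derivatives also pair with those of the cutoff; the cancellations
  appear only after summation, in \<open>gsol_heat\<close>.\<close>

definition gsol1 :: "('m::finite \<Rightarrow> real^'q^'q) \<Rightarrow> real^'m \<Rightarrow> ('q::finite \<Rightarrow> real^'q) \<Rightarrow> ('q \<Rightarrow> real) \<Rightarrow> real \<Rightarrow> 'q \<Rightarrow> (real^'q) \<times> (real^'m) \<Rightarrow> real" where
  "gsol1 U lam e m c l g = - 1/2 * exp (c - 1/4 * (\<Sum>i\<in>UNIV. m i * (e i \<bullet> fst g)\<^sup>2)) *
     (cos (lam \<bullet> snd g) * Mvec e m (fst g) $ l + sin (lam \<bullet> snd g) * (W_mat U lam *v fst g) $ l)"

definition gsol2 :: "('m::finite \<Rightarrow> real^'q^'q) \<Rightarrow> real^'m \<Rightarrow> ('q::finite \<Rightarrow> real^'q) \<Rightarrow> ('q \<Rightarrow> real) \<Rightarrow> real \<Rightarrow> 'q \<Rightarrow> (real^'q) \<times> (real^'m) \<Rightarrow> real" where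
  "gsol2 U lam e m c l g = exp (c - 1/4 * (\<Sum>i\<in>UNIV. m i * (e i \<bullet> fst g)\<^sup>2)) *
     (let C = cos (lam \<bullet> snd g); S = sin (lam \<bullet> snd g); M = Mvec e m (fst g) $ l; W = (W_mat U lam *v fst g) $ l in
       1/4 * (C * M + S * W) * M - 1/2 * (- 1/2 * S * W * M + C * (\<Sum>i\<in>UNIV. m i * (e i $ l)\<^sup>2)
         + 1/2 * C * W\<^sup>2 + S * W_mat U lam $ l $ l))"

lemma hasX_gauss:
  fixes U :: "'b::finite \<Rightarrow> real^'a^'a"
  shows "hasX U l (\<lambda>g. exp (c - 1/4 * (\<Sum>i\<in>UNIV. m i * (e i \<bullet> fst g)\<^sup>2)))
    (\<lambda>g. - 1/2 * exp (c - 1/4 * (\<Sum>i\<in>UNIV. m i * (e i \<bullet> fst g)\<^sup>2)) * Mvec e m (fst g) $ l)"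
proof -
  have "hasX U l (\<lambda>g. (e i \<bullet> fst g)\<^sup>2) (\<lambda>g. 2 * (e i \<bullet> fst g) * e i $ l)" for i
    by (rule hasX_chain[OF hasX_fst]) (auto intro!: derivative_eq_intros)
  then have h: "hasX U l (\<lambda>g. c + (- 1/4) * (\<Sum>i\<in>UNIV. m i * (e i \<bullet> fst g)\<^sup>2))
      (\<lambda>g. 0 + (- 1/4) * (\<Sum>i\<in>UNIV. m i * (2 * (e i \<bullet> fst g) * e i $ l)))"
    by (intro hasX_add hasX_const hasX_cmult hasX_sum)
  have M: "(\<Sum>i\<in>UNIV. m i * (2 * (e i \<bullet> fst g) * e i $ l)) = 2 * Mvec e m (fst g) $ l" for g :: "(real^'a) \<times> (real^'b)"
    by (simp add: Mvec_def sum_distrib_left mult_ac)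
  have E: "c + (- 1/4) * S = c - 1/4 * S" for S by simp
  show ?thesis
    by (rule hasX_cong[OF hasX_chain[OF h DERIV_exp, unfolded M E]]) simp
qed

lemma hasX_gsol: "hasX U l (gsol lam e m c) (gsol1 U lam e m c l)"
proof -
  have "hasX U l (\<lambda>g. cos (lam \<bullet> snd g)) (\<lambda>g. - sin (lam \<bullet> snd g) * (1/2 * (W_mat U lam *v fst g) $ l))"
    by (rule hasX_chain[OF hasX_snd DERIV_cos])
  from hasX_mult[OF this hasX_gauss[of U l c m e]] show ?thesis
    unfolding gsol_def[abs_def] by (rule hasX_cong) (simp add: gsol1_def algebra_simps)
qed

lemma gsol2_algebra:
  fixes E :: real
  shows "- 1/2 * E * ((C * D + - S * (1/2 * W) * M) + (S * w + C * (1/2 * W) * W)) + - 1/2 * (- 1/2 * E * M) * (C * M + S * W)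
    = E * (1/4 * (C * M + S * W) * M - 1/2 * (- 1/2 * S * W * M + C * D + 1/2 * C * W\<^sup>2 + S * w))"
  by (simp add: field_simps power2_eq_square)

lemma hasX_gsol1: "hasX U l (gsol1 U lam e m c l) (gsol2 U lam e m c l)"
proof -
  have C: "hasX U l (\<lambda>g. cos (lam \<bullet> snd g)) (\<lambda>g. - sin (lam \<bullet> snd g) * (1/2 * (W_mat U lam *v fst g) $ l))"
    by (rule hasX_chain[OF hasX_snd DERIV_cos])
  have S: "hasX U l (\<lambda>g. sin (lam \<bullet> snd g)) (\<lambda>g. cos (lam \<bullet> snd g) * (1/2 * (W_mat U lam *v fst g) $ l))"
    by (rule hasX_chain[OF hasX_snd DERIV_sin])
  have W: "hasX U l (\<lambda>g. (W_mat U lam *v fst g) $ l) (\<lambda>g. W_mat U lam $ l $ l)"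
    unfolding matrix_vector_mul_component by (rule hasX_fst)
  have M: "hasX U l (\<lambda>g. Mvec e m (fst g) $ l) (\<lambda>g. \<Sum>i\<in>UNIV. m i * (e i $ l)\<^sup>2)"
  proof -
    have "hasX U l (\<lambda>g. \<Sum>i\<in>UNIV. (m i * e i $ l) * (e i \<bullet> fst g)) (\<lambda>g. \<Sum>i\<in>UNIV. (m i * e i $ l) * e i $ l)"
      by (intro hasX_sum hasX_cmult hasX_fst)
    then show ?thesis by (simp add: Mvec_def mult_ac power2_eq_square)
  qed
  note hasX_mult[OF hasX_cmult[OF hasX_gauss[of U l c m e], of "- 1/2"]
      hasX_add[OF hasX_mult[OF C M] hasX_mult[OF S W]]]
  then show ?thesis
    unfolding gsol1_def[abs_def]
    by (rule hasX_cong) (simp only: gsol2_def Let_def gsol2_algebra)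
qed

text \<open>Taking m as a function of z makes M commute with W, so the sine term vanishes by
  \<open>frame_skew_zero\<close>. The cosine terms leave the trace of M and the difference of |M
  x|^2 and |W x|^2, both diagonal in the frame.\<close>

lemma gsol_heat:
  assumes fr: "frame (W_mat U lam) e z"
  shows "(\<Sum>l\<in>UNIV. gsol2 U lam e (\<lambda>i. f (z i)) c l g) = gsol lam e (\<lambda>i. f (z i)) c g *
    (- 1/2 * (\<Sum>i\<in>UNIV. f (z i)) - 1/4 * (\<Sum>i\<in>UNIV. ((z i)\<^sup>2 - (f (z i))\<^sup>2) * (e i \<bullet> fst g)\<^sup>2))"
proof -
  let ?m = "\<lambda>i. f (z i)" and ?W = "W_mat U lam" and ?x = "fst g"
  let ?C = "cos (lam \<bullet> snd g)" and ?S = "sin (lam \<bullet> snd g)"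
  define M where "M = Mvec e ?m ?x"
  have eM: "e i \<bullet> M = ?m i * (e i \<bullet> ?x)" for i
    by (simp add: M_def Mvec_def inner_sum_right frame_orthonormal[OF fr] if_distrib[of "\<lambda>u. _ * u"] cong: if_cong)
  have W0: "?W $ l $ l = 0" for l
  proof -
    have "transpose ?W $ l $ l = (- ?W) $ l $ l" using fr by (simp only: frame_def)
    then show ?thesis by (simp add: transpose_def)
  qed
  have WM: "(\<Sum>l\<in>UNIV. (?W *v ?x) $ l * M $ l) = 0"
  proof -
    have "(\<Sum>l\<in>UNIV. (?W *v ?x) $ l * M $ l) = (\<Sum>i\<in>UNIV. (e i \<bullet> (?W *v ?x)) * (e i \<bullet> M))"
      by (subst frame_inner[OF fr, symmetric]) (simp add: inner_vec_def)
    also have "\<dots> = (\<Sum>i\<in>UNIV. f (z i) * (e i \<bullet> ?x) * (e i \<bullet> (?W *v ?x)))"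
      by (simp add: eM mult_ac)
    also have "\<dots> = 0" by (rule frame_skew_zero[OF fr])
    finally show ?thesis .
  qed
  have MM: "(\<Sum>l\<in>UNIV. M $ l * M $ l) = (\<Sum>i\<in>UNIV. (?m i)\<^sup>2 * (e i \<bullet> ?x)\<^sup>2)"
  proof -
    have "(\<Sum>l\<in>UNIV. M $ l * M $ l) = (\<Sum>i\<in>UNIV. (e i \<bullet> M) * (e i \<bullet> M))"
      by (subst frame_inner[OF fr, symmetric]) (simp add: inner_vec_def)
    then show ?thesis by (simp add: eM power2_eq_square mult_ac)
  qed
  have WW: "(\<Sum>l\<in>UNIV. ((?W *v ?x) $ l)\<^sup>2) = (\<Sum>i\<in>UNIV. (z i)\<^sup>2 * (e i \<bullet> ?x)\<^sup>2)"
    using frame_norm[OF fr, of ?x ?x] by (simp add: inner_vec_def power2_eq_square mult_ac)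
  have tr: "(\<Sum>l\<in>UNIV. \<Sum>i\<in>UNIV. ?m i * (e i $ l)\<^sup>2) = (\<Sum>i\<in>UNIV. ?m i)"
  proof -
    have "(\<Sum>l\<in>UNIV. \<Sum>i\<in>UNIV. ?m i * (e i $ l)\<^sup>2) = (\<Sum>i\<in>UNIV. ?m i * (e i \<bullet> e i))"
      by (subst sum.swap) (simp add: inner_vec_def power2_eq_square sum_distrib_left)
    then show ?thesis by (simp add: frame_orthonormal[OF fr])
  qed
  define E where "E = exp (c - 1/4 * (\<Sum>i\<in>UNIV. ?m i * (e i \<bullet> ?x)\<^sup>2))"
  define D where "D l = (\<Sum>i\<in>UNIV. ?m i * (e i $ l)\<^sup>2)" for l
  have alg: "E * (1/4 * (C * M + S * W) * M - 1/2 * (- 1/2 * S * W * M + C * D + 1/2 * C * W\<^sup>2 + S * 0))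
     = E * (1/4 * C * (M * M) + 1/2 * S * (W * M) - 1/2 * C * D - 1/4 * C * W\<^sup>2)" for C D M S W :: real
    by (simp add: field_simps power2_eq_square)
  have "gsol2 U lam e ?m c l g = E * (1/4 * ?C * (M $ l * M $ l) + 1/2 * ?S * ((?W *v ?x) $ l * M $ l)
       - 1/2 * ?C * D l - 1/4 * ?C * ((?W *v ?x) $ l)\<^sup>2)" for l
    unfolding gsol2_def Let_def M_def[symmetric] W0 E_def[symmetric] D_def[symmetric] by (rule alg)
  then have "(\<Sum>l\<in>UNIV. gsol2 U lam e ?m c l g) = E * (\<Sum>l\<in>UNIV. 1/4 * ?C * (M $ l * M $ l)
       + 1/2 * ?S * ((?W *v ?x) $ l * M $ l) - 1/2 * ?C * D l - 1/4 * ?C * ((?W *v ?x) $ l)\<^sup>2)"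
    by (simp only: sum_distrib_left[symmetric])
  also have "\<dots> = E * (1/4 * ?C * (\<Sum>i\<in>UNIV. (?m i)\<^sup>2 * (e i \<bullet> ?x)\<^sup>2) - 1/2 * ?C * (\<Sum>i\<in>UNIV. ?m i)
       - 1/4 * ?C * (\<Sum>i\<in>UNIV. (z i)\<^sup>2 * (e i \<bullet> ?x)\<^sup>2))"
    unfolding sum.distrib sum_subtractf sum_distrib_left[symmetric] WM MM WW tr[folded D_def] by simp
  also have "\<dots> = gsol lam e ?m c g *
    (- 1/2 * (\<Sum>i\<in>UNIV. ?m i) - 1/4 * (\<Sum>i\<in>UNIV. ((z i)\<^sup>2 - (?m i)\<^sup>2) * (e i \<bullet> ?x)\<^sup>2))"
    unfolding gsol_def E_def[symmetric] left_diff_distrib sum_subtractf by (simp add: field_simps)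
  finally show ?thesis .
qed

lemma smooth_gsol: "smooth_fn (gsol lam e m c)"
proof -
  have 1: "smooth_fn (\<lambda>g. cos (g \<bullet> (0, lam)))" by (intro smooth_cos smooth_inner)
  have 2: "smooth_fn (\<lambda>g. exp (c + (\<Sum>i\<in>UNIV. (- 1/4 * m i) * ((g \<bullet> (e i, 0)) * (g \<bullet> (e i, 0))))))"
    by (intro smooth_exp smooth_add smooth_sum smooth_mult smooth_const smooth_inner)
  show ?thesis
    using smooth_mult[OF 1 2]
    by (simp add: gsol_def[abs_def] inner_prod_def inner_commute power2_eq_square sum_negf sum_distrib_left)
qed

subsection \<open>Cutoff functions\<close>

text \<open>The factor \<open>exp 1\<close> makes the value at 0 equal to 1. The argument of
  \<open>flat\<close> is a polynomial in g, which keeps the function in the class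
  \<open>smooth_fn\<close>, and the support is the ball of radius 1 / \<epsilon>.\<close>

definition cutoff :: "real \<Rightarrow> 'a::euclidean_space \<Rightarrow> real" where
  "cutoff \<epsilon> g = exp 1 * flat 0 (1 - \<epsilon>\<^sup>2 * (g \<bullet> g))"

lemma smooth_cutoff: "smooth_fn (cutoff \<epsilon>)"
proof -
  have "smooth_fn (\<lambda>g::'a. exp 1 * flat 0 (1 + (- (\<epsilon>\<^sup>2)) * (\<Sum>b\<in>Basis. (g \<bullet> b) * (g \<bullet> b))))"
    by (intro smooth_mult smooth_flat smooth_add smooth_sum smooth_const smooth_inner)
  then show ?thesis unfolding cutoff_def[abs_def] by (simp add: euclidean_inner[of _ _, symmetric])
qed

lemma cutoff_zero: "0 < \<epsilon> \<Longrightarrow> 1 / \<epsilon> < norm g \<Longrightarrow> cutoff \<epsilon> g = 0"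
proof -
  assume "0 < \<epsilon>" "1 / \<epsilon> < norm g"
  then have "1 \<le> \<epsilon> * norm g" by (simp add: field_simps)
  then have "1\<^sup>2 \<le> (\<epsilon> * norm g)\<^sup>2" by (intro power_mono) auto
  then show ?thesis
    by (simp add: cutoff_def flat_nonpos_arg power_mult_distrib power2_norm_eq_inner)
qed

lemma cutoff_bounded: "\<bar>cutoff \<epsilon> g\<bar> \<le> exp 1"
  using flat_bounded[of 0] by (simp add: cutoff_def abs_mult)

lemma cutoff_tendsto: "(\<lambda>n. cutoff (1 / real (Suc n)) g) \<longlonglongrightarrow> 1"
proof -
  have "(\<lambda>n. 1 - (1 / real (Suc n))\<^sup>2 * (g \<bullet> g)) \<longlonglongrightarrow> 1 - 0\<^sup>2 * (g \<bullet> g)"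
    by (intro tendsto_intros LIMSEQ_Suc lim_1_over_n)
  moreover have "isCont (flat 0) 1" using DERIV_flat DERIV_isCont by blast
  ultimately have "(\<lambda>n. flat 0 (1 - (1 / real (Suc n))\<^sup>2 * (g \<bullet> g))) \<longlonglongrightarrow> flat 0 1"
    using isCont_tendsto_compose[of 1 "flat 0"] by simp
  then have "(\<lambda>n. exp 1 * flat 0 (1 - (1 / real (Suc n))\<^sup>2 * (g \<bullet> g))) \<longlonglongrightarrow> exp 1 * flat 0 1"
    by (intro tendsto_intros)
  moreover have "exp 1 * flat 0 1 = 1" by (simp add: flat_def exp_minus)
  ultimately show ?thesis by (simp add: cutoff_def)
qed

text \<open>\<open>rho1\<close> and \<open>rho2\<close> are the first and second X_l-derivatives of
  the squared Euclidean norm.\<close>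

definition rho1 :: "('m::finite \<Rightarrow> real^'q^'q) \<Rightarrow> 'q \<Rightarrow> (real^'q) \<times> (real^'m) \<Rightarrow> real" where
  "rho1 U l g = 2 * fst g $ l + (\<Sum>j\<in>UNIV. snd g $ j * (U j *v fst g) $ l)"

definition rho2 :: "('m::finite \<Rightarrow> real^'q^'q) \<Rightarrow> 'q \<Rightarrow> (real^'q) \<times> (real^'m) \<Rightarrow> real" where
  "rho2 U l g = 2 + 1/2 * (\<Sum>j\<in>UNIV. ((U j *v fst g) $ l)\<^sup>2)"

lemma hasX_rho:
  fixes U :: "'m::finite \<Rightarrow> real^'q^'q"
  shows "hasX U l (\<lambda>g. g \<bullet> g) (rho1 U l)"
  unfolding hasX_def
proof
  fix g :: "(real^'q) \<times> (real^'m)"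
  have "2 * (g \<bullet> horiz U l (fst g)) = rho1 U l g"
    by (simp add: rho1_def horiz_def inner_prod_def inner_axis) (simp add: inner_vec_def)
  then show "\<exists>D. ((\<lambda>g. g \<bullet> g) has_derivative D) (at g) \<and> rho1 U l g = D (horiz U l (fst g))"
    by (intro exI[of _ "\<lambda>v. 2 * (g \<bullet> v)"]) (auto intro!: derivative_eq_intros simp: inner_commute)
qed

text \<open>Skew matrices have zero diagonal, so X_l annihilates component l of U_j x, and in each
  summand only the central coordinate is differentiated.\<close>

lemma hasX_rho1:
  fixes U :: "'m::finite \<Rightarrow> real^'q^'q"
  assumes "step_two U"
  shows "hasX U l (rho1 U l) (rho2 U l)"
proof -
  have U0: "U j $ l $ l = 0" for j
  proof -
    have "transpose (U j) $ l $ l = (- U j) $ l $ l" using assms by (simp only: step_two_def)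
    then show ?thesis by (simp add: transpose_def)
  qed
  have W: "W_mat U (axis j 1) = U j" for j
    by (simp add: W_mat_def axis_def if_distrib[of "\<lambda>u. u *\<^sub>R _"] cong: if_cong)
  have x: "hasX U l (\<lambda>g. fst g $ l) (\<lambda>_. 1)"
    using hasX_fst[of U l "axis l 1"] by (simp add: inner_axis')
  have t: "hasX U l (\<lambda>g. snd g $ j) (\<lambda>g. 1/2 * (U j *v fst g) $ l)" for j
    using hasX_snd[of U l "axis j 1"] by (simp add: inner_axis' W)
  have u: "hasX U l (\<lambda>g. (U j *v fst g) $ l) (\<lambda>g. 0)" for j
    unfolding matrix_vector_mul_component using hasX_fst[of U l "U j $ l"] by (simp add: U0)
  show ?thesis
    unfolding rho1_def[abs_def]
    by (rule hasX_cong[OF hasX_add[OF hasX_cmult[OF x] hasX_sum[OF hasX_mult[OF t u]]]])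
      (simp add: rho2_def power2_eq_square sum_distrib_left)
qed

text \<open>Chain rule, with flat 2 as derivative of flat 0 and flat 4 - 2 flat 3 as derivative of
  flat 2, at the argument 1 - \<epsilon>^2 |g|^2.\<close>

definition cutoff1 where
  "cutoff1 U \<epsilon> l g = - exp 1 * flat 2 (1 - \<epsilon>\<^sup>2 * (g \<bullet> g)) * (\<epsilon>\<^sup>2 * rho1 U l g)"

definition cutoff2 where
  "cutoff2 U \<epsilon> l g = exp 1 * ((flat 4 (1 - \<epsilon>\<^sup>2 * (g \<bullet> g)) - 2 * flat 3 (1 - \<epsilon>\<^sup>2 * (g \<bullet> g))) * (\<epsilon>\<^sup>2 * rho1 U l g)\<^sup>2
     - flat 2 (1 - \<epsilon>\<^sup>2 * (g \<bullet> g)) * (\<epsilon>\<^sup>2 * rho2 U l g))"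

lemma hasX_cutoff_arg: "hasX U l (\<lambda>g. 1 - \<epsilon>\<^sup>2 * (g \<bullet> g)) (\<lambda>g. - (\<epsilon>\<^sup>2 * rho1 U l g))"
  using hasX_add[OF hasX_const hasX_cmult[OF hasX_rho], of U l 1 "- (\<epsilon>\<^sup>2)"] by simp

lemma hasX_cutoff: "hasX U l (cutoff \<epsilon>) (cutoff1 U \<epsilon> l)"
  unfolding cutoff_def[abs_def]
  by (rule hasX_cong[OF hasX_cmult[OF hasX_chain[OF hasX_cutoff_arg DERIV_flat]]])
    (simp add: cutoff1_def numeral_2_eq_2)

lemma hasX_cutoff1:
  assumes "step_two U"
  shows "hasX U l (cutoff1 U \<epsilon> l) (cutoff2 U \<epsilon> l)"
  unfolding cutoff1_def[abs_def]
  by (rule hasX_cong[OF hasX_mult[OF hasX_cmult[OF hasX_chain[OF hasX_cutoff_arg DERIV_flat]]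
          hasX_cmult[OF hasX_rho1[OF assms]]]])
    (simp add: cutoff2_def algebra_simps power2_eq_square numeral_eq_Suc)

lemma cutoff_product_laplacian:
  assumes U: "step_two U"
  shows "sublaplacian U (\<lambda>g. cutoff \<epsilon> g * gsol lam e m c g) g = cutoff \<epsilon> g * (\<Sum>l\<in>UNIV. gsol2 U lam e m c l g) +
    (\<Sum>l\<in>UNIV. 2 * cutoff1 U \<epsilon> l g * gsol1 U lam e m c l g + cutoff2 U \<epsilon> l g * gsol lam e m c g)"
proof -
  have 1: "hasX U l (\<lambda>g. cutoff \<epsilon> g * gsol lam e m c g)
     (\<lambda>g. cutoff \<epsilon> g * gsol1 U lam e m c l g + cutoff1 U \<epsilon> l g * gsol lam e m c g)" for l
    by (rule hasX_mult[OF hasX_cutoff hasX_gsol])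
  have 2: "hasX U l (\<lambda>g. cutoff \<epsilon> g * gsol1 U lam e m c l g + cutoff1 U \<epsilon> l g * gsol lam e m c g)
     (\<lambda>g. (cutoff \<epsilon> g * gsol2 U lam e m c l g + cutoff1 U \<epsilon> l g * gsol1 U lam e m c l g) +
       (cutoff1 U \<epsilon> l g * gsol1 U lam e m c l g + cutoff2 U \<epsilon> l g * gsol lam e m c g))" for l
    by (intro hasX_add hasX_mult hasX_cutoff hasX_gsol hasX_gsol1 hasX_cutoff1[OF U])
  show ?thesis
    unfolding hasX_sublaplacian[OF 1 2]
    by (simp add: sum_distrib_left sum.distrib[symmetric] algebra_simps)
qed

lemma bracket_bound:
  fixes U :: "'m::finite \<Rightarrow> real^'q^'q"
  obtains K where "0 \<le> K" "\<And>l x. (\<Sum>j\<in>UNIV. \<bar>(U j *v x) $ l\<bar>) \<le> K * norm x"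
proof
  let ?K = "\<Sum>j\<in>UNIV. onorm (\<lambda>x. U j *v x)"
  have bl: "bounded_linear (\<lambda>x. U j *v x)" for j
    using matrix_vector_mul_linear[of "U j"] by (simp only: linear_linear)
  show "0 \<le> ?K" using onorm_pos_le[OF bl] by (intro sum_nonneg) auto
  show "(\<Sum>j\<in>UNIV. \<bar>(U j *v x) $ l\<bar>) \<le> ?K * norm x" for l x
    unfolding sum_distrib_right
    by (intro sum_mono order_trans[OF component_le_norm_cart onorm[OF bl]])
qed

text \<open>On the support \<epsilon> |t| \<le> 1, so the terms of \<open>rho1\<close> that grow in
  t cost one factor \<epsilon>; of the prefactor \<epsilon>^2 one power remains, times growth in x
  alone. Off the support both derivatives vanish.\<close>

lemma cutoff_bounds:
  fixes U :: "'m::finite \<Rightarrow> real^'q^'q"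
  obtains C where "0 \<le> C"
    "\<And>\<epsilon> l g. 0 < \<epsilon> \<Longrightarrow> \<epsilon> \<le> 1 \<Longrightarrow> \<bar>cutoff1 U \<epsilon> l g\<bar> \<le> \<epsilon> * C * norm (fst g)"
    "\<And>\<epsilon> l g. 0 < \<epsilon> \<Longrightarrow> \<epsilon> \<le> 1 \<Longrightarrow> \<bar>cutoff2 U \<epsilon> l g\<bar> \<le> \<epsilon> * C * (1 + (norm (fst g))\<^sup>2)"
proof -
  obtain K where K: "0 \<le> K" "\<And>l x. (\<Sum>j\<in>UNIV. \<bar>(U j *v x) $ l\<bar>) \<le> K * norm x"
    by (rule bracket_bound[of U]) blast
  \<comment> \<open>By \<open>flat_bounded\<close>, 36 = 4! + 2 * 3! is for flat 4 - 2 flat 3 and 2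
    = 2! for flat 2; 2 + K comes from \<open>rho1\<close>, and 4 + K^2 is twice the 2 + K^2 / 2 of
    \<open>rho2\<close>.\<close>
  define C where "C = exp 1 * (36 * (2 + K)\<^sup>2 + 2 * (2 + K) + 4 + K\<^sup>2)"
  have C: "exp 1 * 2 * (2 + K) \<le> C" "exp 1 * (36 * (2 + K)\<^sup>2 + 4 + K\<^sup>2) \<le> C" "0 \<le> C"
    using K by (auto simp: C_def mult.assoc)
  have R1: "\<bar>\<epsilon>\<^sup>2 * rho1 U l g\<bar> \<le> \<epsilon> * ((2 + K) * norm (fst g))"
    if \<epsilon>: "0 < \<epsilon>" "\<epsilon> \<le> 1" and r: "0 < 1 - \<epsilon>\<^sup>2 * (g \<bullet> g)" for \<epsilon> l g
  proof -
    have "(\<epsilon> * norm (snd g))\<^sup>2 \<le> 1\<^sup>2"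
    proof -
      have "snd g \<bullet> snd g \<le> g \<bullet> g" by (simp add: inner_prod_def)
      then have "\<epsilon>\<^sup>2 * (snd g \<bullet> snd g) \<le> \<epsilon>\<^sup>2 * (g \<bullet> g)" by (intro mult_left_mono) auto
      then show ?thesis using r by (simp add: power_mult_distrib power2_norm_eq_inner)
    qed
    then have t: "\<epsilon> * norm (snd g) \<le> 1" by (rule power2_le_imp_le) simp
    have "\<bar>\<Sum>j\<in>UNIV. snd g $ j * (U j *v fst g) $ l\<bar> \<le> (\<Sum>j\<in>UNIV. norm (snd g) * \<bar>(U j *v fst g) $ l\<bar>)"
      by (intro order_trans[OF sum_abs] sum_mono) (auto simp: abs_mult intro!: mult_right_mono component_le_norm_cart)
    also have "\<dots> \<le> norm (snd g) * (K * norm (fst g))"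
      unfolding sum_distrib_left[symmetric] by (intro mult_left_mono K) auto
    finally have "\<epsilon> * \<bar>\<Sum>j\<in>UNIV. snd g $ j * (U j *v fst g) $ l\<bar> \<le> \<epsilon> * norm (snd g) * (K * norm (fst g))"
      using \<epsilon> by (simp add: mult_left_mono mult.assoc)
    also have "\<dots> \<le> 1 * (K * norm (fst g))" using K t by (intro mult_right_mono) auto
    finally have b: "\<epsilon> * \<bar>\<Sum>j\<in>UNIV. snd g $ j * (U j *v fst g) $ l\<bar> \<le> K * norm (fst g)" by simp
    have "\<epsilon> * \<bar>2 * fst g $ l\<bar> \<le> 1 * (2 * norm (fst g))"
      using \<epsilon> component_le_norm_cart[of "fst g" l] by (intro mult_mono) auto
    then have "\<epsilon> * \<bar>rho1 U l g\<bar> \<le> (2 + K) * norm (fst g)"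
      using b \<epsilon> abs_triangle_ineq[of "2 * fst g $ l" "\<Sum>j\<in>UNIV. snd g $ j * (U j *v fst g) $ l"]
        mult_left_mono[of "\<bar>rho1 U l g\<bar>" "\<bar>2 * fst g $ l\<bar> + \<bar>\<Sum>j\<in>UNIV. snd g $ j * (U j *v fst g) $ l\<bar>" \<epsilon>]
      by (simp add: rho1_def algebra_simps)
    then have "\<epsilon> * (\<epsilon> * \<bar>rho1 U l g\<bar>) \<le> \<epsilon> * ((2 + K) * norm (fst g))"
      using \<epsilon> by (intro mult_left_mono) auto
    then show ?thesis using \<epsilon> by (simp add: abs_mult power2_eq_square mult.assoc)
  qed
  have R2: "\<bar>\<epsilon>\<^sup>2 * rho2 U l g\<bar> \<le> \<epsilon> * (2 + K\<^sup>2 / 2 * (norm (fst g))\<^sup>2)" if \<epsilon>: "0 < \<epsilon>" "\<epsilon> \<le> 1" for \<epsilon> l g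
  proof -
    have "(\<Sum>j\<in>UNIV. ((U j *v fst g) $ l)\<^sup>2) \<le> (\<Sum>j\<in>UNIV. \<bar>(U j *v fst g) $ l\<bar>)\<^sup>2"
    proof -
      have "(sqrt (\<Sum>j\<in>UNIV. ((U j *v fst g) $ l)\<^sup>2))\<^sup>2 \<le> (\<Sum>j\<in>UNIV. \<bar>(U j *v fst g) $ l\<bar>)\<^sup>2"
        using L2_set_le_sum[of UNIV "\<lambda>j. \<bar>(U j *v fst g) $ l\<bar>"]
        by (intro power_mono) (auto simp: L2_set_def sum_nonneg)
      then show ?thesis by (simp add: sum_nonneg)
    qed
    also have "\<dots> \<le> (K * norm (fst g))\<^sup>2" by (intro power_mono K sum_nonneg) auto
    finally have "rho2 U l g \<le> 2 + K\<^sup>2 / 2 * (norm (fst g))\<^sup>2" by (simp add: rho2_def power_mult_distrib)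
    moreover have "0 \<le> rho2 U l g" by (simp add: rho2_def sum_nonneg)
    moreover have "\<epsilon>\<^sup>2 \<le> \<epsilon>" using \<epsilon> by (simp add: power2_eq_square mult_left_le)
    ultimately have "\<epsilon>\<^sup>2 * rho2 U l g \<le> \<epsilon> * (2 + K\<^sup>2 / 2 * (norm (fst g))\<^sup>2)"
      using \<epsilon> by (intro mult_mono) auto
    then show ?thesis using \<open>0 \<le> rho2 U l g\<close> by simp
  qed
  show thesis
  proof (rule that[OF C(3)])
    fix \<epsilon> :: real and l and g :: "(real^'q) \<times> (real^'m)" assume \<epsilon>: "0 < \<epsilon>" "\<epsilon> \<le> 1"
    let ?r = "1 - \<epsilon>\<^sup>2 * (g \<bullet> g)" and ?n = "norm (fst g)"
    show "\<bar>cutoff1 U \<epsilon> l g\<bar> \<le> \<epsilon> * C * ?n"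
    proof (cases "0 < ?r")
      case False
      then show ?thesis using C \<epsilon> by (simp add: cutoff1_def flat_nonpos_arg)
    next
      case True
      have "\<bar>cutoff1 U \<epsilon> l g\<bar> = exp 1 * \<bar>flat 2 ?r\<bar> * \<bar>\<epsilon>\<^sup>2 * rho1 U l g\<bar>" by (simp add: cutoff1_def abs_mult)
      also have "\<dots> \<le> exp 1 * 2 * (\<epsilon> * ((2 + K) * ?n))"
        using flat_bounded[of 2 ?r] R1[OF \<epsilon> True] by (intro mult_mono) (auto simp: fact_numeral)
      also have "\<dots> = exp 1 * 2 * (2 + K) * (\<epsilon> * ?n)" by simp
      also have "\<dots> \<le> C * (\<epsilon> * ?n)" using C \<epsilon> by (intro mult_right_mono) auto
      finally show ?thesis by (simp add: mult_ac)
    qed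
    show "\<bar>cutoff2 U \<epsilon> l g\<bar> \<le> \<epsilon> * C * (1 + ?n\<^sup>2)"
    proof (cases "0 < ?r")
      case False
      then show ?thesis using C \<epsilon> by (simp add: cutoff2_def flat_nonpos_arg)
    next
      case True
      have f2: "\<bar>flat 4 ?r - 2 * flat 3 ?r\<bar> \<le> 36" "\<bar>flat 2 ?r\<bar> \<le> 2"
        using flat_bounded[of 4 ?r] flat_bounded[of 3 ?r] flat_bounded[of 2 ?r] by (auto simp: fact_numeral)
      have sq: "(\<epsilon>\<^sup>2 * rho1 U l g)\<^sup>2 \<le> \<epsilon> * ((2 + K)\<^sup>2 * ?n\<^sup>2)"
      proof -
        have "(\<epsilon>\<^sup>2 * rho1 U l g)\<^sup>2 = \<bar>\<epsilon>\<^sup>2 * rho1 U l g\<bar>\<^sup>2" by simp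
        also have "\<dots> \<le> (\<epsilon> * ((2 + K) * ?n))\<^sup>2" by (rule power_mono[OF R1[OF \<epsilon> True]]) simp
        also have "\<dots> = \<epsilon>\<^sup>2 * ((2 + K)\<^sup>2 * ?n\<^sup>2)" by (simp add: power_mult_distrib)
        also have "\<dots> \<le> \<epsilon> * ((2 + K)\<^sup>2 * ?n\<^sup>2)"
          using \<epsilon> by (intro mult_right_mono) (auto simp: power2_eq_square mult_left_le)
        finally show ?thesis .
      qed
      have "\<bar>(flat 4 ?r - 2 * flat 3 ?r) * (\<epsilon>\<^sup>2 * rho1 U l g)\<^sup>2 - flat 2 ?r * (\<epsilon>\<^sup>2 * rho2 U l g)\<bar>
         \<le> \<bar>flat 4 ?r - 2 * flat 3 ?r\<bar> * (\<epsilon>\<^sup>2 * rho1 U l g)\<^sup>2 + \<bar>flat 2 ?r\<bar> * \<bar>\<epsilon>\<^sup>2 * rho2 U l g\<bar>"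
        by (rule order_trans[OF abs_triangle_ineq4]) (simp add: abs_mult)
      also have "\<dots> \<le> 36 * (\<epsilon> * ((2 + K)\<^sup>2 * ?n\<^sup>2)) + 2 * (\<epsilon> * (2 + K\<^sup>2 / 2 * ?n\<^sup>2))"
        by (intro add_mono mult_mono f2 sq R2 \<epsilon>) auto
      also have "\<dots> = \<epsilon> * (4 + (36 * (2 + K)\<^sup>2 + K\<^sup>2) * ?n\<^sup>2)" by (simp add: algebra_simps)
      also have "\<dots> \<le> \<epsilon> * ((36 * (2 + K)\<^sup>2 + 4 + K\<^sup>2) * (1 + ?n\<^sup>2))"
        using \<epsilon> by (intro mult_left_mono) (auto simp: algebra_simps)
      finally have "\<bar>cutoff2 U \<epsilon> l g\<bar> \<le> exp 1 * (\<epsilon> * ((36 * (2 + K)\<^sup>2 + 4 + K\<^sup>2) * (1 + ?n\<^sup>2)))"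
        unfolding cutoff2_def abs_mult by (simp add: abs_mult)
      also have "\<dots> = exp 1 * (36 * (2 + K)\<^sup>2 + 4 + K\<^sup>2) * (\<epsilon> * (1 + ?n\<^sup>2))" by (simp add: mult_ac)
      also have "\<dots> \<le> C * (\<epsilon> * (1 + ?n\<^sup>2))" using C \<epsilon> by (intro mult_right_mono) auto
      finally show ?thesis by (simp add: mult_ac)
    qed
  qed
qed

text \<open>The commutator with the cutoff consists of terms of size \<epsilon> (1 + |x|^2) times
  the Gaussian, and the Gaussian absorbs |x|^2 because all rates are at least \<kappa>. The constant
  depends on m and c through their bounds only, hence is the same at all times.\<close>

lemma cutoff_error:
  fixes U :: "'m::finite \<Rightarrow> real^'q^'q" and lam :: "real^'m"
  assumes U: "step_two U" and fr: "frame (W_mat U lam) e z" and \<kappa>: "0 < \<kappa>"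
  obtains C where "0 \<le> C" "\<And>\<epsilon> (m::'q \<Rightarrow> real) c g. 0 < \<epsilon> \<Longrightarrow> \<epsilon> \<le> 1 \<Longrightarrow> (\<And>i. \<kappa> \<le> m i \<and> m i \<le> L) \<Longrightarrow> c \<le> A \<Longrightarrow>
    \<bar>cutoff \<epsilon> g * (\<Sum>l\<in>UNIV. gsol2 U lam e m c l g) - sublaplacian U (\<lambda>g. cutoff \<epsilon> g * gsol lam e m c g) g\<bar> \<le> C * \<epsilon>"
proof -
  obtain C where C: "0 \<le> C"
    "\<And>\<epsilon> l g. 0 < \<epsilon> \<Longrightarrow> \<epsilon> \<le> 1 \<Longrightarrow> \<bar>cutoff1 U \<epsilon> l g\<bar> \<le> \<epsilon> * C * norm (fst g)"
    "\<And>\<epsilon> l g. 0 < \<epsilon> \<Longrightarrow> \<epsilon> \<le> 1 \<Longrightarrow> \<bar>cutoff2 U \<epsilon> l g\<bar> \<le> \<epsilon> * C * (1 + (norm (fst g))\<^sup>2)"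
    by (rule cutoff_bounds[of U]) blast
  define W where "W = W_mat U lam"
  have bl: "bounded_linear (\<lambda>x. W *v x)"
    using matrix_vector_mul_linear[of W] by (simp only: linear_linear)
  define N where "N = real CARD('q) * \<bar>L\<bar> + onorm (\<lambda>x. W *v x)"
  have N0: "0 \<le> N" using onorm_pos_le[OF bl] by (simp add: N_def)
  define C' where "C' = real CARD('q) * (C * (2 * N + 1) * (exp A * (1 + 4 / \<kappa>)))"
  have en: "norm (e i) = 1" for i using frame_orthonormal[OF fr, of i i] by (simp add: norm_eq_1)
  show thesis
  proof (rule that[of C'])
    show "0 \<le> C'" using C N0 \<kappa> by (simp add: C'_def)
    fix \<epsilon> c :: real and m :: "'q \<Rightarrow> real" and g :: "(real^'q) \<times> (real^'m)"
    assume \<epsilon>: "0 < \<epsilon>" "\<epsilon> \<le> 1" and m: "\<And>i. \<kappa> \<le> m i \<and> m i \<le> L" and c: "c \<le> A"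
    let ?x = "fst g"
    define E where "E = exp (c - 1/4 * (\<Sum>i\<in>UNIV. m i * (e i \<bullet> ?x)\<^sup>2))"
    have g0: "\<bar>gsol lam e m c g\<bar> \<le> E"
      using abs_cos_le_one[of "lam \<bullet> snd g"] by (simp add: gsol_def E_def[symmetric] abs_mult mult_left_le_one_le E_def)
    have M: "\<bar>Mvec e m ?x $ l\<bar> \<le> real CARD('q) * \<bar>L\<bar> * norm ?x" for l
    proof -
      have "\<bar>Mvec e m ?x $ l\<bar> \<le> (\<Sum>i\<in>(UNIV::'q set). \<bar>L\<bar> * norm ?x * 1)"
        unfolding Mvec_def sum_component
      proof (intro order_trans[OF sum_abs] sum_mono)
        fix i :: 'q
        have "\<bar>m i\<bar> \<le> \<bar>L\<bar>" using m[of i] \<kappa> by linarith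
        moreover have "\<bar>e i \<bullet> ?x\<bar> \<le> norm ?x" using Cauchy_Schwarz_ineq2[of "e i" ?x] by (simp add: en)
        moreover have "\<bar>e i $ l\<bar> \<le> 1" using component_le_norm_cart[of "e i" l] by (simp add: en)
        ultimately show "\<bar>((m i * (e i \<bullet> ?x)) *\<^sub>R e i) $ l\<bar> \<le> \<bar>L\<bar> * norm ?x * 1"
          unfolding vector_scaleR_component real_scaleR_def abs_mult by (intro mult_mono) auto
      qed
      then show ?thesis by simp
    qed
    have Wx: "\<bar>(W *v ?x) $ l\<bar> \<le> onorm (\<lambda>x. W *v x) * norm ?x" for l
      by (rule order_trans[OF component_le_norm_cart onorm[OF bl]])
    have g1: "\<bar>gsol1 U lam e m c l g\<bar> \<le> E * (N * norm ?x)" for l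
    proof -
      have "\<bar>cos (lam \<bullet> snd g) * Mvec e m ?x $ l + sin (lam \<bullet> snd g) * (W *v ?x) $ l\<bar>
         \<le> 1 * (real CARD('q) * \<bar>L\<bar> * norm ?x) + 1 * (onorm (\<lambda>x. W *v x) * norm ?x)"
        by (rule order_trans[OF abs_triangle_ineq], unfold abs_mult, intro add_mono mult_mono M Wx) auto
      also have "\<dots> = N * norm ?x" by (simp add: N_def algebra_simps)
      finally have "E * \<bar>cos (lam \<bullet> snd g) * Mvec e m ?x $ l + sin (lam \<bullet> snd g) * (W *v ?x) $ l\<bar> \<le> E * (N * norm ?x)"
        by (intro mult_left_mono) (auto simp: E_def)
      moreover have "\<bar>gsol1 U lam e m c l g\<bar> = 1/2 * (E * \<bar>cos (lam \<bullet> snd g) * Mvec e m ?x $ l + sin (lam \<bullet> snd g) * (W *v ?x) $ l\<bar>)"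
        by (simp add: gsol1_def E_def W_def abs_mult)
      moreover have "0 \<le> E * (N * norm ?x)" using N0 by (simp add: E_def)
      ultimately show ?thesis by linarith
    qed
    have EE: "E * (1 + (norm ?x)\<^sup>2) \<le> exp A * (1 + 4 / \<kappa>)"
    proof -
      have "(norm ?x)\<^sup>2 = (\<Sum>i\<in>UNIV. (e i \<bullet> ?x)\<^sup>2)"
        unfolding power2_norm_eq_inner by (subst frame_inner[OF fr]) (simp add: power2_eq_square)
      then have "\<kappa> * (norm ?x)\<^sup>2 \<le> (\<Sum>i\<in>UNIV. m i * (e i \<bullet> ?x)\<^sup>2)"
        unfolding sum_distrib_left using m by (auto intro!: sum_mono mult_right_mono simp: sum_distrib_left)
      then have "E \<le> exp (A - \<kappa> / 4 * (norm ?x)\<^sup>2)" unfolding E_def using c by simp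
      then have "E * (1 + (norm ?x)\<^sup>2) \<le> exp (A - \<kappa> / 4 * (norm ?x)\<^sup>2) * (1 + (norm ?x)\<^sup>2)"
        by (intro mult_right_mono) auto
      also have "\<dots> = exp A * (exp (- (\<kappa> / 4 * (norm ?x)\<^sup>2)) * (1 + (norm ?x)\<^sup>2))"
        by (simp only: diff_conv_add_uminus exp_add mult.assoc)
      also have "\<dots> \<le> exp A * (1 + 4 / \<kappa>)"
      proof (rule mult_left_mono)
        \<comment> \<open>The Gaussian exponent as variable: |x|^2 = (4 / \<kappa>) y, and both 1
          and y are at most exp y.\<close>
        let ?y = "\<kappa> / 4 * (norm ?x)\<^sup>2"
        have y: "0 \<le> ?y" using \<kappa> by simp
        have "1 + (norm ?x)\<^sup>2 = 1 + 4 / \<kappa> * ?y" using \<kappa> by simp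
        also have "\<dots> \<le> exp ?y + 4 / \<kappa> * exp ?y"
        proof (intro add_mono mult_left_mono)
          show "1 \<le> exp ?y" using y by simp
          show "?y \<le> exp ?y" using exp_ge_add_one_self[of ?y] by linarith
        qed (use \<kappa> in simp)
        also have "\<dots> = (1 + 4 / \<kappa>) * exp ?y" by (simp add: algebra_simps)
        finally show "exp (- ?y) * (1 + (norm ?x)\<^sup>2) \<le> 1 + 4 / \<kappa>"
          by (simp add: exp_minus field_simps)
      qed simp
      finally show ?thesis .
    qed
    have "\<bar>\<Sum>l\<in>UNIV. 2 * cutoff1 U \<epsilon> l g * gsol1 U lam e m c l g + cutoff2 U \<epsilon> l g * gsol lam e m c g\<bar>
       \<le> (\<Sum>l\<in>(UNIV::'q set). \<epsilon> * (C * (2 * N + 1) * (exp A * (1 + 4 / \<kappa>))))"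
    proof (intro order_trans[OF sum_abs] sum_mono)
      fix l :: 'q
      have E0: "0 \<le> E" by (simp add: E_def)
      have "\<bar>2 * cutoff1 U \<epsilon> l g * gsol1 U lam e m c l g + cutoff2 U \<epsilon> l g * gsol lam e m c g\<bar>
         \<le> 2 * (\<bar>cutoff1 U \<epsilon> l g\<bar> * \<bar>gsol1 U lam e m c l g\<bar>) + \<bar>cutoff2 U \<epsilon> l g\<bar> * \<bar>gsol lam e m c g\<bar>"
        by (rule order_trans[OF abs_triangle_ineq]) (simp add: abs_mult)
      also have "\<dots> \<le> 2 * ((\<epsilon> * C * norm ?x) * (E * (N * norm ?x))) + (\<epsilon> * C * (1 + (norm ?x)\<^sup>2)) * E"
        using C \<epsilon> E0 N0 by (intro add_mono mult_mono g0 g1) auto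
      also have "\<dots> = \<epsilon> * C * E * (2 * N * (norm ?x)\<^sup>2 + (1 + (norm ?x)\<^sup>2))"
        by (simp add: algebra_simps power2_eq_square)
      also have "\<dots> \<le> \<epsilon> * C * E * ((2 * N + 1) * (1 + (norm ?x)\<^sup>2))"
        using C \<epsilon> E0 N0 by (intro mult_left_mono) (auto simp: algebra_simps)
      also have "\<dots> = \<epsilon> * C * (2 * N + 1) * (E * (1 + (norm ?x)\<^sup>2))" by (simp add: mult_ac)
      also have "\<dots> \<le> \<epsilon> * C * (2 * N + 1) * (exp A * (1 + 4 / \<kappa>))"
        using C \<epsilon> N0 by (intro mult_left_mono EE) auto
      finally show "\<bar>2 * cutoff1 U \<epsilon> l g * gsol1 U lam e m c l g + cutoff2 U \<epsilon> l g * gsol lam e m c g\<bar>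
          \<le> \<epsilon> * (C * (2 * N + 1) * (exp A * (1 + 4 / \<kappa>)))" by (simp add: mult_ac)
    qed
    also have "\<dots> = C' * \<epsilon>" by (simp add: C'_def)
    finally show "\<bar>cutoff \<epsilon> g * (\<Sum>l\<in>UNIV. gsol2 U lam e m c l g) - sublaplacian U (\<lambda>g. cutoff \<epsilon> g * gsol lam e m c g) g\<bar> \<le> C' * \<epsilon>"
      unfolding cutoff_product_laplacian[OF U] by simp
  qed
qed

section \<open>The heat kernel tested against the explicit solutions\<close>

text \<open>An antiderivative in s of -1/2 times the trace of the rates, these being logarithmic
  derivatives of \<open>mehler\<close>. Its exponential is the product of the \<open>mehler\<close>
  values to the power -1/2.\<close>

definition mehler_c :: "real \<Rightarrow> ('q::finite \<Rightarrow> real) \<Rightarrow> real \<Rightarrow> real" where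
  "mehler_c a z s = - 1/2 * (\<Sum>i\<in>UNIV. ln (mehler a (z i) s))"

text \<open>The derivative is the expression of \<open>gsol_heat\<close> with f the rate at time s,
  which is the heat equation: the Riccati equation accounts for the quadratic part,
  \<open>mehler_c\<close> for the trace.\<close>

lemma DERIV_gsol:
  assumes a: "0 < a" and z: "\<And>i. 0 \<le> z i" and s: "0 \<le> s"
  shows "((\<lambda>s. gsol lam e (\<lambda>i. mrate a (z i) s) (mehler_c a z s) g) has_real_derivative
    gsol lam e (\<lambda>i. mrate a (z i) s) (mehler_c a z s) g * (- 1/2 * (\<Sum>i\<in>UNIV. mrate a (z i) s)
      - 1/4 * (\<Sum>i\<in>UNIV. ((z i)\<^sup>2 - (mrate a (z i) s)\<^sup>2) * (e i \<bullet> fst g)\<^sup>2))) (at s)"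
proof -
  have "((\<lambda>s. ln (mehler a (z i) s)) has_real_derivative mrate a (z i) s) (at s)" for i
    using mehler_pos[OF a z s, of i]
    by (auto intro!: derivative_eq_intros DERIV_mehler simp: mrate_def)
  then have 1: "(mehler_c a z has_real_derivative - 1/2 * (\<Sum>i\<in>UNIV. mrate a (z i) s)) (at s)"
    unfolding mehler_c_def[abs_def] by (intro DERIV_cmult DERIV_sum)
  have 2: "((\<lambda>s. \<Sum>i\<in>UNIV. mrate a (z i) s * (e i \<bullet> fst g)\<^sup>2) has_real_derivative
      (\<Sum>i\<in>UNIV. ((z i)\<^sup>2 - (mrate a (z i) s)\<^sup>2) * (e i \<bullet> fst g)\<^sup>2)) (at s)"
    by (intro DERIV_sum DERIV_cmult_right DERIV_mrate a z s)
  note DERIV_cmult[OF DERIV_chain2[OF DERIV_exp DERIV_diff[OF 1 DERIV_cmult[OF 2, of "1/4"]]], of "cos (lam \<bullet> snd g)"]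
  then show ?thesis unfolding gsol_def by (simp only: mult.assoc)
qed

text \<open>For a > 0 the rates are continuous and positive on the whole closed interval, with value
  1 / a at 0; for a point mass they would be infinite there.\<close>

lemma mehler_bounds:
  fixes z :: "'q::finite \<Rightarrow> real"
  assumes a: "0 < a" and z: "\<And>i. 0 \<le> z i" and h: "0 \<le> h"
  obtains \<kappa> L A where "0 < \<kappa>" "\<And>s i. s \<in> {0..h} \<Longrightarrow> \<kappa> \<le> mrate a (z i) s \<and> mrate a (z i) s \<le> L"
    "\<And>s. s \<in> {0..h} \<Longrightarrow> mehler_c a z s \<le> A"
proof -
  have "\<exists>l u. 0 < l \<and> (\<forall>s\<in>{0..h}. l \<le> mrate a (z i) s \<and> mrate a (z i) s \<le> u)" for i
  proof -
    have c: "continuous_on {0..h} (mrate a (z i))" by (rule continuous_mrate(1)[OF a z])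
    obtain s1 where s1: "s1 \<in> {0..h}" "\<And>s. s \<in> {0..h} \<Longrightarrow> mrate a (z i) s1 \<le> mrate a (z i) s"
      using continuous_attains_inf[OF _ _ c] h by auto
    obtain s2 where s2: "s2 \<in> {0..h}" "\<And>s. s \<in> {0..h} \<Longrightarrow> mrate a (z i) s \<le> mrate a (z i) s2"
      using continuous_attains_sup[OF _ _ c] h by auto
    have "0 < mrate a (z i) s1" using s1(1) mehler_pos[OF a z] by (simp add: mrate_def)
    then show ?thesis using s1 s2 by blast
  qed
  then obtain l u where lu: "\<And>i. 0 < l i" "\<And>i s. s \<in> {0..h} \<Longrightarrow> l i \<le> mrate a (z i) s \<and> mrate a (z i) s \<le> u i"
    by metis
  have c: "continuous_on {0..h} (mehler_c a z)"
    unfolding mehler_c_def[abs_def] by (intro continuous_intros continuous_mrate a z)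
  obtain s3 where s3: "s3 \<in> {0..h}" "\<And>s. s \<in> {0..h} \<Longrightarrow> mehler_c a z s \<le> mehler_c a z s3"
    using continuous_attains_sup[OF _ _ c] h by auto
  show thesis
  proof (rule that[of "Min (range l)" "Max (range u)" "mehler_c a z s3"])
    show "0 < Min (range l)" using lu by simp
    fix s i assume "s \<in> {0..h}"
    then show "Min (range l) \<le> mrate a (z i) s \<and> mrate a (z i) s \<le> Max (range u)"
      using lu(2)[of s i] by (meson Max_ge Min_le finite finite_imageI order_trans rangeI)
  qed (use s3 in auto)
qed

text \<open>For the cut-off solution the Duhamel residual reduces to the cutoff commutator, because
  the solution itself satisfies the heat equation exactly.\<close>

lemma heat_semigroup_gsol_approx:
  fixes U :: "'m::finite \<Rightarrow> real^'q^'q" and lam :: "real^'m"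
  assumes U: "step_two U" and T: "heat_semigroup U T" and fr: "frame (W_mat U lam) e z" and a: "0 < a" and h: "0 < h"
  defines "u \<equiv> \<lambda>s. gsol lam e (\<lambda>i. mrate a (z i) s) (mehler_c a z s)"
  obtains C where "\<And>\<epsilon> g. 0 < \<epsilon> \<Longrightarrow> \<epsilon> \<le> 1 \<Longrightarrow> \<bar>cutoff \<epsilon> g * u h g - T h (\<lambda>g. cutoff \<epsilon> g * u 0 g) g\<bar> \<le> C * \<epsilon>"
proof -
  have z: "\<And>i. 0 \<le> z i" using fr by (simp add: frame_def)
  obtain \<kappa> L A where b: "0 < \<kappa>" "\<And>s i. s \<in> {0..h} \<Longrightarrow> \<kappa> \<le> mrate a (z i) s \<and> mrate a (z i) s \<le> L"
    "\<And>s. s \<in> {0..h} \<Longrightarrow> mehler_c a z s \<le> A"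
    by (rule mehler_bounds[of a z h, OF a z less_imp_le[OF h]]) blast
  obtain C where C: "0 \<le> C" "\<And>\<epsilon> m c g. 0 < \<epsilon> \<Longrightarrow> \<epsilon> \<le> 1 \<Longrightarrow> (\<And>i. \<kappa> \<le> m i \<and> m i \<le> L) \<Longrightarrow> c \<le> A \<Longrightarrow>
    \<bar>cutoff \<epsilon> g * (\<Sum>l\<in>UNIV. gsol2 U lam e m c l g) - sublaplacian U (\<lambda>g. cutoff \<epsilon> g * gsol lam e m c g) g\<bar> \<le> C * \<epsilon>"
    by (rule cutoff_error[OF U fr b(1), of L A]) blast
  define v where "v s g = u s g * (- 1/2 * (\<Sum>i\<in>UNIV. mrate a (z i) s)
      - 1/4 * (\<Sum>i\<in>UNIV. ((z i)\<^sup>2 - (mrate a (z i) s)\<^sup>2) * (e i \<bullet> fst g)\<^sup>2))" for s g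
  have v: "v s g = (\<Sum>l\<in>UNIV. gsol2 U lam e (\<lambda>i. mrate a (z i) s) (mehler_c a z s) l g)" for s g
    using gsol_heat[OF fr, of "\<lambda>\<zeta>. mrate a \<zeta> s"] by (simp add: v_def u_def)
  show thesis
  proof (rule that[of "C * h"])
    fix \<epsilon> :: real and g assume \<epsilon>: "0 < \<epsilon>" "\<epsilon> \<le> 1"
    define f where "f s g = cutoff \<epsilon> g * u s g" for s g
    define f' where "f' s g = cutoff \<epsilon> g * v s g" for s g
    let ?K = "cball 0 (1 / \<epsilon>) :: ((real^'q) \<times> (real^'m)) set"
    have out: "g \<notin> ?K \<Longrightarrow> cutoff \<epsilon> g = 0" for g :: "(real^'q) \<times> (real^'m)"
      using cutoff_zero[OF \<epsilon>(1), of g] by (simp add: not_le)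
    have D: "((\<lambda>s. f s g) has_real_derivative f' s g) (at s)" if "s \<in> {0..h}" for s g
      unfolding f_def f'_def v_def u_def using that by (intro DERIV_cmult DERIV_gsol a z) auto
    have cont: "continuous_on ({0..h} \<times> ?K) (\<lambda>(s, g). f' s g)"
    proof -
      have m: "continuous_on ({0..h} \<times> ?K) (\<lambda>p. mrate a (z i) (fst p))" for i
        by (rule continuous_on_compose2[OF continuous_mrate(1)[OF a z, of h]]) (auto intro!: continuous_intros)
      have l: "continuous_on ({0..h} \<times> ?K) (\<lambda>p. ln (mehler a (z i) (fst p)))" for i
        by (rule continuous_on_compose2[OF continuous_mrate(2)[OF a z, of h]]) (auto intro!: continuous_intros)
      have "continuous_on UNIV (cutoff \<epsilon> :: (real^'q) \<times> (real^'m) \<Rightarrow> real)"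
        using smooth_fn_C_n[OF smooth_cutoff, of 0] by simp
      then have c: "continuous_on ({0..h} \<times> ?K) (\<lambda>p. cutoff \<epsilon> (snd p))"
        by (rule continuous_on_compose2) (auto intro!: continuous_intros)
      show ?thesis
        unfolding case_prod_beta f'_def v_def u_def gsol_def mehler_c_def by (intro continuous_intros m l c)
    qed
    have "\<bar>f h g - T h (f 0) g\<bar> \<le> (C * \<epsilon>) * h"
    proof (rule semigroup_duhamel[OF T h, of _ f f'])
      show "0 \<le> C * \<epsilon>" using C \<epsilon> by simp
      show "f s \<in> test_fun" for s
        unfolding f_def u_def using out
        by (intro smooth_fn_test_fun[of _ "1 / \<epsilon>"] smooth_mult smooth_cutoff smooth_gsol) (auto simp: cutoff_zero[OF \<epsilon>(1)])
      show "0 \<le> s \<Longrightarrow> s < h \<Longrightarrow> uniform_limit UNIV (\<lambda>d g. (f (s + d) g - f s g) / d) (f' s) (at_right 0)" for s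
        by (rule uniform_derivative_compact(1)[of ?K f f' h]) (use D cont in \<open>auto simp: f_def f'_def out\<close>)
      show "0 < s \<Longrightarrow> s \<le> h \<Longrightarrow> uniform_limit UNIV f (f s) (at_left s)" for s
        by (rule uniform_derivative_compact(2)[of ?K f f' h]) (use D cont in \<open>auto simp: f_def f'_def out\<close>)
      show "\<bar>f' s y - sublaplacian U (f s) y\<bar> \<le> C * \<epsilon>" if "0 \<le> s" "s < h" for s y
        unfolding f'_def v f_def u_def using that by (intro C(2) \<epsilon> b) auto
    qed
    moreover have "f 0 = (\<lambda>g. cutoff \<epsilon> g * u 0 g)" by (simp add: f_def fun_eq_iff)
    ultimately show "\<bar>cutoff \<epsilon> g * u h g - T h (\<lambda>g. cutoff \<epsilon> g * u 0 g) g\<bar> \<le> C * h * \<epsilon>"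
      by (simp add: f_def mult_ac)
  qed
qed

subsection \<open>The kernel\<close>

lemma integrable_compact_support:
  fixes f :: "'a::euclidean_space \<Rightarrow> real"
  assumes "continuous_on UNIV f" "\<And>x. R < norm x \<Longrightarrow> f x = 0"
  shows "integrable lborel f"
proof -
  have "integrable lborel (\<lambda>x. indicator (cball 0 R) x *\<^sub>R f x)"
    using assms(1) by (intro borel_integrable_compact) (auto intro: continuous_on_subset)
  moreover have "(\<lambda>x. indicator (cball 0 R) x *\<^sub>R f x) = f"
    using assms(2) by (auto simp: indicator_def fun_eq_iff not_le)
  ultimately show ?thesis by simp
qed

text \<open>Test with continuous, compactly supported approximations of the sign of P and apply
  Fatou. For such u the product u P is integrable, so nothing about P at infinity is
  presupposed.\<close>

lemma integrable_of_bounded_pairing: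
  fixes P :: "'a::euclidean_space \<Rightarrow> real"
  assumes P: "continuous_on UNIV P"
    and bound: "\<And>u. u \<in> C_zero \<Longrightarrow> (\<And>x. \<bar>u x\<bar> \<le> 1) \<Longrightarrow> \<bar>LINT x|lborel. u x * P x\<bar> \<le> 1"
  shows "integrable lborel P"
proof -
  \<comment> \<open>The first factor is a continuous bump of height 1 that spreads over the whole
    space. The second tends to the sign of P, and the summand 1 / (n + 1) keeps it continuous at the
    zeros of P.\<close>
  define w where "w n x = max 0 (min 1 (real n + 1 - norm x)) * (P x / (\<bar>P x\<bar> + 1 / real (Suc n)))" for n x
  have den: "0 < \<bar>P x\<bar> + 1 / real (Suc n)" for n x by (intro add_nonneg_pos) auto
  have wc: "continuous_on UNIV (w n)" for n
    unfolding w_def[abs_def] using den[of _ n]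
    by (intro continuous_intros P) (auto simp: less_imp_neq[symmetric])
  have w0: "w n x = 0" if "real n + 1 < norm x" for n x using that by (simp add: w_def)
  have w1: "\<bar>w n x\<bar> \<le> 1" for n x
  proof -
    have "\<bar>P x / (\<bar>P x\<bar> + 1 / real (Suc n))\<bar> \<le> 1" using den[of x n] by (simp add: abs_divide)
    moreover have "\<bar>max 0 (min 1 (real n + 1 - norm x))\<bar> \<le> 1" by auto
    ultimately show ?thesis unfolding w_def abs_mult by (metis abs_ge_zero mult_le_one)
  qed
  have wP: "0 \<le> w n x * P x" for n x
    using den[of x n] by (simp add: w_def zero_le_mult_iff zero_le_divide_iff mult.assoc)
  have int: "integrable lborel (\<lambda>x. w n x * P x)" for n
    by (rule integrable_compact_support[of _ "real n + 1"]) (auto intro!: continuous_intros wc P simp: w0)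
  have le: "(\<integral>\<^sup>+x. ennreal (w n x * P x) \<partial>lborel) \<le> 1" for n
  proof -
    have "\<bar>LINT x|lborel. w n x * P x\<bar> \<le> 1"
      by (intro bound w1 C_zero_compact_support[of _ "real n + 1"] wc w0)
    then show ?thesis
      unfolding nn_integral_eq_integral[OF int AE_I2[OF wP]] using ennreal_le_1 by auto
  qed
  have lim: "(\<lambda>n. w n x * P x) \<longlonglongrightarrow> \<bar>P x\<bar>" for x
  proof -
    have "\<forall>\<^sub>F n in sequentially. max 0 (min 1 (real n + 1 - norm x)) = 1"
    proof -
      obtain N where "norm x \<le> real N" using real_arch_simple by blast
      then show ?thesis by (auto simp: eventually_sequentially intro!: exI[of _ N])
    qed
    then have 1: "(\<lambda>n. max 0 (min 1 (real n + 1 - norm x))) \<longlonglongrightarrow> 1" by (rule tendsto_eventually)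
    have 2: "(\<lambda>n. P x / (\<bar>P x\<bar> + 1 / real (Suc n)) * P x) \<longlonglongrightarrow> \<bar>P x\<bar>"
    proof (cases "P x = 0")
      case False
      have "(\<lambda>n. P x / (\<bar>P x\<bar> + 1 / real (Suc n)) * P x) \<longlonglongrightarrow> P x / (\<bar>P x\<bar> + 0) * P x"
        using False by (intro tendsto_intros LIMSEQ_Suc lim_1_over_n) auto
      moreover have "P x / (\<bar>P x\<bar> + 0) * P x = \<bar>P x\<bar>" using False by (simp add: abs_if)
      ultimately show ?thesis by simp
    qed simp
    show ?thesis unfolding w_def using tendsto_mult[OF 1 2] by (simp add: mult.assoc)
  qed
  have [measurable]: "P \<in> borel_measurable borel" "w n \<in> borel_measurable borel" for n
    using P wc by (auto intro: borel_measurable_continuous_onI)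
  have "(\<integral>\<^sup>+x. ennreal \<bar>P x\<bar> \<partial>lborel) = (\<integral>\<^sup>+x. liminf (\<lambda>n. ennreal (w n x * P x)) \<partial>lborel)"
    using lim by (intro nn_integral_cong lim_imp_Liminf[symmetric] tendsto_ennrealI) auto
  also have "\<dots> \<le> liminf (\<lambda>n. \<integral>\<^sup>+x. ennreal (w n x * P x) \<partial>lborel)"
    by (intro nn_integral_liminf) simp
  also have "\<dots> \<le> liminf (\<lambda>n. 1)" by (intro Liminf_mono always_eventually allI le)
  also have "\<dots> < \<infinity>" by (simp add: Liminf_const)
  finally show ?thesis by (intro integrableI_bounded) auto
qed

context
  fixes U :: "'m::finite \<Rightarrow> real^'q^'q" and p :: "real \<Rightarrow> (real^'q) \<times> (real^'m) \<Rightarrow> real" and h :: real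
  assumes U: "step_two U" and p: "heat_kernel U p" and h: "0 < h"
begin

lemma continuous_bracket: "continuous_on UNIV (\<lambda>g'. gmult U (ginv g') g)"
proof -
  have "continuous_on UNIV (\<lambda>x. U j *v x)" for j
    using linear_continuous_on[of "\<lambda>x. U j *v x" UNIV] matrix_vector_mul_linear[of "U j"] by (simp only: linear_linear)
  then have "continuous_on UNIV (\<lambda>g' :: (real^'q) \<times> (real^'m). U j *v (- fst g'))" for j
    by (rule continuous_on_compose2) (auto intro!: continuous_intros)
  then show ?thesis
    unfolding gmult_def ginv_def bracket_def by (intro continuous_intros) simp
qed

lemma continuous_kernel: "continuous_on UNIV (\<lambda>g'. p h (gmult U (ginv g') g))"
proof -
  have "continuous_on UNIV (p h)" using p h unfolding heat_kernel_def by blast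
  then show ?thesis by (rule continuous_on_compose2[OF _ continuous_bracket]) auto
qed

text \<open>Contractivity of T h in the sup norm is the pairing bound that
  \<open>integrable_of_bounded_pairing\<close> asks for.\<close>

lemma integrable_kernel: "integrable lborel (\<lambda>g'. p h (gmult U (ginv g') g))"
proof (rule integrable_of_bounded_pairing[OF continuous_kernel])
  fix u :: "(real^'q) \<times> (real^'m) \<Rightarrow> real" assume u: "u \<in> C_zero" "\<And>x. \<bar>u x\<bar> \<le> 1"
  obtain T where T: "heat_semigroup U T" "\<And>u g. u \<in> C_zero \<Longrightarrow> T h u g = (LINT g'|lborel. u g' * p h (gmult U (ginv g') g))"
    using p h unfolding heat_kernel_def by blast
  have "\<forall>h\<ge>0. \<forall>f\<in>C_zero. \<forall>B. (\<forall>g. \<bar>f g\<bar> \<le> B) \<longrightarrow> (\<forall>g. \<bar>T h f g\<bar> \<le> B)"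
    using T(1) unfolding heat_semigroup_def by blast
  then have "\<bar>T h u g\<bar> \<le> 1" using u less_imp_le[OF h] by blast
  then show "\<bar>LINT g'|lborel. u g' * p h (gmult U (ginv g') g)\<bar> \<le> 1" by (simp add: T(2)[OF u(1)])
qed

text \<open>Let the cutoff parameter tend to 0: the Duhamel error is of its order, and the integrals
  against the kernel converge by domination, the kernel being integrable and the initial datum
  bounded.\<close>

lemma kernel_gsol:
  fixes lam :: "real^'m"
  assumes fr: "frame (W_mat U lam) e z" and a: "0 < a"
  shows "(LINT g'|lborel. gsol lam e (\<lambda>i. mrate a (z i) 0) (mehler_c a z 0) g' * p h (gmult U (ginv g') g))
    = gsol lam e (\<lambda>i. mrate a (z i) h) (mehler_c a z h) g"
proof -
  define u where "u s = gsol lam e (\<lambda>i. mrate a (z i) s) (mehler_c a z s)" for s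
  obtain T where T: "heat_semigroup U T" "\<And>u g. u \<in> C_zero \<Longrightarrow> T h u g = (LINT g'|lborel. u g' * p h (gmult U (ginv g') g))"
    using p h unfolding heat_kernel_def by blast
  obtain C where C: "\<And>\<epsilon> g. 0 < \<epsilon> \<Longrightarrow> \<epsilon> \<le> 1 \<Longrightarrow> \<bar>cutoff \<epsilon> g * u h g - T h (\<lambda>g. cutoff \<epsilon> g * u 0 g) g\<bar> \<le> C * \<epsilon>"
    unfolding u_def by (rule heat_semigroup_gsol_approx[OF U T(1) fr a h]) blast
  define P where "P g' = p h (gmult U (ginv g') g)" for g'
  define \<epsilon> where "\<epsilon> n = 1 / real (Suc n)" for n
  have \<epsilon>: "0 < \<epsilon> n" "\<epsilon> n \<le> 1" for n by (auto simp: \<epsilon>_def)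
  have cu: "(\<lambda>g. cutoff (\<epsilon> n) g * u 0 g) \<in> C_zero" for n
    unfolding u_def
    by (intro test_fun_C_zero smooth_fn_test_fun[of _ "1 / \<epsilon> n"] smooth_mult smooth_cutoff smooth_gsol)
      (auto simp: cutoff_zero[OF \<epsilon>(1)])
  have c1: "continuous_on UNIV (cutoff r :: (real^'q) \<times> (real^'m) \<Rightarrow> real)" for r
    using smooth_fn_C_n[OF smooth_cutoff, of 0] by simp
  have c2: "continuous_on UNIV (u 0)"
    unfolding u_def using smooth_fn_C_n[OF smooth_gsol, of 0] by simp
  have z: "\<And>i. 0 \<le> z i" using fr by (simp add: frame_def)
  have ub: "\<bar>u 0 y\<bar> \<le> exp (mehler_c a z 0)" for y
  proof -
    have "0 \<le> (\<Sum>i\<in>UNIV. mrate a (z i) 0 * (e i \<bullet> fst y)\<^sup>2)"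
      using mehler_pos[OF a z, of 0] by (intro sum_nonneg mult_nonneg_nonneg) (auto simp: mrate_def less_imp_le)
    then have "exp (mehler_c a z 0 - 1/4 * (\<Sum>i\<in>UNIV. mrate a (z i) 0 * (e i \<bullet> fst y)\<^sup>2)) \<le> exp (mehler_c a z 0)" by simp
    then have "\<bar>cos (lam \<bullet> snd y)\<bar> * exp (mehler_c a z 0 - 1/4 * (\<Sum>i\<in>UNIV. mrate a (z i) 0 * (e i \<bullet> fst y)\<^sup>2)) \<le> 1 * exp (mehler_c a z 0)"
      by (intro mult_mono) auto
    then show ?thesis by (simp add: u_def gsol_def abs_mult)
  qed
  have mP: "P \<in> borel_measurable borel"
    unfolding P_def[abs_def] by (intro borel_measurable_continuous_onI continuous_kernel)
  have "(\<lambda>n. LINT g'|lborel. cutoff (\<epsilon> n) g' * u 0 g' * P g') \<longlonglongrightarrow> (LINT g'|lborel. u 0 g' * P g')"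
  proof (rule integral_dominated_convergence)
    show "integrable lborel (\<lambda>y. exp 1 * exp (mehler_c a z 0) * \<bar>P y\<bar>)"
      using integrable_kernel[of g] by (simp add: P_def)
    show "(\<lambda>g'. u 0 g' * P g') \<in> borel_measurable lborel"
      using mP borel_measurable_continuous_onI[OF c2] by simp
    show "(\<lambda>g'. cutoff (\<epsilon> n) g' * u 0 g' * P g') \<in> borel_measurable lborel" for n
      using mP borel_measurable_continuous_onI[OF c2] borel_measurable_continuous_onI[OF c1] by simp
    show "AE y in lborel. (\<lambda>n. cutoff (\<epsilon> n) y * u 0 y * P y) \<longlonglongrightarrow> u 0 y * P y"
    proof (intro AE_I2)
      fix y
      have "(\<lambda>n. cutoff (\<epsilon> n) y * u 0 y * P y) \<longlonglongrightarrow> 1 * u 0 y * P y"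
        unfolding \<epsilon>_def by (intro tendsto_intros cutoff_tendsto)
      then show "(\<lambda>n. cutoff (\<epsilon> n) y * u 0 y * P y) \<longlonglongrightarrow> u 0 y * P y" by simp
    qed
    show "AE y in lborel. norm (cutoff (\<epsilon> n) y * u 0 y * P y) \<le> exp 1 * exp (mehler_c a z 0) * \<bar>P y\<bar>" for n
      by (intro AE_I2) (simp add: abs_mult mult_mono cutoff_bounded ub mult_right_mono)
  qed
  then have 1: "(\<lambda>n. T h (\<lambda>g. cutoff (\<epsilon> n) g * u 0 g) g) \<longlonglongrightarrow> (LINT g'|lborel. u 0 g' * P g')"
    by (simp add: T(2)[OF cu] P_def)
  have "(\<lambda>n. cutoff (\<epsilon> n) g * u h g - T h (\<lambda>g. cutoff (\<epsilon> n) g * u 0 g) g) \<longlonglongrightarrow> 0"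
  proof (rule Lim_null_comparison)
    show "\<forall>\<^sub>F n in sequentially. norm (cutoff (\<epsilon> n) g * u h g - T h (\<lambda>g. cutoff (\<epsilon> n) g * u 0 g) g) \<le> C * \<epsilon> n"
      using C[OF \<epsilon>] by simp
    have "(\<lambda>n. C * \<epsilon> n) \<longlonglongrightarrow> C * 0" unfolding \<epsilon>_def by (intro tendsto_intros LIMSEQ_Suc lim_1_over_n)
    then show "(\<lambda>n. C * \<epsilon> n) \<longlonglongrightarrow> 0" by simp
  qed
  moreover have "(\<lambda>n. cutoff (\<epsilon> n) g * u h g) \<longlonglongrightarrow> 1 * u h g"
    unfolding \<epsilon>_def by (intro tendsto_intros cutoff_tendsto)
  ultimately have "(\<lambda>n. cutoff (\<epsilon> n) g * u h g - (cutoff (\<epsilon> n) g * u h g - T h (\<lambda>g. cutoff (\<epsilon> n) g * u 0 g) g)) \<longlonglongrightarrow> 1 * u h g - 0"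
    by (intro tendsto_diff)
  then have "(\<lambda>n. T h (\<lambda>g. cutoff (\<epsilon> n) g * u 0 g) g) \<longlonglongrightarrow> u h g" by simp
  with 1 have "(LINT g'|lborel. u 0 g' * P g') = u h g" by (rule LIMSEQ_unique)
  then show ?thesis by (simp add: u_def P_def)
qed

end

section \<open>The kernels P\<close>

text \<open>\<open>dQ\<close> and \<open>qR\<close> are real counterparts of the complex factors of
  \<open>P_ker\<close>. Real parts lose nothing for skew U, as \<open>det_Q_powr\<close> and
  \<open>quad_form_R\<close> show.\<close>

definition dQ :: "('m::finite \<Rightarrow> real^'q^'q) \<Rightarrow> nat \<Rightarrow> real^'m \<Rightarrow> real" where
  "dQ U k lam = 1 / sqrt (Re (det (matrix_fun (Q_fun k) (U_mat U lam))))"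

definition qR :: "('m::finite \<Rightarrow> real^'q^'q) \<Rightarrow> nat \<Rightarrow> real^'m \<Rightarrow> real^'q \<Rightarrow> real" where
  "qR U k lam X = Re (quad_form (matrix_fun (R_fun k) (U_mat U lam)) X)"

lemma det_Q_frame:
  assumes "frame (W_mat U lam) e z"
  shows "det (matrix_fun (Q_fun k) (U_mat U lam)) = of_real (\<Prod>i\<in>UNIV. Q_fun k (z i))"
  unfolding U_mat_eq by (rule det_matrix_fun_frame[OF assms]) (rule Q_fun_even)

lemma dQ_frame:
  assumes "frame (W_mat U lam) e z"
  shows "dQ U k lam = 1 / sqrt (\<Prod>i\<in>UNIV. Q_fun k (z i))"
  unfolding dQ_def det_Q_frame[OF assms] Re_complex_of_real ..

lemma quad_form_R_frame:
  assumes "frame (W_mat U lam) e z"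
  shows "quad_form (matrix_fun (R_fun k) (U_mat U lam)) X = of_real (\<Sum>i\<in>UNIV. R_fun k (z i) * (e i \<bullet> X)\<^sup>2)"
  unfolding U_mat_eq by (rule quad_form_matrix_fun_frame[OF assms]) (rule R_fun_even)

lemma qR_frame:
  assumes "frame (W_mat U lam) e z"
  shows "qR U k lam X = (\<Sum>i\<in>UNIV. R_fun k (z i) * (e i \<bullet> X)\<^sup>2)"
  unfolding qR_def quad_form_R_frame[OF assms] Re_complex_of_real ..

lemma frame_W_mat:
  assumes "step_two U"
  obtains e z where "frame (W_mat U lam) e z"
  using frame_exists[OF W_mat_skew[OF assms]] by blast

lemma prod_Q_pos: "0 < (\<Prod>i\<in>A. Q_fun k (z i))"
  by (intro prod_pos) (auto simp: Q_fun_pos)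

lemma det_Q_powr:
  assumes U: "step_two U"
  shows "det (matrix_fun (Q_fun k) (U_mat U lam)) powr (-1/2) = of_real (dQ U k lam)"
proof -
  obtain e z where fr: "frame (W_mat U lam) e z" by (rule frame_W_mat[OF U])
  have "(complex_of_real (\<Prod>i\<in>UNIV. Q_fun k (z i))) powr (complex_of_real (-1/2)) = of_real ((\<Prod>i\<in>UNIV. Q_fun k (z i)) powr (-1/2))"
    by (rule powr_of_real) (use prod_Q_pos[of k z UNIV] in simp)
  moreover have "(\<Prod>i\<in>UNIV. Q_fun k (z i)) powr (-1/2) = 1 / sqrt (\<Prod>i\<in>UNIV. Q_fun k (z i))"
    using prod_Q_pos[of k z UNIV] by (simp add: powr_minus_divide powr_half_sqrt)
  ultimately show ?thesis by (simp add: det_Q_frame[OF fr] dQ_frame[OF fr])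
qed

lemma quad_form_R:
  assumes U: "step_two U"
  shows "quad_form (matrix_fun (R_fun k) (U_mat U lam)) X = of_real (qR U k lam X)"
proof -
  obtain e z where fr: "frame (W_mat U lam) e z" by (rule frame_W_mat[OF U])
  show ?thesis by (simp add: quad_form_R_frame[OF fr] qR_frame[OF fr])
qed

lemma dQ_pos: "step_two U \<Longrightarrow> 0 < dQ U k lam"
  by (rule frame_W_mat[of U lam]) (auto simp: dQ_frame prod_Q_pos)

lemma qR_nonneg: "step_two U \<Longrightarrow> 0 \<le> qR U k lam X"
  by (rule frame_W_mat[of U lam]) (auto simp: qR_frame intro!: sum_nonneg mult_nonneg_nonneg R_fun_nonneg)

lemma P_ker_eq:
  fixes U :: "'m::finite \<Rightarrow> real^'q^'q"
  assumes U: "step_two U"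
  shows "P_ker U k h (X, T) = of_real (h powr (- (real (k + 1) * real CARD('q) / 2) - real CARD('m))) *
    (LINT lam|lborel. of_real (dQ U k lam * exp (- qR U k lam X / (2 * h))) * iexp (T \<bullet> lam / h))"
proof -
  have "det (matrix_fun (Q_fun k) (U_mat U lam)) powr (-1/2) *
        exp (- (quad_form (matrix_fun (R_fun k) (U_mat U lam)) X - 2 * \<i> * of_real (T \<bullet> lam)) / of_real (2 * h))
     = of_real (dQ U k lam * exp (- qR U k lam X / (2 * h))) * iexp (T \<bullet> lam / h)" for lam
  proof -
    have "- (of_real (qR U k lam X) - 2 * \<i> * of_real (T \<bullet> lam)) / of_real (2 * h)
        = of_real (- qR U k lam X / (2 * h)) + \<i> * of_real (T \<bullet> lam / h)"
      by (cases "h = 0") (auto simp: field_simps)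
    then have "exp (- (of_real (qR U k lam X) - 2 * \<i> * of_real (T \<bullet> lam)) / of_real (2 * h))
        = of_real (exp (- qR U k lam X / (2 * h))) * iexp (T \<bullet> lam / h)"
      by (simp only: exp_add exp_of_real)
    then show ?thesis unfolding det_Q_powr[OF U] quad_form_R[OF U] by (simp only: of_real_mult mult.assoc)
  qed
  then show ?thesis unfolding P_ker_def by simp
qed

section \<open>Measurability and integrability over lam\<close>

lemma measurable_dQ:
  assumes U: "step_two U"
  shows "dQ U k \<in> borel_measurable borel"
proof -
  note [measurable] = measurable_matrix_fun[OF U continuous_Q_fun]
  have "(\<lambda>lam. det (matrix_fun (Q_fun k) (U_mat U lam))) \<in> borel_measurable borel"
    unfolding det_def by measurable
  then show ?thesis unfolding dQ_def[abs_def] by simp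
qed

lemma measurable_qR:
  assumes U: "step_two U"
  shows "(\<lambda>p. qR U k (fst p) (snd p)) \<in> borel_measurable (borel \<Otimes>\<^sub>M borel)"
proof -
  note m = measurable_matrix_fun[OF U continuous_R_fun]
  have [measurable]: "(\<lambda>p. matrix_fun (R_fun k) (U_mat U (fst p)) $ a $ b) \<in> borel_measurable (borel \<Otimes>\<^sub>M (borel :: (real^'b) measure))" for a b
    by (rule measurable_compose[OF measurable_fst m])
  have [measurable]: "(\<lambda>p. snd p $ a) \<in> borel_measurable (borel \<Otimes>\<^sub>M borel)" for a :: 'b
    by (rule measurable_compose[OF measurable_snd]) (intro borel_measurable_continuous_onI continuous_intros)
  show ?thesis
    unfolding qR_def quad_form_def matrix_vector_mult_def vec_lambda_beta by measurable
qed

lemma one_plus_sum_le_prod: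
  fixes f :: "'a \<Rightarrow> real"
  assumes "finite A" "\<And>x. x \<in> A \<Longrightarrow> 0 \<le> f x"
  shows "1 + sum f A \<le> (\<Prod>x\<in>A. 1 + f x)"
  using assms
proof (induction A rule: finite_induct)
  case (insert x A)
  have "1 + sum f (insert x A) \<le> (1 + f x) * (1 + sum f A)"
    using insert by (simp add: algebra_simps sum_nonneg)
  also have "\<dots> \<le> (1 + f x) * (\<Prod>x\<in>A. 1 + f x)" using insert by (intro mult_left_mono) auto
  finally show ?case using insert by simp
qed simp

lemma integrable_inverse_square:
  assumes c: "0 < c"
  shows "integrable lborel (\<lambda>s::real. 1 / (1 + c * s\<^sup>2))"
proof -
  have "integrable lborel (\<lambda>s::real. inverse (1 + s\<^sup>2))"
    using integrable_inverse_1_plus_square by (simp add: set_integrable_def einterval_eq_UNIV)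
  then have "integrable lborel (\<lambda>s. inverse (1 + (0 + sqrt c * s)\<^sup>2))"
    using c by (intro lborel_integrable_real_affine) auto
  then show ?thesis using c by (simp add: power_mult_distrib divide_inverse)
qed

text \<open>det Q_k dominates the N-th power of the product of the 1 + z_i^2. That product is at
  least 1 + c |lam|^2 by coercivity, hence at least 1 + c lam_j^2 for each j; used once per
  coordinate, this gives a majorant that is a product of integrable functions of one
  variable.\<close>

lemma integrable_dQ:
  fixes U :: "'m::finite \<Rightarrow> real^'q^'q"
  assumes U: "step_two U"
  shows "integrable lborel (dQ U k)"
proof -
  \<comment> \<open>The square root in \<open>dQ\<close> halves the exponent, which leaves one
    factor for each of the m coordinates of lam.\<close>
  define N where "N = 2 * CARD('m)"
  obtain c0 where c0: "0 < c0" "\<And>z. c0 * (1 + z\<^sup>2) ^ N \<le> Q_fun k z" by (rule Q_fun_growth[where N=N and k=k]) blast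
  obtain c where c: "0 < c" "\<And>lam. c * (norm lam)\<^sup>2 \<le> (\<Sum>a\<in>UNIV. \<Sum>b\<in>UNIV. (W_mat U lam $ a $ b)\<^sup>2)"
    by (rule W_mat_coercive[OF U]) blast
  define K where "K = sqrt (c0 ^ CARD('q))"
  have K: "0 < K" using c0 by (simp add: K_def)
  have bound: "dQ U k lam \<le> (1 / K) * (\<Prod>j\<in>UNIV. 1 / (1 + c * (lam $ j)\<^sup>2))" for lam
  proof -
    obtain e z where fr: "frame (W_mat U lam) e z" by (rule frame_W_mat[OF U])
    have "1 + (\<Sum>j\<in>UNIV. c * (lam $ j)\<^sup>2) = 1 + c * (norm lam)\<^sup>2"
      unfolding power2_norm_eq_inner inner_vec_def by (simp add: sum_distrib_left power2_eq_square)
    also have "\<dots> \<le> 1 + (\<Sum>i\<in>UNIV. (z i)\<^sup>2)" using c(2)[of lam] frame_trace[OF fr] by simp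
    also have "\<dots> \<le> (\<Prod>i\<in>UNIV. 1 + (z i)\<^sup>2)" by (rule one_plus_sum_le_prod) auto
    finally have 1: "1 + (\<Sum>j\<in>UNIV. c * (lam $ j)\<^sup>2) \<le> (\<Prod>i\<in>UNIV. 1 + (z i)\<^sup>2)" .
    have s0: "0 \<le> (\<Sum>j\<in>UNIV. c * (lam $ j)\<^sup>2)" using c by (intro sum_nonneg) auto
    have "(\<Prod>j\<in>UNIV. 1 + c * (lam $ j)\<^sup>2) \<le> (\<Prod>j\<in>(UNIV::'m set). 1 + (\<Sum>j\<in>UNIV. c * (lam $ j)\<^sup>2))"
    proof (rule prod_mono)
      fix j :: 'm
      have "c * (lam $ j)\<^sup>2 \<le> (\<Sum>j\<in>UNIV. c * (lam $ j)\<^sup>2)"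
        using c by (intro member_le_sum) auto
      then show "0 \<le> 1 + c * (lam $ j)\<^sup>2 \<and> 1 + c * (lam $ j)\<^sup>2 \<le> 1 + (\<Sum>j\<in>UNIV. c * (lam $ j)\<^sup>2)"
        using c by simp
    qed
    also have "\<dots> \<le> (\<Prod>i\<in>UNIV. 1 + (z i)\<^sup>2) ^ CARD('m)"
      using 1 s0 by (simp add: power_mono)
    finally have 2: "(\<Prod>j\<in>UNIV. 1 + c * (lam $ j)\<^sup>2) \<le> (\<Prod>i\<in>UNIV. 1 + (z i)\<^sup>2) ^ CARD('m)" .
    have pos: "0 < (\<Prod>j\<in>UNIV. 1 + c * (lam $ j)\<^sup>2)" using c by (intro prod_pos) (auto intro: add_pos_nonneg)
    have "c0 ^ CARD('q) * ((\<Prod>i\<in>UNIV. 1 + (z i)\<^sup>2) ^ CARD('m))\<^sup>2 = (\<Prod>i\<in>UNIV. c0 * (1 + (z i)\<^sup>2) ^ N)"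
      by (simp add: prod.distrib prod_power_distrib N_def power_mult[symmetric] mult.commute)
    also have "\<dots> \<le> (\<Prod>i\<in>UNIV. Q_fun k (z i))" using c0 by (intro prod_mono) auto
    finally have "sqrt (c0 ^ CARD('q) * ((\<Prod>i\<in>UNIV. 1 + (z i)\<^sup>2) ^ CARD('m))\<^sup>2) \<le> sqrt (\<Prod>i\<in>UNIV. Q_fun k (z i))"
      by simp
    moreover have "0 \<le> (\<Prod>i\<in>UNIV. 1 + (z i)\<^sup>2) ^ CARD('m)" by (intro zero_le_power prod_nonneg) auto
    ultimately have "K * (\<Prod>i\<in>UNIV. 1 + (z i)\<^sup>2) ^ CARD('m) \<le> sqrt (\<Prod>i\<in>UNIV. Q_fun k (z i))"
      by (simp add: K_def real_sqrt_mult)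
    then have "K * (\<Prod>j\<in>UNIV. 1 + c * (lam $ j)\<^sup>2) \<le> sqrt (\<Prod>i\<in>UNIV. Q_fun k (z i))"
      using order_trans[OF mult_left_mono[OF 2, of K]] K by simp
    then have "1 / sqrt (\<Prod>i\<in>UNIV. Q_fun k (z i)) \<le> 1 / (K * (\<Prod>j\<in>UNIV. 1 + c * (lam $ j)\<^sup>2))"
      using K pos by (intro divide_left_mono mult_pos_pos) (auto simp: prod_Q_pos)
    then show ?thesis by (simp add: dQ_frame[OF fr] prod_dividef)
  qed
  show ?thesis
  proof (rule Bochner_Integration.integrable_bound)
    show "integrable lborel (\<lambda>lam::real^'m. (1 / K) * (\<Prod>j\<in>UNIV. 1 / (1 + c * (lam $ j)\<^sup>2)))"
      using integral_lborel_vec_prod(1)[OF integrable_inverse_square[OF c(1)], where 'n='m]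
      by (intro integrable_mult_right) simp
    show "dQ U k \<in> borel_measurable lborel" using measurable_dQ[OF U] by simp
    show "AE lam in lborel. norm (dQ U k lam) \<le> norm ((1 / K) * (\<Prod>j\<in>UNIV. 1 / (1 + c * (lam $ j)\<^sup>2)))"
    proof (intro AE_I2)
      fix lam :: "real^'m"
      have "0 \<le> (1 / K) * (\<Prod>j\<in>UNIV. 1 / (1 + c * (lam $ j)\<^sup>2))"
        using K c by (intro mult_nonneg_nonneg prod_nonneg) auto
      then show "norm (dQ U k lam) \<le> norm ((1 / K) * (\<Prod>j\<in>UNIV. 1 / (1 + c * (lam $ j)\<^sup>2)))"
        using bound[of lam] dQ_pos[OF U, of k lam] unfolding real_norm_def by linarith
    qed
  qed
qed

lemma integrable_prod_mult:
  fixes f :: "'a::euclidean_space \<Rightarrow> real" and g :: "'b::euclidean_space \<Rightarrow> real"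
  assumes f: "integrable lborel f" and g: "integrable lborel g"
  shows "integrable (lborel \<Otimes>\<^sub>M lborel) (\<lambda>p. f (fst p) * g (snd p))"
proof (rule lborel_pair.Fubini_integrable)
  have [measurable]: "f \<in> borel_measurable borel" "g \<in> borel_measurable borel"
    using f g by (simp_all add: borel_measurable_integrable[simplified])
  show "(\<lambda>p. f (fst p) * g (snd p)) \<in> borel_measurable (lborel \<Otimes>\<^sub>M lborel)" by measurable
  show "integrable lborel (\<lambda>x. \<integral>y. norm (f (fst (x, y)) * g (snd (x, y))) \<partial>lborel)"
    using f by (simp add: abs_mult)
  show "AE x in lborel. integrable lborel (\<lambda>y. f (fst (x, y)) * g (snd (x, y)))"
    using g by simp
qed

lemma P_ker_bound:
  fixes U :: "'m::finite \<Rightarrow> real^'q^'q"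
  assumes U: "step_two U" and h: "0 < h"
  obtains B where "0 \<le> B" "\<And>g. norm (P_ker U k h g) \<le> B"
proof
  define H where "H = h powr (- (real (k + 1) * real CARD('q) / 2) - real CARD('m))"
  show "0 \<le> H * integral\<^sup>L lborel (dQ U k)"
    unfolding H_def
    by (intro mult_nonneg_nonneg Bochner_Integration.integral_nonneg less_imp_le[OF dQ_pos[OF U]]) simp
  show "norm (P_ker U k h g) \<le> H * integral\<^sup>L lborel (dQ U k)" for g
  proof -
    obtain X T where g: "g = (X, T)" by (cases g)
    have "norm (LINT lam|lborel. of_real (dQ U k lam * exp (- qR U k lam X / (2 * h))) * iexp (T \<bullet> lam / h)) \<le> integral\<^sup>L lborel (dQ U k)"
    proof (rule order_trans[OF integral_norm_bound integral_mono'])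
      show "integrable lborel (dQ U k)" by (rule integrable_dQ[OF U])
      show "0 \<le> dQ U k lam" for lam by (rule less_imp_le[OF dQ_pos[OF U]])
      fix lam
      have "exp (- qR U k lam X / (2 * h)) \<le> 1" using qR_nonneg[OF U, of k lam X] h by simp
      then show "norm (of_real (dQ U k lam * exp (- qR U k lam X / (2 * h))) * iexp (T \<bullet> lam / h)) \<le> dQ U k lam"
        using dQ_pos[OF U, of k lam] by (simp add: norm_mult mult_left_le)
    qed
    then show ?thesis unfolding g P_ker_eq[OF U] norm_mult H_def by (simp add: mult_left_mono)
  qed
qed

lemma measurable_P_ker:
  fixes U :: "'m::finite \<Rightarrow> real^'q^'q"
  assumes U: "step_two U"
  shows "P_ker U k h \<in> borel_measurable borel"
proof -
  note [measurable] = measurable_dQ[OF U]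
  have q [measurable]: "(\<lambda>p. qR U k (snd p) (fst (fst p))) \<in> borel_measurable ((borel :: ((real^'q) \<times> (real^'m)) measure) \<Otimes>\<^sub>M borel)"
  proof -
    have "(\<lambda>p. (snd p, fst (fst p))) \<in> measurable ((borel :: ((real^'q) \<times> (real^'m)) measure) \<Otimes>\<^sub>M (borel :: (real^'m) measure)) (borel \<Otimes>\<^sub>M borel)"
      by (intro measurable_Pair measurable_snd measurable_compose[OF measurable_fst])
        (simp add: borel_measurable_continuous_onI continuous_on_fst)
    from measurable_compose[OF this measurable_qR[OF U, of k]] show ?thesis by simp
  qed
  have [measurable]: "(\<lambda>p. snd (fst p) \<bullet> snd p) \<in> borel_measurable ((borel :: ((real^'q) \<times> (real^'m)) measure) \<Otimes>\<^sub>M borel)"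
    unfolding borel_prod by (intro borel_measurable_continuous_onI continuous_intros) 
  have "(\<lambda>g. LINT lam|lborel. of_real (dQ U k lam * exp (- qR U k lam (fst g) / (2 * h))) * iexp (snd g \<bullet> lam / h)) \<in> borel_measurable borel"
  proof (rule lborel.borel_measurable_lebesgue_integral)
    have "(\<lambda>p. complex_of_real (dQ U k (snd p) * exp (- qR U k (snd p) (fst (fst p)) / (2 * h))) * iexp (snd (fst p) \<bullet> snd p / h))
        \<in> borel_measurable ((borel :: ((real^'q) \<times> (real^'m)) measure) \<Otimes>\<^sub>M borel)"
      by measurable
    then show "(\<lambda>(g, lam). complex_of_real (dQ U k lam * exp (- qR U k lam (fst g) / (2 * h))) * iexp (snd g \<bullet> lam / h))
        \<in> borel_measurable ((borel :: ((real^'q) \<times> (real^'m)) measure) \<Otimes>\<^sub>M lborel)"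
      by (simp add: case_prod_beta)
  qed
  moreover have "P_ker U k h = (\<lambda>g. of_real (h powr (- (real (k + 1) * real CARD('q) / 2) - real CARD('m))) *
    (LINT lam|lborel. of_real (dQ U k lam * exp (- qR U k lam (fst g) / (2 * h))) * iexp (snd g \<bullet> lam / h)))"
    using P_ker_eq[OF U] by (auto simp: fun_eq_iff)
  ultimately show ?thesis by simp
qed

section \<open>One step of the recursion in k\<close>

lemma gaussian_norm:
  fixes \<alpha> :: real
  assumes a: "0 < \<alpha>"
  shows "has_bochner_integral lborel (\<lambda>x::'a::euclidean_space. exp (- \<alpha> * (norm x)\<^sup>2)) (sqrt (pi / \<alpha>) ^ DIM('a))"
proof -
  have h: "has_bochner_integral lborel (\<lambda>s::real. exp (- \<alpha> * s\<^sup>2)) (sqrt (pi / \<alpha>))"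
    using has_bochner_integral_bounded_linear[OF bounded_linear_Re gaussian_fourier_1[of "2 * \<alpha>" 0]] a by simp
  have e: "exp (- \<alpha> * (norm x)\<^sup>2) = (\<Prod>b\<in>Basis. exp (- \<alpha> * (x \<bullet> b)\<^sup>2))" for x :: 'a
    unfolding power2_norm_eq_inner by (subst euclidean_inner) (simp add: exp_sum[symmetric] sum_distrib_left power2_eq_square sum_negf)
  show ?thesis
    unfolding e
    using integral_lborel_prod[where 'a='a, of "\<lambda>_ s. exp (- \<alpha> * s\<^sup>2)"] h
    by (simp add: has_bochner_integral_iff)
qed

lemma sqrt_power_powr: "0 < y \<Longrightarrow> sqrt y ^ n = y powr (real n / 2)"
proof -
  assume y: "0 < y"
  then have "sqrt y ^ n = (y powr (1/2)) powr real n"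
    by (subst powr_realpow) (auto simp: powr_half_sqrt)
  then show ?thesis by (simp only: powr_powr) simp
qed

lemma sqrt_prod: "sqrt (\<Prod>i\<in>A. f i) = (\<Prod>i\<in>A. sqrt (f i))"
  by (induction A rule: infinite_finite_induct) (simp_all add: real_sqrt_mult)

text \<open>The shift of T by the bracket of X and s is the last summand of \<open>F_map\<close>, so
  integrating out s passes from k + 1 to k with the other variables frozen in X and T. Fubini rests
  on the majorant Gaussian times \<open>dQ\<close>.\<close>

lemma P_ker_step:
  fixes U :: "'m::finite \<Rightarrow> real^'q^'q"
  assumes U: "step_two U" and h: "0 < h"
  shows "(LINT s|lborel. of_real (exp (- ((2 * real k + 3) / (2 * h) * (norm s)\<^sup>2))) * P_ker U (Suc k) h (s, T + bracket U X s))
    = of_real ((2 * pi) powr (real CARD('q) / 2)) * P_ker U k h (X, T)"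
proof -
  let ?G = "\<lambda>s::real^'q. exp (- ((2 * real k + 3) / (2 * h) * (norm s)\<^sup>2))"
  let ?H = "\<lambda>k. h powr (- (real (k + 1) * real CARD('q) / 2) - real CARD('m))"
  define F where "F s lam = complex_of_real (?G s * (dQ U (Suc k) lam * exp (- qR U (Suc k) lam s / (2 * h)))) * iexp ((T + bracket U X s) \<bullet> lam / h)" for s lam
  have Gi: "integrable lborel ?G"
    using gaussian_norm[of "(2 * real k + 3) / (2 * h)", where 'a="real^'q"] h
    by (simp add: has_bochner_integral_iff)
  have cb: "continuous_on UNIV (\<lambda>s. bracket U X s)"
    unfolding bracket_def by (intro continuous_intros)
  have int: "integrable (lborel \<Otimes>\<^sub>M lborel) (\<lambda>(s, lam). F s lam)"
  proof (rule Bochner_Integration.integrable_bound)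
    show "integrable (lborel \<Otimes>\<^sub>M lborel) (\<lambda>p. ?G (fst p) * dQ U (Suc k) (snd p))"
      by (rule integrable_prod_mult[OF Gi integrable_dQ[OF U]])
    note [measurable] = measurable_dQ[OF U]
    have [measurable]: "(\<lambda>p. qR U (Suc k) (snd p) (fst p)) \<in> borel_measurable (borel \<Otimes>\<^sub>M borel)"
      using measurable_compose[OF measurable_Pair[OF measurable_snd measurable_fst] measurable_qR[OF U, of "Suc k"]] by simp
    have [measurable]: "(\<lambda>p. (T + bracket U X (fst p)) \<bullet> snd p / h) \<in> borel_measurable ((borel :: (real^'q) measure) \<Otimes>\<^sub>M borel)"
      unfolding borel_prod
      by (intro borel_measurable_continuous_onI continuous_intros continuous_on_compose2[OF cb]) (use h in auto)
    show "(\<lambda>(s, lam). F s lam) \<in> borel_measurable (lborel \<Otimes>\<^sub>M lborel)"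
      unfolding F_def case_prod_beta by measurable
    show "AE p in lborel \<Otimes>\<^sub>M lborel. norm (case p of (s, lam) \<Rightarrow> F s lam) \<le> norm (?G (fst p) * dQ U (Suc k) (snd p))"
    proof (intro AE_I2, clarify)
      fix s lam
      have "exp (- qR U (Suc k) lam s / (2 * h)) \<le> 1" using qR_nonneg[OF U, of "Suc k" lam s] h by simp
      then have "dQ U (Suc k) lam * exp (- qR U (Suc k) lam s / (2 * h)) \<le> dQ U (Suc k) lam"
        using dQ_pos[OF U, of "Suc k" lam] by (simp add: mult_left_le)
      then show "norm (F s lam) \<le> norm (?G (fst (s, lam)) * dQ U (Suc k) (snd (s, lam)))"
        using dQ_pos[OF U, of "Suc k" lam] by (simp add: F_def norm_mult abs_mult)
    qed
  qed
  have inner: "(LINT s|lborel. F s lam) = of_real (sqrt (2 * pi * h) ^ CARD('q)) *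
      (of_real (dQ U k lam * exp (- qR U k lam X / (2 * h))) * iexp (T \<bullet> lam / h))" for lam
  proof -
    obtain e z where fr: "frame (W_mat U lam) e z" by (rule frame_W_mat[OF U])
    define r where "r i = Q_fun k (z i) / Q_fun (Suc k) (z i)" for i
    have r0: "0 < r i" for i by (simp add: r_def Q_fun_pos)
    have r: "2 * real k + 3 + R_fun (Suc k) (z i) = r i" for i
      unfolding r_def R_fun_def Q_fun_recurrence[of k "z i"] using Q_fun_pos[of "Suc k" "z i"]
      by (simp add: add_divide_distrib)
    \<comment> \<open>Frame coefficients of the linear phase in s that \<open>bracket_inner\<close>
      produces from the bracket.\<close>
    define b where "b i = (e i \<bullet> (W_mat U lam *v X)) / h" for i
    have n: "(norm s)\<^sup>2 = (\<Sum>i\<in>UNIV. (e i \<bullet> s)\<^sup>2)" for s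
      unfolding power2_norm_eq_inner by (subst frame_inner[OF fr]) (simp add: power2_eq_square)
    have F: "F s lam = of_real (dQ U (Suc k) lam) * iexp (T \<bullet> lam / h) *
       (complex_of_real (exp (- (\<Sum>i\<in>UNIV. r i / h * (e i \<bullet> s)\<^sup>2) / 2)) * iexp (\<Sum>i\<in>UNIV. b i * (e i \<bullet> s)))" for s
    proof -
      have "(\<Sum>i\<in>UNIV. r i / h * (e i \<bullet> s)\<^sup>2) = ((2 * real k + 3) * (norm s)\<^sup>2 + qR U (Suc k) lam s) / h"
        unfolding qR_frame[OF fr] n r[symmetric]
        by (simp add: sum_distrib_left sum.distrib[symmetric] sum_divide_distrib algebra_simps)
      then have A: "?G s * exp (- qR U (Suc k) lam s / (2 * h)) = exp (- (\<Sum>i\<in>UNIV. r i / h * (e i \<bullet> s)\<^sup>2) / 2)"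
        using h by (simp add: exp_add[symmetric] field_simps)
      have B: "(T + bracket U X s) \<bullet> lam / h = T \<bullet> lam / h + (\<Sum>i\<in>UNIV. b i * (e i \<bullet> s))"
        unfolding inner_add_left bracket_inner frame_inner[OF fr, of "W_mat U lam *v X"] b_def
        by (simp add: add_divide_distrib sum_divide_distrib)
      have I: "iexp (u + v) = iexp u * iexp v" for u v :: real by (simp add: ring_distribs exp_add)
      have e: "?G s * (dQ U (Suc k) lam * exp (- qR U (Suc k) lam s / (2 * h)))
            = dQ U (Suc k) lam * exp (- (\<Sum>i\<in>UNIV. r i / h * (e i \<bullet> s)\<^sup>2) / 2)"
          "iexp ((T + bracket U X s) \<bullet> lam / h) = iexp (T \<bullet> lam / h) * iexp (\<Sum>i\<in>UNIV. b i * (e i \<bullet> s))"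
        unfolding B by (simp only: mult.left_commute[of "?G s"] A) (rule I)
      show ?thesis unfolding F_def e by (simp only: of_real_mult mult_ac)
    qed
    have "(LINT s|lborel. F s lam) = of_real (dQ U (Suc k) lam) * iexp (T \<bullet> lam / h) *
       (complex_of_real ((\<Prod>i\<in>UNIV. sqrt (2 * pi / (r i / h))) * exp (- (\<Sum>i\<in>UNIV. (b i)\<^sup>2 / (r i / h)) / 2)))"
      unfolding F
      using gaussian_fourier_frame[of "\<lambda>i. r i / h" e b] frame_orthonormal[OF fr] r0 h
      by (simp add: has_bochner_integral_iff)
    \<comment> \<open>The quotient Q_(k+1) / Q_k evaluated on W X is moved to X by
      \<open>frame_quad_W\<close>; the z^2 this contributes makes it R_k.\<close>
    also have "(\<Sum>i\<in>UNIV. (b i)\<^sup>2 / (r i / h)) = qR U k lam X / h"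
    proof -
      have "(\<Sum>i\<in>UNIV. (b i)\<^sup>2 / (r i / h)) = (\<Sum>i\<in>UNIV. Q_fun (Suc k) (z i) / Q_fun k (z i) * (e i \<bullet> (W_mat U lam *v X))\<^sup>2) / h"
        unfolding sum_divide_distrib using h by (intro sum.cong refl) (simp add: b_def r_def power_divide power2_eq_square mult_ac)
      also have "\<dots> = qR U k lam X / h"
        unfolding frame_quad_W[OF fr, of "\<lambda>\<zeta>. Q_fun (Suc k) \<zeta> / Q_fun k \<zeta>"] qR_frame[OF fr] by (simp add: R_fun_def)
      finally show ?thesis .
    qed
    also have "(\<Prod>i\<in>UNIV. sqrt (2 * pi / (r i / h))) = sqrt (2 * pi * h) ^ CARD('q) * (sqrt (\<Prod>i\<in>UNIV. Q_fun (Suc k) (z i)) / sqrt (\<Prod>i\<in>UNIV. Q_fun k (z i)))"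
    proof -
      have "2 * pi / (r i / h) = 2 * pi * h * (Q_fun (Suc k) (z i) / Q_fun k (z i))" for i by (simp add: r_def)
      then have "(\<Prod>i\<in>UNIV. sqrt (2 * pi / (r i / h))) = (\<Prod>i\<in>UNIV. sqrt (2 * pi * h) * (sqrt (Q_fun (Suc k) (z i)) / sqrt (Q_fun k (z i))))"
        by (simp only: real_sqrt_mult real_sqrt_divide)
      then show ?thesis by (simp add: prod.distrib prod_dividef sqrt_prod)
    qed
    finally have *: "(LINT s|lborel. F s lam) = of_real (dQ U (Suc k) lam) * iexp (T \<bullet> lam / h) *
       (complex_of_real (sqrt (2 * pi * h) ^ CARD('q) * (sqrt (\<Prod>i\<in>UNIV. Q_fun (Suc k) (z i)) / sqrt (\<Prod>i\<in>UNIV. Q_fun k (z i))) * exp (- (qR U k lam X / h) / 2)))" .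
    have "dQ U (Suc k) lam * (sqrt (2 * pi * h) ^ CARD('q) * (sqrt (\<Prod>i\<in>UNIV. Q_fun (Suc k) (z i)) / sqrt (\<Prod>i\<in>UNIV. Q_fun k (z i))) * exp (- (qR U k lam X / h) / 2))
       = sqrt (2 * pi * h) ^ CARD('q) * (dQ U k lam * exp (- qR U k lam X / (2 * h)))"
    proof -
      have "sqrt (\<Prod>i\<in>UNIV. Q_fun (Suc k) (z i)) \<noteq> 0"
        using real_sqrt_gt_zero[OF prod_Q_pos[of "Suc k" z UNIV]] by (rule less_imp_neq[symmetric])
      then show ?thesis by (simp add: dQ_frame[OF fr] mult.commute[of 2 h])
    qed
    then have A: "of_real (dQ U (Suc k) lam) * complex_of_real (sqrt (2 * pi * h) ^ CARD('q) * (sqrt (\<Prod>i\<in>UNIV. Q_fun (Suc k) (z i)) / sqrt (\<Prod>i\<in>UNIV. Q_fun k (z i))) * exp (- (qR U k lam X / h) / 2))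
       = of_real (sqrt (2 * pi * h) ^ CARD('q) * (dQ U k lam * exp (- qR U k lam X / (2 * h))))"
      by (simp only: of_real_mult[symmetric])
    have comm: "d * E * Y = (d * Y) * E" for d E Y :: complex by simp
    show ?thesis by (subst *, subst comm, subst A) (simp only: of_real_mult mult_ac)
  qed
  have "(LINT s|lborel. of_real (?G s) * P_ker U (Suc k) h (s, T + bracket U X s)) = of_real (?H (Suc k)) * (LINT s|lborel. LINT lam|lborel. F s lam)"
  proof -
    have "of_real (?G s) * P_ker U (Suc k) h (s, T + bracket U X s) = of_real (?H (Suc k)) * (LINT lam|lborel. F s lam)" for s
    proof -
      have "(LINT lam|lborel. F s lam) = of_real (?G s) * (LINT lam|lborel. of_real (dQ U (Suc k) lam * exp (- qR U (Suc k) lam s / (2 * h))) * iexp ((T + bracket U X s) \<bullet> lam / h))"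
        unfolding F_def of_real_mult[of "?G s"] mult.assoc[of "of_real (?G s)"] by (rule integral_mult_right_zero)
      then show ?thesis unfolding P_ker_eq[OF U] by (simp only: mult_ac)
    qed
    then show ?thesis by simp
  qed
  also have "(LINT s|lborel. LINT lam|lborel. F s lam) = (LINT lam|lborel. LINT s|lborel. F s lam)"
    by (rule lborel_pair.Fubini_integral[OF int, symmetric])
  also have "\<dots> = of_real (sqrt (2 * pi * h) ^ CARD('q)) * (LINT lam|lborel. of_real (dQ U k lam * exp (- qR U k lam X / (2 * h))) * iexp (T \<bullet> lam / h))"
    unfolding inner by (rule integral_mult_right_zero)
  also have "of_real (?H (Suc k)) * \<dots> = of_real ((2 * pi) powr (real CARD('q) / 2)) * P_ker U k h (X, T)"
  proof -
    \<comment> \<open>The Gaussian integral returns h^(q/2), the quotient of the normalising powers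
      of h for k and k + 1; only (2 pi)^(q/2) is left over.\<close>
    have "sqrt (2 * pi * h) ^ CARD('q) = (2 * pi * h) powr (real CARD('q) / 2)"
      using h by (intro sqrt_power_powr) simp
    also have "\<dots> = (2 * pi) powr (real CARD('q) / 2) * h powr (real CARD('q) / 2)"
      by (rule powr_mult)
    finally have "?H (Suc k) * sqrt (2 * pi * h) ^ CARD('q) = (2 * pi) powr (real CARD('q) / 2) * (?H (Suc k) * h powr (real CARD('q) / 2))"
      by (simp only: mult_ac)
    also have "?H (Suc k) * h powr (real CARD('q) / 2) = ?H k"
      unfolding powr_add[symmetric] by (rule arg_cong[where f="(powr) h"]) (simp add: algebra_simps add_divide_distrib)
    finally have "?H (Suc k) * sqrt (2 * pi * h) ^ CARD('q) = (2 * pi) powr (real CARD('q) / 2) * ?H k" .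
    then have "complex_of_real (?H (Suc k)) * of_real (sqrt (2 * pi * h) ^ CARD('q)) = of_real ((2 * pi) powr (real CARD('q) / 2)) * of_real (?H k)"
      by (simp only: of_real_mult[symmetric])
    then show ?thesis unfolding P_ker_eq[OF U] mult.assoc[symmetric] by simp
  qed
  finally show ?thesis .
qed

section \<open>Gaveau's formula\<close>

lemma frame_scale:
  assumes "frame W e z" "0 \<le> c"
  shows "frame (c *\<^sub>R W) e (\<lambda>i. c * z i)"
proof -
  have t: "transpose (c *\<^sub>R W) = c *\<^sub>R transpose W" by (simp add: transpose_def vec_eq_iff)
  have s: "(c *\<^sub>R A) *v x = c *\<^sub>R (A *v x)" for A :: "real^'a^'a" and x
    by (simp add: vec_eq_iff matrix_vector_mult_def sum_distrib_left mult.assoc)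
  have fr: "transpose W = - W" "\<forall>i j. e i \<bullet> e j = (if i = j then 1 else 0)" "\<forall>i. 0 \<le> z i"
    "\<And>i. transpose W *v (W *v e i) = (z i)\<^sup>2 *\<^sub>R e i"
    using assms(1) unfolding frame_def by blast+
  have "transpose (c *\<^sub>R W) *v ((c *\<^sub>R W) *v e i) = (c * z i)\<^sup>2 *\<^sub>R e i" for i
    unfolding t s matrix_vector_mult_scaleR fr(4) by (simp add: power2_eq_square)
  moreover have "transpose (c *\<^sub>R W) = - (c *\<^sub>R W)" unfolding t fr(1) by simp
  ultimately show ?thesis unfolding frame_def using fr(2,3) assms(2) by auto
qed

lemma frame_uminus:
  assumes "frame W e z"
  shows "frame (- W) e z"
proof -
  have t: "transpose (- W) = - transpose W" by (simp add: transpose_def vec_eq_iff)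
  have s: "(- A) *v x = - (A *v x)" "A *v (- x) = - (A *v x)" for A :: "real^'a^'a" and x
    by (simp_all add: vec_eq_iff matrix_vector_mult_def sum_negf)
  have fr: "transpose W = - W" "\<forall>i j. e i \<bullet> e j = (if i = j then 1 else 0)" "\<forall>i. 0 \<le> z i"
    "\<And>i. transpose W *v (W *v e i) = (z i)\<^sup>2 *\<^sub>R e i"
    using assms(1) unfolding frame_def by blast+
  have "transpose (- W) *v ((- W) *v e i) = (z i)\<^sup>2 *\<^sub>R e i" for i
    unfolding t s fr(4) by simp
  moreover have "transpose (- W) = - (- W)" unfolding t fr(1) by simp
  ultimately show ?thesis unfolding frame_def using fr(2,3) by auto
qed

lemma W_mat_scaleR: "W_mat U (c *\<^sub>R lam) = c *\<^sub>R W_mat U lam"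
  by (simp add: W_mat_def scaleR_sum_right)

lemma dQ_qR_uminus:
  assumes "step_two U"
  shows "dQ U k (- lam) = dQ U k lam" "qR U k (- lam) X = qR U k lam X"
proof -
  obtain e z where fr: "frame (W_mat U lam) e z" by (rule frame_W_mat[OF assms])
  then have fr': "frame (W_mat U (- lam)) e z"
    using frame_uminus[OF fr] W_mat_scaleR[of U "- 1" lam] by simp
  show "dQ U k (- lam) = dQ U k lam" by (simp only: dQ_frame[OF fr] dQ_frame[OF fr'])
  show "qR U k (- lam) X = qR U k lam X" by (simp only: qR_frame[OF fr] qR_frame[OF fr'])
qed

lemma integral_lborel_uminus:
  fixes g :: "'a::euclidean_space \<Rightarrow> real"
  assumes [measurable]: "g \<in> borel_measurable borel"
  shows "(LINT x|lborel. g (- x)) = (LINT x|lborel. g x)"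
proof -
  have "orthogonal_transformation (uminus :: 'a \<Rightarrow> 'a)"
    by (simp add: orthogonal_transformation_def linear_iff)
  then have "(LINT x|lborel. g x) = (LINT x|distr lborel borel uminus. g x)"
    by (simp only: lborel_distr_orthogonal)
  then show ?thesis by (simp add: integral_distr)
qed

text \<open>The amplitude is even in lam and the sine is odd, so the imaginary part integrates to
  zero.\<close>

lemma P_ker_cos:
  fixes U :: "'m::finite \<Rightarrow> real^'q^'q"
  assumes U: "step_two U" and h: "0 < h"
  shows "P_ker U k h (X, T) = of_real (h powr (- (real (k + 1) * real CARD('q) / 2) - real CARD('m)) *
    (LINT lam|lborel. dQ U k lam * exp (- qR U k lam X / (2 * h)) * cos (T \<bullet> lam / h)))"
proof -
  let ?D = "\<lambda>lam. dQ U k lam * exp (- qR U k lam X / (2 * h))"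
  let ?f = "\<lambda>lam. complex_of_real (?D lam) * iexp (T \<bullet> lam / h)"
  note [measurable] = measurable_dQ[OF U]
  have [measurable]: "(\<lambda>lam. qR U k lam X) \<in> borel_measurable borel"
    using measurable_compose[OF measurable_Pair[OF measurable_ident measurable_const] measurable_qR[OF U, of k]] by simp
  have [measurable]: "(\<lambda>lam. T \<bullet> lam) \<in> borel_measurable borel" by measurable
  have int: "integrable lborel ?f"
  proof (rule Bochner_Integration.integrable_bound[OF integrable_dQ[OF U, of k]])
    show "?f \<in> borel_measurable lborel" by measurable
    show "AE lam in lborel. norm (?f lam) \<le> norm (dQ U k lam)"
    proof (intro AE_I2)
      fix lam
      have "exp (- qR U k lam X / (2 * h)) \<le> 1" using qR_nonneg[OF U, of k lam X] h by simp
      then show "norm (?f lam) \<le> norm (dQ U k lam)"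
        using dQ_pos[OF U, of k lam] by (simp add: norm_mult mult_left_le)
    qed
  qed
  have ri: "Re (complex_of_real u * iexp v) = u * cos v" "Im (complex_of_real u * iexp v) = u * sin v" for u v
    by (simp_all add: Re_exp Im_exp)
  have R: "Re (integral\<^sup>L lborel ?f) = (LINT lam|lborel. ?D lam * cos (T \<bullet> lam / h))"
    using integral_Re[OF int] unfolding ri by (rule sym)
  have "Im (integral\<^sup>L lborel ?f) = (LINT lam|lborel. ?D lam * sin (T \<bullet> lam / h))"
    using integral_Im[OF int] unfolding ri by (rule sym)
  also have "\<dots> = 0"
  proof -
    have "(LINT lam|lborel. ?D lam * sin (T \<bullet> lam / h)) = (LINT lam|lborel. ?D (- lam) * sin (T \<bullet> (- lam) / h))"
      by (rule integral_lborel_uminus[symmetric]) measurable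
    also have "\<dots> = - (LINT lam|lborel. ?D lam * sin (T \<bullet> lam / h))"
      by (simp add: dQ_qR_uminus[OF U])
    finally show ?thesis by simp
  qed
  finally have "integral\<^sup>L lborel ?f = of_real (LINT lam|lborel. ?D lam * cos (T \<bullet> lam / h))"
    using R by (simp add: complex_eq_iff)
  then show ?thesis unfolding P_ker_eq[OF U] by (simp only: of_real_mult)
qed

subsection \<open>Approximate identities\<close>

text \<open>Up to a constant, N^d exp (- c N) is \<open>flat d\<close> at 1 / (c N), which makes the
  decay a case of \<open>flat_le\<close>.\<close>

lemma exp_decay_times_power:
  assumes c: "0 < c"
  shows "(\<lambda>n. sqrt (real (Suc n)) ^ d * exp (- (c * real (Suc n)))) \<longlonglongrightarrow> 0"
proof (rule Lim_null_comparison)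
  show "\<forall>\<^sub>F n in sequentially. norm (sqrt (real (Suc n)) ^ d * exp (- (c * real (Suc n)))) \<le> (1 / c) ^ d * (fact (d + 1) * (1 / c)) * (1 / real (Suc n))"
  proof (intro always_eventually allI)
    fix n
    define N where "N = real (Suc n)"
    have N: "1 \<le> N" by (simp add: N_def)
    have "sqrt N \<le> N" using N by (simp add: real_le_lsqrt power2_eq_square mult_left_le)
    then have "sqrt N ^ d * exp (- (c * N)) \<le> N ^ d * exp (- (c * N))"
      using N by (intro mult_right_mono power_mono) auto
    also have "\<dots> = (1 / c) ^ d * flat d (1 / (c * N))"
      using c N by (simp add: flat_def power_mult_distrib power_divide)
    also have "\<dots> \<le> (1 / c) ^ d * (fact (d + 1) * (1 / (c * N)))"
      using flat_le[of d "1 / (c * N)" 1] c N by (intro mult_left_mono) auto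
    finally show "norm (sqrt (real (Suc n)) ^ d * exp (- (c * real (Suc n)))) \<le> (1 / c) ^ d * (fact (d + 1) * (1 / c)) * (1 / real (Suc n))"
      using N unfolding N_def[symmetric] by (simp add: abs_mult)
  qed
  have "(\<lambda>n. (1 / c) ^ d * (fact (d + 1) * (1 / c)) * (1 / real (Suc n))) \<longlonglongrightarrow> (1 / c) ^ d * (fact (d + 1) * (1 / c)) * 0"
    by (intro tendsto_intros LIMSEQ_Suc lim_1_over_n)
  then show "(\<lambda>n. (1 / c) ^ d * (fact (d + 1) * (1 / c)) * (1 / real (Suc n))) \<longlonglongrightarrow> 0" by simp
qed

text \<open>The prefactor compensates the width, so every Gaussian has the same mass (4 pi)^(dim/2).
  P may be unbounded; away from 0 the Gaussian is therefore bounded by a small constant and |P| is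
  integrated against it.\<close>

lemma gaussian_approx_identity:
  fixes P :: "'a::euclidean_space \<Rightarrow> real"
  assumes P: "continuous_on UNIV P" "integrable lborel P"
  shows "(\<lambda>n. LINT y|lborel. sqrt (real (Suc n)) ^ DIM('a) * exp (- (real (Suc n) / 4) * (norm y)\<^sup>2) * P y)
    \<longlonglongrightarrow> sqrt (4 * pi) ^ DIM('a) * P 0"
proof (rule LIMSEQ_I)
  fix r :: real assume r: "0 < r"
  define M where "M = sqrt (4 * pi) ^ DIM('a)"
  have M: "0 < M" by (simp add: M_def)
  define K where "K n y = sqrt (real (Suc n)) ^ DIM('a) * exp (- (real (Suc n) / 4) * (norm (y::'a))\<^sup>2)" for n y
  have K0: "0 \<le> K n y" for n y by (simp add: K_def)
  have KM: "has_bochner_integral lborel (K n) M" for n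
  proof -
    have "has_bochner_integral lborel (\<lambda>y::'a. sqrt (real (Suc n)) ^ DIM('a) * exp (- (real (Suc n) / 4) * (norm y)\<^sup>2))
        (sqrt (real (Suc n)) ^ DIM('a) * sqrt (pi / (real (Suc n) / 4)) ^ DIM('a))"
      by (intro has_bochner_integral_mult_right gaussian_norm) simp
    moreover have "sqrt (real (Suc n)) * sqrt (pi / (real (Suc n) / 4)) = sqrt (4 * pi)"
      by (subst real_sqrt_mult[symmetric]) (simp del: of_nat_Suc)
    ultimately show ?thesis unfolding K_def[abs_def] M_def by (simp only: power_mult_distrib[symmetric])
  qed
  then have Ki: "integrable lborel (K n)" and KI: "integral\<^sup>L lborel (K n) = M" for n
    by (auto simp: has_bochner_integral_iff)
  define \<eta> where "\<eta> = r / (4 * M)"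
  have \<eta>: "0 < \<eta>" using r M by (simp add: \<eta>_def)
  have "isCont P 0" using P(1) by (simp add: continuous_on_eq_continuous_at)
  then obtain \<delta> where \<delta>: "0 < \<delta>" "\<And>y. norm y < \<delta> \<Longrightarrow> \<bar>P y - P 0\<bar> < \<eta>"
    using \<eta> unfolding continuous_at_eps_delta by (auto simp: dist_norm)
  \<comment> \<open>For |y| \<ge> \<delta>, half of the exponent N |y|^2 / 4 yields the smallness
    \<open>m n\<close>; the other half keeps a fixed Gaussian, which makes the constant P 0
    integrable.\<close>
  define c where "c = \<delta>\<^sup>2 / 8"
  have c: "0 < c" using \<delta> by (simp add: c_def)
  define m where "m n = sqrt (real (Suc n)) ^ DIM('a) * exp (- (c * real (Suc n)))" for n
  have m0: "0 \<le> m n" for n by (simp add: m_def)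
  define B where "B y = \<bar>P y\<bar> + \<bar>P 0\<bar> * exp (- (1/8) * (norm y)\<^sup>2)" for y
  have Bi: "integrable lborel B"
    unfolding B_def[abs_def] using gaussian_norm[of "1/8", where 'a='a] P(2)
    by (intro Bochner_Integration.integrable_add integrable_mult_right integrable_abs) (auto simp: has_bochner_integral_iff)
  have pt: "\<bar>K n y * (P y - P 0)\<bar> \<le> \<eta> * K n y + m n * B y" for n y
  proof (cases "norm y < \<delta>")
    case True
    have "\<bar>K n y * (P y - P 0)\<bar> \<le> K n y * \<eta>"
      using \<delta>(2)[OF True] K0[of n y] by (simp add: abs_mult mult_left_mono)
    moreover have "0 \<le> m n * B y" using m0 by (simp add: B_def)
    ultimately show ?thesis by (simp add: mult.commute)
  next
    case False
    define N where "N = real (Suc n)"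
    have N: "1 \<le> N" by (simp add: N_def)
    have y: "\<delta>\<^sup>2 \<le> (norm y)\<^sup>2" using False \<delta> by (intro power_mono) auto
    have "N * \<delta>\<^sup>2 \<le> N * (norm y)\<^sup>2" using y N by (intro mult_left_mono) auto
    moreover have "1 * (norm y)\<^sup>2 \<le> N * (norm y)\<^sup>2" using N by (intro mult_right_mono) auto
    ultimately have "- (N / 4) * (norm y)\<^sup>2 \<le> - (c * N) + - (1/8) * (norm y)\<^sup>2"
      by (simp add: c_def algebra_simps)
    then have "exp (- (N / 4) * (norm y)\<^sup>2) \<le> exp (- (c * N) + - (1/8) * (norm y)\<^sup>2)" by (simp only: exp_le_cancel_iff)
    then have "K n y \<le> m n * exp (- (1/8) * (norm y)\<^sup>2)"
      unfolding K_def m_def N_def[symmetric] exp_add mult.assoc using N by (intro mult_left_mono) auto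
    moreover have "m n * exp (- (1/8) * (norm y)\<^sup>2) \<le> m n" using m0[of n] by (simp add: mult_left_le)
    ultimately have k: "K n y \<le> m n * exp (- (1/8) * (norm y)\<^sup>2)" "K n y \<le> m n" by auto
    have "\<bar>K n y * (P y - P 0)\<bar> \<le> K n y * (\<bar>P y\<bar> + \<bar>P 0\<bar>)"
      unfolding abs_mult using K0[of n y] abs_triangle_ineq4[of "P y" "P 0"] by (simp add: mult_left_mono)
    also have "\<dots> \<le> m n * \<bar>P y\<bar> + m n * exp (- (1/8) * (norm y)\<^sup>2) * \<bar>P 0\<bar>"
      unfolding distrib_left by (intro add_mono mult_right_mono k) auto
    also have "\<dots> = m n * B y" by (simp add: B_def algebra_simps)
    finally show ?thesis using mult_nonneg_nonneg[OF less_imp_le[OF \<eta>] K0[of n y]] by linarith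
  qed
  have "(\<lambda>n. m n * integral\<^sup>L lborel B) \<longlonglongrightarrow> 0 * integral\<^sup>L lborel B"
    unfolding m_def by (intro tendsto_intros exp_decay_times_power c)
  then obtain n0 where n0: "\<And>n. n0 \<le> n \<Longrightarrow> \<bar>m n * integral\<^sup>L lborel B\<bar> < r / 2"
    using LIMSEQ_D[of _ 0 "r / 2"] r by fastforce
  have "norm ((LINT y|lborel. K n y * P y) - M * P 0) < r" if n: "n0 \<le> n" for n
  proof -
    have [measurable]: "P \<in> borel_measurable borel" using P(1) by (rule borel_measurable_continuous_onI)
    have [measurable]: "K n \<in> borel_measurable borel" using Ki[of n, THEN borel_measurable_integrable] by simp
    have i1: "integrable lborel (\<lambda>y. \<eta> * K n y + m n * B y)"
      using Ki Bi by (intro Bochner_Integration.integrable_add integrable_mult_right) auto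
    have i2: "integrable lborel (\<lambda>y. K n y * (P y - P 0))"
    proof (rule Bochner_Integration.integrable_bound[OF i1])
      show "AE y in lborel. norm (K n y * (P y - P 0)) \<le> norm (\<eta> * K n y + m n * B y)"
      proof (intro AE_I2)
        fix y show "norm (K n y * (P y - P 0)) \<le> norm (\<eta> * K n y + m n * B y)"
          using pt[of n y] unfolding real_norm_def by linarith
      qed
    qed simp
    have i3: "integrable lborel (\<lambda>y. K n y * P 0)" using Ki by simp
    have "(LINT y|lborel. K n y * P y) = (LINT y|lborel. K n y * (P y - P 0) + K n y * P 0)"
      by (simp add: algebra_simps)
    also have "\<dots> = (LINT y|lborel. K n y * (P y - P 0)) + M * P 0"
      using i2 i3 KI[of n] by simp
    finally have "norm ((LINT y|lborel. K n y * P y) - M * P 0) = norm (LINT y|lborel. K n y * (P y - P 0))" by simp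
    also have "\<dots> \<le> (LINT y|lborel. \<eta> * K n y + m n * B y)"
      by (rule Bochner_Integration.integral_norm_bound_integral[OF i2 i1]) (use pt in \<open>simp only: real_norm_def\<close>)
    also have "\<dots> = \<eta> * M + m n * integral\<^sup>L lborel B" using Ki Bi KI by simp
    also have "\<dots> < r / 4 + r / 2" using n0[OF n] M r by (intro add_le_less_mono) (auto simp: \<eta>_def)
    finally show ?thesis using r by simp
  qed
  then show "\<exists>no. \<forall>n\<ge>no. norm ((LINT y|lborel. sqrt (real (Suc n)) ^ DIM('a) * exp (- (real (Suc n) / 4) * (norm y)\<^sup>2) * P y) - sqrt (4 * pi) ^ DIM('a) * P 0) < r"
    unfolding K_def M_def by blast
qed

subsection \<open>The case k = 0\<close>

lemma sinhc: "sqrt (pi / 2) * Q_fun 0 z = (if z = 0 then 1 else sinh z / z)"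
proof (cases "z = 0")
  case True
  have "(\<Sum>n. Q_coeff 0 n * 0 ^ n) = Q_coeff 0 0" by (rule powser_zero)
  then have "Q_fun 0 0 = sqrt (2 / pi)" by (simp add: Q_fun_powser Q_coeff_0)
  then show ?thesis using True by (simp add: real_sqrt_mult[symmetric])
next
  case False
  have "sqrt (pi / 2) * (z * Q_fun 0 z) = sinh z"
    unfolding Q_fun_0 by (simp add: mult.assoc[symmetric] real_sqrt_mult[symmetric])
  then show ?thesis using False by (simp add: field_simps)
qed

lemma cosh_R: "cosh z = sqrt (pi / 2) * Q_fun 0 z * (1 + R_fun 0 z)"
proof (cases "z = 0")
  case False
  have "sqrt (pi / 2) * (z ^ 3 * Q_fun 1 z) = z * cosh z - sinh z"
    unfolding Q_fun_1 by (simp add: mult.assoc[symmetric] real_sqrt_mult[symmetric])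
  then have "sqrt (pi / 2) * (z\<^sup>2 * Q_fun 1 z) = cosh z - sinh z / z"
    using False by (simp add: field_simps power2_eq_square power3_eq_cube)
  moreover have "Q_fun 0 z * R_fun 0 z = z\<^sup>2 * Q_fun 1 z" using Q_fun_pos[of 0 z] by (simp add: R_fun_def)
  moreover have "sqrt (pi / 2) * Q_fun 0 z * (1 + R_fun 0 z) = sqrt (pi / 2) * Q_fun 0 z + sqrt (pi / 2) * (Q_fun 0 z * R_fun 0 z)"
    by (simp only: distrib_left mult.assoc mult_1_right)
  ultimately show ?thesis
    using sinhc[of z] False by (simp only: if_False)
qed (simp add: sinhc R_fun_def)

text \<open>At time h the eigenvalue z / h gives the hyperbolic argument z, and for a -> 0 the
  quotient of the two values tends to (1 + R_0) / h.\<close>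

lemma mehler_scaled:
  assumes h: "0 < h"
  shows "mehler a (1 / h * z) h = a * cosh z + h * (sqrt (pi / 2) * Q_fun 0 z)"
    "mehler' a (1 / h * z) h = a * (z / h) * sinh z + sqrt (pi / 2) * Q_fun 0 z * (1 + R_fun 0 z)"
  using h by (simp add: mehler_def sinhc, unfold mehler'_def cosh_R[symmetric], simp)

lemma exp_mehler_c:
  fixes z :: "'q::finite \<Rightarrow> real"
  assumes "\<And>i. 0 < mehler a (z i) s"
  shows "exp (mehler_c a z s) = 1 / sqrt (\<Prod>i\<in>UNIV. mehler a (z i) s)"
proof -
  let ?y = "\<Prod>i\<in>UNIV. mehler a (z i) s"
  have y: "0 < ?y" using assms by (intro prod_pos) auto
  have "mehler_c a z s = - (1/2 * ln ?y)"
    unfolding mehler_c_def by (subst ln_prod) (auto simp: less_imp_neq[OF assms, symmetric])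
  also have "\<dots> = - ln (sqrt ?y)" using y by (simp add: ln_sqrt)
  finally show ?thesis using y by (simp add: exp_minus inverse_eq_divide)
qed

lemma gsol_initial:
  assumes fr: "frame W e z" and a: "0 < a"
  shows "gsol lam (e :: 'q::finite \<Rightarrow> real^'q) (\<lambda>i. mrate a (z i) 0) (mehler_c a z 0) g = (1 / sqrt a) ^ CARD('q) * exp (- (norm (fst g))\<^sup>2 / (4 * a)) * cos (lam \<bullet> snd g)"
proof -
  have m: "mehler a (z i) 0 = a" "mrate a (z i) 0 = 1 / a" for i
    by (simp_all add: mrate_def mehler_def mehler'_def)
  have n: "(norm (fst g))\<^sup>2 = (\<Sum>i\<in>UNIV. (e i \<bullet> fst g)\<^sup>2)"
    unfolding power2_norm_eq_inner by (subst frame_inner[OF fr]) (simp add: power2_eq_square)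
  have "exp (mehler_c a z 0) = (1 / sqrt a) ^ CARD('q)"
    using a by (subst exp_mehler_c) (simp_all add: m real_sqrt_power power_one_over)
  moreover have "1/4 * (\<Sum>i\<in>UNIV. 1 / a * (e i \<bullet> fst g)\<^sup>2) = (norm (fst g))\<^sup>2 / (4 * a)"
    unfolding n by (simp add: sum_divide_distrib[symmetric])
  ultimately show ?thesis unfolding gsol_def m exp_diff by (simp add: exp_minus field_simps)
qed

section \<open>Passage to a point mass at the group identity\<close>

context
  fixes U :: "'m::finite \<Rightarrow> real^'q^'q" and p :: "real \<Rightarrow> (real^'q) \<times> (real^'m) \<Rightarrow> real" and h :: real
    and x :: "real^'q" and t :: "real^'m"
  assumes U: "step_two U" and p: "heat_kernel U p" and h: "0 < h"
begin

definition kern :: "(real^'q) \<times> (real^'m) \<Rightarrow> real" where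
  "kern g' = p h (gmult U (ginv g') (x, t))"

text \<open>The kernel tested against the initial datum of the explicit solution with a = 1 / (n +
  1). The frequency lam / h is the one in the phase of \<open>P_ker\<close>.\<close>

definition slice :: "nat \<Rightarrow> real^'m \<Rightarrow> real" where
  "slice n lam = (LINT g'|lborel. sqrt (real (Suc n)) ^ CARD('q) * exp (- (real (Suc n) / 4) * (norm (fst g'))\<^sup>2) *
      cos (1 / h * (lam \<bullet> snd g')) * kern g')"

lemma slice_eq:
  assumes fr: "frame (W_mat U lam) e z"
  defines "a \<equiv> \<lambda>n. 1 / real (Suc n)" and "S \<equiv> \<lambda>i. sqrt (pi / 2) * Q_fun 0 (z i)"
  shows "slice n lam = cos (1 / h * (lam \<bullet> t)) * (1 / sqrt (\<Prod>i\<in>UNIV. a n * cosh (z i) + h * S i)) *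
     exp (- 1/4 * (\<Sum>i\<in>UNIV. (a n * (z i / h) * sinh (z i) + S i * (1 + R_fun 0 (z i))) / (a n * cosh (z i) + h * S i) * (e i \<bullet> x)\<^sup>2))"
proof -
  have an: "0 < a n" by (simp add: a_def)
  have fr': "frame (W_mat U ((1 / h) *\<^sub>R lam)) e (\<lambda>i. 1 / h * z i)"
    unfolding W_mat_scaleR using h by (intro frame_scale fr) auto
  have pos: "0 < mehler (a n) (1 / h * z i) h" for i
    using an h fr by (intro mehler_pos) (auto simp: frame_def)
  have 0: "gsol ((1 / h) *\<^sub>R lam) e (\<lambda>i. mrate (a n) (1 / h * z i) 0) (mehler_c (a n) (\<lambda>i. 1 / h * z i) 0) g'
     = sqrt (real (Suc n)) ^ CARD('q) * exp (- (real (Suc n) / 4) * (norm (fst g'))\<^sup>2) * cos (1 / h * (lam \<bullet> snd g'))" for g'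
  proof -
    have "1 / sqrt (a n) = sqrt (real (Suc n))" by (simp add: a_def real_sqrt_divide)
    moreover have "- (norm (fst g'))\<^sup>2 / (4 * a n) = - (real (Suc n) / 4) * (norm (fst g'))\<^sup>2"
      by (simp add: a_def)
    ultimately show ?thesis
      unfolding gsol_initial[OF fr' an] by (simp only: inner_scaleR_left)
  qed
  have "slice n lam = gsol ((1 / h) *\<^sub>R lam) e (\<lambda>i. mrate (a n) (1 / h * z i) h) (mehler_c (a n) (\<lambda>i. 1 / h * z i) h) (x, t)"
    unfolding slice_def kern_def 0[symmetric] by (rule kernel_gsol[OF U p h fr' an])
  also have "\<dots> = cos (1 / h * (lam \<bullet> t)) * (exp (mehler_c (a n) (\<lambda>i. 1 / h * z i) h) *
     exp (- 1/4 * (\<Sum>i\<in>UNIV. mrate (a n) (1 / h * z i) h * (e i \<bullet> x)\<^sup>2)))"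
    unfolding gsol_def by (simp add: exp_add[symmetric])
  also have "exp (mehler_c (a n) (\<lambda>i. 1 / h * z i) h) = 1 / sqrt (\<Prod>i\<in>UNIV. a n * cosh (z i) + h * S i)"
    unfolding exp_mehler_c[OF pos] mehler_scaled[OF h] S_def ..
  finally show ?thesis unfolding mrate_def mehler_scaled[OF h] S_def mult.assoc .
qed

text \<open>What remains of the exponential of \<open>mehler_c\<close> at a = 0 once the power of
  det Q_0 is split off.\<close>

definition \<Lambda> :: real where "\<Lambda> = 1 / sqrt ((h * sqrt (pi / 2)) ^ CARD('q))"

text \<open>The limit a -> 0. The 1 in 1 + R_0 yields the Gaussian in x, and 1 / sqrt 2 turns the 1
  / (4 h) in front of the form of R_0 into the 1 / (2 h) of \<open>P_ker\<close>.\<close>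

definition slice_lim :: "real^'m \<Rightarrow> real" where
  "slice_lim lam = \<Lambda> * exp (- (norm x)\<^sup>2 / (4 * h)) *
    (dQ U 0 lam * exp (- qR U 0 lam ((1 / sqrt 2) *\<^sub>R x) / (2 * h)) * cos (t \<bullet> lam / h))"

lemma prod_S:
  assumes fr: "frame (W_mat U lam) e z"
  shows "1 / sqrt (\<Prod>i\<in>UNIV. h * (sqrt (pi / 2) * Q_fun 0 (z i))) = \<Lambda> * dQ U 0 lam"
proof -
  have "(\<Prod>i\<in>UNIV. h * (sqrt (pi / 2) * Q_fun 0 (z i))) = (h * sqrt (pi / 2)) ^ CARD('q) * (\<Prod>i\<in>UNIV. Q_fun 0 (z i))"
    by (simp add: prod.distrib power_mult_distrib)
  then show ?thesis unfolding \<Lambda>_def dQ_frame[OF fr] by (simp add: real_sqrt_mult)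
qed

lemma slice_tendsto: "(\<lambda>n. slice n lam) \<longlonglongrightarrow> slice_lim lam"
proof -
  obtain e z where fr: "frame (W_mat U lam) e z" by (rule frame_W_mat[OF U])
  define S where "S i = sqrt (pi / 2) * Q_fun 0 (z i)" for i
  have S: "0 < S i" for i by (simp add: S_def Q_fun_pos)
  have n: "(norm x)\<^sup>2 = (\<Sum>i\<in>UNIV. (e i \<bullet> x)\<^sup>2)"
    unfolding power2_norm_eq_inner by (subst frame_inner[OF fr]) (simp add: power2_eq_square)
  have a: "(\<lambda>n. 1 / real (Suc n)) \<longlonglongrightarrow> 0" by (intro LIMSEQ_Suc lim_1_over_n)
  have pp: "0 < (\<Prod>i\<in>UNIV. h * S i)" using S h by (intro prod_pos) auto
  have "(\<lambda>n. slice n lam) \<longlonglongrightarrow> cos (1 / h * (lam \<bullet> t)) * (1 / sqrt (\<Prod>i\<in>UNIV. 0 * cosh (z i) + h * S i)) *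
     exp (- 1/4 * (\<Sum>i\<in>UNIV. (0 * (z i / h) * sinh (z i) + S i * (1 + R_fun 0 (z i))) / (0 * cosh (z i) + h * S i) * (e i \<bullet> x)\<^sup>2))"
    unfolding slice_eq[OF fr] S_def[symmetric]
    using S h pp by (intro tendsto_intros a) (auto simp: less_imp_neq[symmetric])
  moreover have "cos (1 / h * (lam \<bullet> t)) * (1 / sqrt (\<Prod>i\<in>UNIV. 0 * cosh (z i) + h * S i)) *
     exp (- 1/4 * (\<Sum>i\<in>UNIV. (0 * (z i / h) * sinh (z i) + S i * (1 + R_fun 0 (z i))) / (0 * cosh (z i) + h * S i) * (e i \<bullet> x)\<^sup>2)) = slice_lim lam"
  proof -
    have r: "(0 * (z i / h) * sinh (z i) + S i * (1 + R_fun 0 (z i))) / (0 * cosh (z i) + h * S i) = (1 + R_fun 0 (z i)) / h" for i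
      using S[of i] by simp
    have "- 1/4 * (\<Sum>i\<in>UNIV. (1 + R_fun 0 (z i)) / h * (e i \<bullet> x)\<^sup>2) = - (norm x)\<^sup>2 / (4 * h) + - qR U 0 lam ((1 / sqrt 2) *\<^sub>R x) / (2 * h)"
    proof -
      have "(\<Sum>i\<in>UNIV. (1 + R_fun 0 (z i)) / h * (e i \<bullet> x)\<^sup>2) = ((norm x)\<^sup>2 + (\<Sum>i\<in>UNIV. R_fun 0 (z i) * (e i \<bullet> x)\<^sup>2)) / h"
        unfolding n by (simp add: sum.distrib[symmetric] sum_divide_distrib algebra_simps)
      moreover have "qR U 0 lam ((1 / sqrt 2) *\<^sub>R x) = (\<Sum>i\<in>UNIV. R_fun 0 (z i) * (e i \<bullet> x)\<^sup>2) / 2"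
        unfolding qR_frame[OF fr] by (simp add: power_divide sum_divide_distrib)
      ultimately show ?thesis using h by (simp add: field_simps)
    qed
    moreover have "1 / sqrt (\<Prod>i\<in>UNIV. 0 * cosh (z i) + h * S i) = \<Lambda> * dQ U 0 lam"
      using prod_S[OF fr] by (simp add: S_def)
    ultimately show ?thesis
      unfolding r slice_lim_def by (simp only: exp_add) (simp add: inner_commute mult_ac)
  qed
  ultimately show ?thesis by simp
qed

text \<open>Dropping the positive a cosh terms only shrinks the denominator, and the Gaussian factor
  is at most 1. So one integrable function of lam dominates all slices.\<close>

lemma slice_bound: "\<bar>slice n lam\<bar> \<le> \<Lambda> * dQ U 0 lam"
proof -
  obtain e z where fr: "frame (W_mat U lam) e z" by (rule frame_W_mat[OF U])
  define S where "S i = sqrt (pi / 2) * Q_fun 0 (z i)" for i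
  have S: "0 < S i" for i by (simp add: S_def Q_fun_pos)
  have z: "0 \<le> z i" for i using fr by (simp add: frame_def)
  define a where "a = 1 / real (Suc n)"
  have a: "0 < a" by (simp add: a_def)
  have pp: "0 < (\<Prod>i\<in>UNIV. h * S i)" using S h by (intro prod_pos) auto
  have "(\<Prod>i\<in>UNIV. h * S i) \<le> (\<Prod>i\<in>UNIV. a * cosh (z i) + h * S i)"
    using S h a by (intro prod_mono) (auto intro!: mult_nonneg_nonneg simp: less_imp_le)
  then have 1: "1 / sqrt (\<Prod>i\<in>UNIV. a * cosh (z i) + h * S i) \<le> \<Lambda> * dQ U 0 lam"
    unfolding prod_S[OF fr, symmetric] S_def[symmetric] using pp by (intro divide_left_mono) auto
  have "0 \<le> (\<Sum>i\<in>UNIV. (a * (z i / h) * sinh (z i) + S i * (1 + R_fun 0 (z i))) / (a * cosh (z i) + h * S i) * (e i \<bullet> x)\<^sup>2)"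
    using a h S z R_fun_nonneg[of 0]
    by (intro sum_nonneg mult_nonneg_nonneg divide_nonneg_nonneg add_nonneg_nonneg) (auto simp: less_imp_le)
  then have 2: "exp (- 1/4 * (\<Sum>i\<in>UNIV. (a * (z i / h) * sinh (z i) + S i * (1 + R_fun 0 (z i))) / (a * cosh (z i) + h * S i) * (e i \<bullet> x)\<^sup>2)) \<le> 1"
    by simp
  have 3: "0 \<le> 1 / sqrt (\<Prod>i\<in>UNIV. a * cosh (z i) + h * S i)"
    using a h S by (intro divide_nonneg_nonneg real_sqrt_ge_zero prod_nonneg) (auto simp: less_imp_le)
  have "\<bar>slice n lam\<bar> = \<bar>cos (1 / h * (lam \<bullet> t))\<bar> * (1 / sqrt (\<Prod>i\<in>UNIV. a * cosh (z i) + h * S i)) *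
     exp (- 1/4 * (\<Sum>i\<in>UNIV. (a * (z i / h) * sinh (z i) + S i * (1 + R_fun 0 (z i))) / (a * cosh (z i) + h * S i) * (e i \<bullet> x)\<^sup>2))"
    unfolding slice_eq[OF fr] S_def[symmetric] a_def[symmetric] abs_mult using 3 by simp
  also have "\<dots> \<le> 1 * (\<Lambda> * dQ U 0 lam) * 1"
    using 1 2 3 order_trans[OF 3 1] by (intro mult_mono) auto
  finally show ?thesis by simp
qed

lemma kern_0: "kern 0 = p h (x, t)"
  by (simp add: kern_def gmult_def ginv_def bracket_def zero_vec_def[symmetric])

lemma kern_integrable: "integrable lborel kern" "continuous_on UNIV kern"
  unfolding kern_def[abs_def] by (rule integrable_kernel[OF U p h], rule continuous_kernel[OF U p h])

text \<open>Chosen so that its Fourier transform at t' / h is a multiple of exp (- (n + 1) |t'|^2 /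
  4), of the same width as the Gaussian in x of \<open>slice\<close>; together they form an
  isotropic Gaussian on the group. As n grows it tends to 1.\<close>

definition weight :: "nat \<Rightarrow> real^'m \<Rightarrow> real" where
  "weight n lam = exp (- (2 / (real (Suc n) * h\<^sup>2)) * (norm lam)\<^sup>2 / 2)"

lemma slice_measurable: "slice n \<in> borel_measurable borel"
proof -
  have [measurable]: "kern \<in> borel_measurable borel"
    using kern_integrable(2) by (rule borel_measurable_continuous_onI)
  have c [measurable]: "(\<lambda>q::(real^'m) \<times> (real^'q) \<times> (real^'m). sqrt (real (Suc n)) ^ CARD('q) * exp (- (real (Suc n) / 4) * (norm (fst (snd q)))\<^sup>2) *
      cos (1 / h * (fst q \<bullet> snd (snd q)))) \<in> borel_measurable (borel \<Otimes>\<^sub>M borel)"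
    unfolding borel_prod by (intro borel_measurable_continuous_onI continuous_intros)
  have "(\<lambda>q::(real^'m) \<times> (real^'q) \<times> (real^'m). (sqrt (real (Suc n)) ^ CARD('q) * exp (- (real (Suc n) / 4) * (norm (fst (snd q)))\<^sup>2) *
      cos (1 / h * (fst q \<bullet> snd (snd q)))) * kern (snd q)) \<in> borel_measurable (borel \<Otimes>\<^sub>M borel)"
    by (rule borel_measurable_times[OF c]) measurable
  then have "(\<lambda>(lam, g'). sqrt (real (Suc n)) ^ CARD('q) * exp (- (real (Suc n) / 4) * (norm (fst g'))\<^sup>2) *
      cos (1 / h * (lam \<bullet> snd g')) * kern g') \<in> borel_measurable (borel \<Otimes>\<^sub>M lborel)"
    by (simp add: case_prod_beta)
  from lborel.borel_measurable_lebesgue_integral[OF this] show ?thesis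
    unfolding slice_def[abs_def] .
qed

lemma weighted_slice_tendsto: "(\<lambda>n. LINT lam|lborel. weight n lam * slice n lam) \<longlonglongrightarrow> (LINT lam|lborel. slice_lim lam)"
proof (rule integral_dominated_convergence)
  note [measurable] = slice_measurable
  have w1: "0 \<le> weight n lam" "weight n lam \<le> 1" for n lam
    using h by (simp_all add: weight_def)
  show "integrable lborel (\<lambda>lam. \<Lambda> * dQ U 0 lam)" using integrable_dQ[OF U] by simp
  show "slice_lim \<in> borel_measurable lborel"
  proof -
    have "slice_lim \<in> borel_measurable borel"
      by (rule borel_measurable_LIMSEQ_real[OF slice_tendsto slice_measurable])
    then show ?thesis by simp
  qed
  show "(\<lambda>lam. weight n lam * slice n lam) \<in> borel_measurable lborel" for n
  proof -
    have [measurable]: "weight n \<in> borel_measurable borel"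
      unfolding weight_def[abs_def] by (intro borel_measurable_continuous_onI continuous_intros) auto
    show ?thesis by measurable
  qed
  show "AE lam in lborel. (\<lambda>n. weight n lam * slice n lam) \<longlonglongrightarrow> slice_lim lam"
  proof (intro AE_I2)
    fix lam :: "real^'m"
    have "(\<lambda>n. exp (- ((1 / real (Suc n)) * (1 / h\<^sup>2) * (norm lam)\<^sup>2))) \<longlonglongrightarrow> exp (- (0 * (1 / h\<^sup>2) * (norm lam)\<^sup>2))"
      by (intro tendsto_intros LIMSEQ_Suc lim_1_over_n)
    moreover have "weight n lam = exp (- ((1 / real (Suc n)) * (1 / h\<^sup>2) * (norm lam)\<^sup>2))" for n
      by (simp add: weight_def)
    ultimately have "(\<lambda>n. weight n lam) \<longlonglongrightarrow> 1" by simp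
    from tendsto_mult[OF this slice_tendsto[of lam]]
    show "(\<lambda>n. weight n lam * slice n lam) \<longlonglongrightarrow> slice_lim lam" by simp
  qed
  show "AE lam in lborel. norm (weight n lam * slice n lam) \<le> \<Lambda> * dQ U 0 lam" for n
  proof (intro AE_I2)
    fix lam :: "real^'m"
    have "\<bar>weight n lam\<bar> * \<bar>slice n lam\<bar> \<le> 1 * (\<Lambda> * dQ U 0 lam)"
      using w1[of n lam] slice_bound[of n lam] by (intro mult_mono) auto
    then show "norm (weight n lam * slice n lam) \<le> \<Lambda> * dQ U 0 lam" by (simp add: abs_mult)
  qed
qed

text \<open>Weight and kernel are integrable and the other factors bounded, so lam may be integrated
  first; this turns the cosines into the missing Gaussian in the central variable.\<close>

lemma weighted_slice:
  "(LINT lam|lborel. weight n lam * slice n lam) = (h * sqrt pi) ^ CARD('m) *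
    (LINT g'|lborel. sqrt (real (Suc n)) ^ DIM((real^'q) \<times> (real^'m)) * exp (- (real (Suc n) / 4) * (norm g')\<^sup>2) * kern g')"
proof -
  let ?N = "real (Suc n)"
  define A where "A g' = sqrt ?N ^ CARD('q) * exp (- (?N / 4) * (norm (fst g'))\<^sup>2)" for g' :: "(real^'q) \<times> (real^'m)"
  define F where "F lam g' = weight n lam * (A g' * cos (1 / h * (lam \<bullet> snd g')) * kern g')" for lam g'
  have A: "0 \<le> A g'" "A g' \<le> sqrt ?N ^ CARD('q)" for g' by (auto simp: A_def mult_left_le)
  have a: "0 < 2 / (?N * h\<^sup>2)" using h by simp
  have wi: "integrable lborel (weight n)"
    using gaussian_cos[OF a, of "0 :: real^'m"] unfolding weight_def[abs_def]
    by (simp add: has_bochner_integral_iff)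
  have [measurable]: "kern \<in> borel_measurable borel" "A \<in> borel_measurable borel" "weight n \<in> borel_measurable borel"
    using kern_integrable(2) wi[THEN borel_measurable_integrable] unfolding A_def[abs_def]
    by (auto intro!: borel_measurable_continuous_onI continuous_intros)
  have int: "integrable (lborel \<Otimes>\<^sub>M lborel) (\<lambda>(lam, g'). F lam g')"
  proof (rule Bochner_Integration.integrable_bound)
    show "integrable (lborel \<Otimes>\<^sub>M lborel) (\<lambda>q. weight n (fst q) * (sqrt ?N ^ CARD('q) * kern (snd q)))"
      by (rule integrable_prod_mult[OF wi]) (use kern_integrable in simp)
    have [measurable]: "(\<lambda>q::(real^'m) \<times> (real^'q) \<times> (real^'m). cos (1 / h * (fst q \<bullet> snd (snd q)))) \<in> borel_measurable (borel \<Otimes>\<^sub>M borel)"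
      unfolding borel_prod by (intro borel_measurable_continuous_onI continuous_intros)
    show "(\<lambda>(lam, g'). F lam g') \<in> borel_measurable (lborel \<Otimes>\<^sub>M lborel)"
      unfolding F_def case_prod_beta by measurable
    show "AE q in lborel \<Otimes>\<^sub>M lborel. norm (case q of (lam, g') \<Rightarrow> F lam g') \<le> norm (weight n (fst q) * (sqrt ?N ^ CARD('q) * kern (snd q)))"
    proof (intro AE_I2, unfold case_prod_beta F_def)
      fix q :: "(real^'m) \<times> (real^'q) \<times> (real^'m)"
      have "\<bar>A (snd q)\<bar> * \<bar>cos (1 / h * (fst q \<bullet> snd (snd q)))\<bar> \<le> sqrt ?N ^ CARD('q) * 1"
        using A[of "snd q"] by (intro mult_mono) auto
      then have "\<bar>weight n (fst q)\<bar> * (\<bar>A (snd q)\<bar> * \<bar>cos (1 / h * (fst q \<bullet> snd (snd q)))\<bar> * \<bar>kern (snd q)\<bar>) \<le> \<bar>weight n (fst q)\<bar> * (sqrt ?N ^ CARD('q) * 1 * \<bar>kern (snd q)\<bar>)"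
        by (intro mult_left_mono mult_right_mono) auto
      then show "norm (weight n (fst q) * (A (snd q) * cos (1 / h * (fst q \<bullet> snd (snd q))) * kern (snd q))) \<le> norm (weight n (fst q) * (sqrt ?N ^ CARD('q) * kern (snd q)))"
        by (simp add: abs_mult)
    qed
  qed
  have "(LINT lam|lborel. weight n lam * slice n lam) = (LINT lam|lborel. LINT g'|lborel. F lam g')"
    unfolding F_def slice_def A_def by simp
  also have "\<dots> = (LINT g'|lborel. LINT lam|lborel. F lam g')"
    by (rule lborel_pair.Fubini_integral[OF int, symmetric])
  also have "\<dots> = (LINT g'|lborel. (h * sqrt pi) ^ CARD('m) * (sqrt ?N ^ DIM((real^'q) \<times> (real^'m)) * exp (- (?N / 4) * (norm g')\<^sup>2) * kern g'))"
  proof (rule Bochner_Integration.integral_cong[OF refl])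
    fix g' :: "(real^'q) \<times> (real^'m)"
    have "(LINT lam|lborel. F lam g') = (LINT lam|lborel. (A g' * kern g') * (weight n lam * cos (((1 / h) *\<^sub>R snd g') \<bullet> lam)))"
      unfolding F_def by (simp add: inner_commute mult_ac)
    also have "\<dots> = A g' * kern g' * (LINT lam|lborel. weight n lam * cos (((1 / h) *\<^sub>R snd g') \<bullet> lam))"
      by (rule integral_mult_right_zero)
    also have "(LINT lam|lborel. weight n lam * cos (((1 / h) *\<^sub>R snd g') \<bullet> lam))
       = sqrt (2 * pi / (2 / (?N * h\<^sup>2))) ^ CARD('m) * exp (- (norm ((1 / h) *\<^sub>R snd g'))\<^sup>2 / (2 * (2 / (?N * h\<^sup>2))))"
      using gaussian_cos[OF a, of "(1 / h) *\<^sub>R snd g'"] unfolding weight_def by (simp only: has_bochner_integral_iff)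
    also have "sqrt (2 * pi / (2 / (?N * h\<^sup>2))) = (h * sqrt pi) * sqrt ?N"
    proof -
      have "2 * pi / (2 / (?N * h\<^sup>2)) = h\<^sup>2 * pi * ?N" by simp
      then show ?thesis using h by (simp only: real_sqrt_mult real_sqrt_abs abs_of_pos)
    qed
    also have "- (norm ((1 / h) *\<^sub>R snd g'))\<^sup>2 / (2 * (2 / (?N * h\<^sup>2))) = - (?N / 4) * (norm (snd g'))\<^sup>2"
      using h by (simp add: power_divide power_mult_distrib)
    also have "A g' * kern g' * (((h * sqrt pi) * sqrt ?N) ^ CARD('m) * exp (- (?N / 4) * (norm (snd g'))\<^sup>2))
      = (h * sqrt pi) ^ CARD('m) * (sqrt ?N ^ DIM((real^'q) \<times> (real^'m)) * exp (- (?N / 4) * (norm g')\<^sup>2) * kern g')"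
    proof -
      have "(norm g')\<^sup>2 = (norm (fst g'))\<^sup>2 + (norm (snd g'))\<^sup>2"
        by (simp add: norm_prod_def)
      then have "exp (- (?N / 4) * (norm g')\<^sup>2) = exp (- (?N / 4) * (norm (fst g'))\<^sup>2) * exp (- (?N / 4) * (norm (snd g'))\<^sup>2)"
        by (simp only: distrib_left exp_add)
      moreover have "sqrt ?N ^ DIM((real^'q) \<times> (real^'m)) = sqrt ?N ^ CARD('q) * sqrt ?N ^ CARD('m)"
        by (simp add: power_add)
      ultimately show ?thesis unfolding A_def by (simp only: power_mult_distrib mult_ac)
    qed
    finally show "(LINT lam|lborel. F lam g') = (h * sqrt pi) ^ CARD('m) * (sqrt ?N ^ DIM((real^'q) \<times> (real^'m)) * exp (- (?N / 4) * (norm g')\<^sup>2) * kern g')" .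
  qed
  also have "\<dots> = (h * sqrt pi) ^ CARD('m) *
    (LINT g'|lborel. sqrt ?N ^ DIM((real^'q) \<times> (real^'m)) * exp (- (?N / 4) * (norm g')\<^sup>2) * kern g')"
    by (rule integral_mult_right_zero)
  finally show ?thesis .
qed

text \<open>One sequence, two limits: dominated convergence over lam gives the right side, the
  approximate identity at the origin the left.\<close>

lemma heat_kernel_Gaveau:
  "(h * sqrt pi) ^ CARD('m) * (sqrt (4 * pi) ^ (CARD('q) + CARD('m)) * p h (x, t)) = (LINT lam|lborel. slice_lim lam)"
proof -
  have "(\<lambda>n. (h * sqrt pi) ^ CARD('m) * (LINT g'|lborel. sqrt (real (Suc n)) ^ DIM((real^'q) \<times> (real^'m)) * exp (- (real (Suc n) / 4) * (norm g')\<^sup>2) * kern g'))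
     \<longlonglongrightarrow> (h * sqrt pi) ^ CARD('m) * (sqrt (4 * pi) ^ DIM((real^'q) \<times> (real^'m)) * kern 0)"
    by (intro tendsto_intros gaussian_approx_identity kern_integrable)
  from LIMSEQ_unique[OF this weighted_slice_tendsto[unfolded weighted_slice]]
  show ?thesis by (simp add: kern_0)
qed

end

section \<open>The heat kernel through the kernels P\<close>

text \<open>The factors come from \<open>\<Lambda>\<close> without its power of h, from the
  normalisation of the weight, and from the mass of the approximate identity. The powers of h go
  into the prefactor of P.\<close>

definition gauss_const :: "nat \<Rightarrow> nat \<Rightarrow> real" where
  "gauss_const q m = 1 / (sqrt (sqrt (pi / 2) ^ q) * (sqrt pi ^ m * sqrt (4 * pi) ^ (q + m)))"

lemma gauss_const_pos: "0 < gauss_const q m"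
  by (simp add: gauss_const_def)

lemma heat_kernel_P_ker_0:
  fixes U :: "'m::finite \<Rightarrow> real^'q^'q"
  assumes U: "step_two U" and p: "heat_kernel U p" and h: "0 < h"
  shows "complex_of_real (p h (x, t)) =
    of_real (gauss_const CARD('q) CARD('m) * exp (- (norm x)\<^sup>2 / (4 * h))) * P_ker U 0 h ((1 / sqrt 2) *\<^sub>R x, t)"
proof -
  let ?q = "CARD('q)" and ?m = "CARD('m)"
  define I where "I = (LINT lam|lborel. dQ U 0 lam * exp (- qR U 0 lam ((1 / sqrt 2) *\<^sub>R x) / (2 * h)) * cos (t \<bullet> lam / h))"
  define E where "E = exp (- (norm x)\<^sup>2 / (4 * h))"
  define c where "c = sqrt pi ^ ?m * sqrt (4 * pi) ^ (?q + ?m)"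
  have c: "c \<noteq> 0" by (simp add: c_def)
  have "(LINT lam|lborel. slice_lim U h x t lam) = 1 / sqrt ((h * sqrt (pi / 2)) ^ ?q) * E * I"
    unfolding slice_lim_def[OF U p h] \<Lambda>_def[OF U p h] I_def E_def by (rule integral_mult_right_zero)
  then have G: "(h * sqrt pi) ^ ?m * (sqrt (4 * pi) ^ (?q + ?m) * p h (x, t)) = 1 / sqrt ((h * sqrt (pi / 2)) ^ ?q) * E * I"
    using heat_kernel_Gaveau[OF U p h, of x t] by simp
  have sq: "sqrt ((h * sqrt (pi / 2)) ^ ?q) = h powr (real ?q / 2) * sqrt (sqrt (pi / 2) ^ ?q)"
    using h sqrt_power_powr[OF h, of ?q] by (simp add: power_mult_distrib real_sqrt_mult real_sqrt_power)
  have hp: "h powr (- (real (0 + 1) * real ?q / 2) - real ?m) = 1 / (h powr (real ?q / 2) * h ^ ?m)"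
    unfolding powr_diff powr_minus powr_realpow[OF h] by (simp add: inverse_eq_divide)
  have "h ^ ?m * c * p h (x, t) = 1 / (h powr (real ?q / 2) * sqrt (sqrt (pi / 2) ^ ?q)) * E * I"
    using G unfolding sq c_def by (simp add: power_mult_distrib mult_ac)
  then have "p h (x, t) = 1 / (h powr (real ?q / 2) * sqrt (sqrt (pi / 2) ^ ?q)) * E * I / (h ^ ?m * c)"
    using c h by (simp add: eq_divide_eq mult.commute)
  also have "\<dots> = 1 / (sqrt (sqrt (pi / 2) ^ ?q) * c) * E * (1 / (h powr (real ?q / 2) * h ^ ?m) * I)"
    by (simp add: mult_ac)
  also have "\<dots> = gauss_const ?q ?m * E * (h powr (- (real (0 + 1) * real ?q / 2) - real ?m) * I)"
    unfolding hp gauss_const_def c_def ..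
  finally have "p h (x, t) = gauss_const ?q ?m * E * (h powr (- (real (0 + 1) * real ?q / 2) - real ?m) * I)" .
  then show ?thesis unfolding P_ker_cos[OF U h] I_def E_def by (simp only: of_real_mult)
qed

text \<open>Extends \<open>F_map\<close> to k = 0 by the point at which the kernel of index 0 is
  evaluated, so that the induction can start there; \<open>F_map\<close> itself would read s
  0.\<close>

definition F_map0 :: "('m::finite \<Rightarrow> real^'q^'q) \<Rightarrow> nat \<Rightarrow> real^'q \<Rightarrow> real^'m \<Rightarrow> (nat \<Rightarrow> real^'q) \<Rightarrow> (real^'q) \<times> (real^'m)" where
  "F_map0 U k x t s = (if k = 0 then ((1 / sqrt 2) *\<^sub>R x, t) else F_map U k x t s)"

text \<open>For k = 0 the bracket of x / sqrt 2 with the new variable is the first bracket of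
  \<open>F_map\<close>, which explains why that term alone carries 1 / sqrt 2.\<close>

lemma F_map0_Suc:
  "F_map0 U (Suc k) x t (s(Suc k := y)) = (y, snd (F_map0 U k x t s) + bracket U (fst (F_map0 U k x t s)) y)"
proof (cases "k = 0")
  case True
  have "bracket U ((1 / sqrt 2) *\<^sub>R x) y = (1 / sqrt 2) *\<^sub>R bracket U x y"
    by (simp add: bracket_def vec_eq_iff matrix_vector_mult_scaleR)
  then show ?thesis using True by (simp add: F_map0_def F_map_def)
next
  case False
  then have "{2..Suc k} = insert (Suc k) {2..k}" by auto
  moreover have "(\<Sum>j=2..k. bracket U ((s(Suc k := y)) (j - 1)) ((s(Suc k := y)) j)) = (\<Sum>j=2..k. bracket U (s (j - 1)) (s j))"
    by (intro sum.cong) auto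
  ultimately have "(\<Sum>j=2..Suc k. bracket U ((s(Suc k := y)) (j - 1)) ((s(Suc k := y)) j))
     = bracket U (s k) y + (\<Sum>j=2..k. bracket U (s (j - 1)) (s j))"
    by simp
  then show ?thesis using False by (simp add: F_map0_def F_map_def)
qed

lemma measurable_F_map0:
  fixes U :: "'m::finite \<Rightarrow> real^'q^'q"
  shows "F_map0 U k x t \<in> borel_measurable (Pi\<^sub>M {1..k} (\<lambda>_. lborel :: (real^'q) measure))"
proof (cases "k = 0")
  case False
  have cb: "continuous_on UNIV (\<lambda>p. bracket U (fst p) (snd p))"
  proof -
    have "continuous_on UNIV (\<lambda>x. U j *v x)" for j
      using linear_continuous_on[of "\<lambda>x. U j *v x" UNIV] matrix_vector_mul_linear[of "U j"] by (simp only: linear_linear)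
    then have "continuous_on UNIV (\<lambda>p :: (real^'q) \<times> (real^'q). U j *v fst p)" for j
      by (rule continuous_on_compose2) (auto intro!: continuous_intros)
    then show ?thesis unfolding bracket_def by (intro continuous_intros) simp
  qed
  have s: "(\<lambda>s. s j) \<in> borel_measurable (Pi\<^sub>M {1..k} (\<lambda>_. lborel :: (real^'q) measure))" if "j \<in> {1..k}" for j
    using measurable_component_singleton[OF that, of "\<lambda>_. lborel :: (real^'q) measure"] by simp
  have b: "(\<lambda>s. bracket U (s i) (s j)) \<in> borel_measurable (Pi\<^sub>M {1..k} (\<lambda>_. lborel :: (real^'q) measure))"
    if "i \<in> {1..k}" "j \<in> {1..k}" for i j
    using borel_measurable_continuous_on[OF cb borel_measurable_Pair[OF s[OF that(1)] s[OF that(2)]]] by simp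
  have b1: "(\<lambda>s. bracket U x (s j)) \<in> borel_measurable (Pi\<^sub>M {1..k} (\<lambda>_. lborel :: (real^'q) measure))"
    if "j \<in> {1..k}" for j
    using borel_measurable_continuous_on[OF cb borel_measurable_Pair[OF borel_measurable_const s[OF that]]] by simp
  have "F_map U k x t \<in> borel_measurable (Pi\<^sub>M {1..k} (\<lambda>_. lborel :: (real^'q) measure))"
    unfolding F_map_def
    using False
    by (intro borel_measurable_Pair borel_measurable_add borel_measurable_const borel_measurable_scaleR
        borel_measurable_sum s b b1) auto
  then show ?thesis using False by (simp add: F_map0_def[abs_def])
qed (simp add: F_map0_def[abs_def])

text \<open>The last variable is integrated first: its weight (2 (k + 1) + 1) / (2 h) is the one of
  \<open>P_ker_step\<close>, and \<open>F_map0_Suc\<close> brings the argument of the kernel into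
  the form used there. Boundedness of the kernel leaves a product of Gaussians as majorant for
  Fubini.\<close>

lemma P_ker_iterate:
  fixes U :: "'m::finite \<Rightarrow> real^'q^'q"
  assumes U: "step_two U" and h: "0 < h"
  shows "(LINT s|Pi\<^sub>M {1..k} (\<lambda>_. lborel :: (real^'q) measure).
      of_real (exp (- (\<Sum>j=1..k. (2 * real j + 1) / (2 * h) * (norm (s j))\<^sup>2))) * P_ker U k h (F_map0 U k x t s))
    = of_real ((2 * pi) powr (real CARD('q) / 2)) ^ k * P_ker U 0 h ((1 / sqrt 2) *\<^sub>R x, t)"
proof (induction k)
  case 0
  \<comment> \<open>The product measure over the empty index set is a point mass, and the empty sum
    makes the exponential 1.\<close>
  show ?case by (simp add: PiM_empty F_map0_def lebesgue_integral_count_space_finite)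
next
  case (Suc k)
  interpret product_sigma_finite "\<lambda>_::nat. lborel :: (real^'q) measure" by standard
  let ?G = "\<lambda>j s. exp (- ((2 * real j + 1) / (2 * h) * (norm (s :: real^'q))\<^sup>2))"
  let ?f = "\<lambda>k s. complex_of_real (exp (- (\<Sum>j=1..k. (2 * real j + 1) / (2 * h) * (norm (s j))\<^sup>2))) * P_ker U k h (F_map0 U k x t s)"
  have E: "exp (- (\<Sum>j=1..k. (2 * real j + 1) / (2 * h) * (norm (s j))\<^sup>2)) = (\<Prod>j\<in>{1..k}. ?G j (s j))" for k and s :: "nat \<Rightarrow> real^'q"
    by (simp add: exp_sum[symmetric] sum_negf)
  have ins: "{1..Suc k} = insert (Suc k) {1..k}" by auto
  have int: "integrable (Pi\<^sub>M {1..Suc k} (\<lambda>_. lborel)) (?f (Suc k))"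
  proof -
    obtain B where B: "0 \<le> B" "\<And>g. norm (P_ker U (Suc k) h g) \<le> B" by (rule P_ker_bound[OF U h]) blast
    have Gi: "integrable lborel (?G j)" for j
      using gaussian_norm[of "(2 * real j + 1) / (2 * h)", where 'a="real^'q"] h by (simp add: has_bochner_integral_iff)
    have Pi: "integrable (Pi\<^sub>M {1..Suc k} (\<lambda>_. lborel)) (\<lambda>s. \<Prod>j\<in>{1..Suc k}. ?G j (s j))"
      by (rule product_integrable_prod[OF finite_atLeastAtMost Gi])
    show ?thesis
    proof (rule Bochner_Integration.integrable_bound)
      show "integrable (Pi\<^sub>M {1..Suc k} (\<lambda>_. lborel)) (\<lambda>s. B * (\<Prod>j\<in>{1..Suc k}. ?G j (s j)))"
        by (rule integrable_mult_right[OF Pi])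
      have "(\<lambda>s. P_ker U (Suc k) h (F_map0 U (Suc k) x t s)) \<in> borel_measurable (Pi\<^sub>M {1..Suc k} (\<lambda>_. lborel))"
        by (rule measurable_compose[OF measurable_F_map0 measurable_P_ker[OF U]])
      moreover have "(\<lambda>s. complex_of_real (\<Prod>j\<in>{1..Suc k}. ?G j (s j))) \<in> borel_measurable (Pi\<^sub>M {1..Suc k} (\<lambda>_. lborel))"
        by (rule measurable_compose[OF borel_measurable_integrable[OF Pi] borel_measurable_of_real])
      ultimately show "?f (Suc k) \<in> borel_measurable (Pi\<^sub>M {1..Suc k} (\<lambda>_. lborel))"
        unfolding E by (intro borel_measurable_times)
      show "AE s in Pi\<^sub>M {1..Suc k} (\<lambda>_. lborel). norm (?f (Suc k) s) \<le> norm (B * (\<Prod>j\<in>{1..Suc k}. ?G j (s j)))"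
      proof (intro AE_I2)
        fix s :: "nat \<Rightarrow> real^'q"
        have g0: "0 \<le> (\<Prod>j\<in>{1..Suc k}. ?G j (s j))" by (intro prod_nonneg) auto
        have "(\<Prod>j\<in>{1..Suc k}. ?G j (s j)) * norm (P_ker U (Suc k) h (F_map0 U (Suc k) x t s)) \<le> (\<Prod>j\<in>{1..Suc k}. ?G j (s j)) * B"
          by (rule mult_left_mono[OF B(2) g0])
        then show "norm (?f (Suc k) s) \<le> norm (B * (\<Prod>j\<in>{1..Suc k}. ?G j (s j)))"
          unfolding E norm_mult norm_of_real real_norm_def abs_mult abs_of_nonneg[OF g0] abs_of_nonneg[OF B(1)]
          by (simp only: mult.commute)
      qed
    qed
  qed
  have step: "(LINT y|lborel. ?f (Suc k) (s(Suc k := y))) = of_real ((2 * pi) powr (real CARD('q) / 2)) * ?f k s" for s :: "nat \<Rightarrow> real^'q"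
  proof -
    let ?e = "complex_of_real (exp (- (\<Sum>j=1..k. (2 * real j + 1) / (2 * h) * (norm (s j))\<^sup>2)))"
    have "?f (Suc k) (s(Suc k := y)) = ?e * (of_real (exp (- ((2 * real k + 3) / (2 * h) * (norm y)\<^sup>2))) *
        P_ker U (Suc k) h (y, snd (F_map0 U k x t s) + bracket U (fst (F_map0 U k x t s)) y))" for y
    proof -
      have "(\<Sum>j=1..Suc k. (2 * real j + 1) / (2 * h) * (norm ((s(Suc k := y)) j))\<^sup>2)
        = (\<Sum>j=1..k. (2 * real j + 1) / (2 * h) * (norm (s j))\<^sup>2) + (2 * real k + 3) / (2 * h) * (norm y)\<^sup>2"
        by (simp cong: sum.cong_simp)
      then have "exp (- (\<Sum>j=1..Suc k. (2 * real j + 1) / (2 * h) * (norm ((s(Suc k := y)) j))\<^sup>2))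
         = exp (- (\<Sum>j=1..k. (2 * real j + 1) / (2 * h) * (norm (s j))\<^sup>2)) * exp (- ((2 * real k + 3) / (2 * h) * (norm y)\<^sup>2))"
        by (simp only: minus_add_distrib exp_add)
      then show ?thesis unfolding F_map0_Suc by (simp only: of_real_mult mult.assoc)
    qed
    then have "(LINT y|lborel. ?f (Suc k) (s(Suc k := y))) = ?e * (LINT y|lborel. of_real (exp (- ((2 * real k + 3) / (2 * h) * (norm y)\<^sup>2))) *
        P_ker U (Suc k) h (y, snd (F_map0 U k x t s) + bracket U (fst (F_map0 U k x t s)) y))"
      by (simp only: integral_mult_right_zero)
    then show ?thesis unfolding P_ker_step[OF U h] by (simp only: prod.collapse mult.left_commute)
  qed
  have "(LINT s|Pi\<^sub>M {1..Suc k} (\<lambda>_. lborel). ?f (Suc k) s) = (LINT s|Pi\<^sub>M {1..k} (\<lambda>_. lborel). LINT y|lborel. ?f (Suc k) (s(Suc k := y)))"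
    using product_integral_insert[of "{1..k}" "Suc k" "?f (Suc k)"] int unfolding ins by simp
  also have "\<dots> = of_real ((2 * pi) powr (real CARD('q) / 2)) * (LINT s|Pi\<^sub>M {1..k} (\<lambda>_. lborel). ?f k s)"
    unfolding step by (rule integral_mult_right_zero)
  finally show ?case unfolding Suc.IH power_Suc mult.assoc .
qed

theorem mainTheorem4:
  shows "\<exists>C>0. \<forall>(U :: 'm::finite \<Rightarrow> real^'q^'q) (p :: real \<Rightarrow> (real^'q) \<times> (real^'m) \<Rightarrow> real).
    step_two U \<longrightarrow> heat_kernel U p \<longrightarrow>
    (\<forall>h>0. \<forall>x t.
       complex_of_real (p h (x, t)) =
         of_real (C * exp (- (norm x)\<^sup>2 / (4 * h))) * P_ker U 0 h ((1 / sqrt 2) *\<^sub>R x, t)) \<and>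
    (\<forall>k\<ge>1. \<forall>h>0. \<forall>x t.
       complex_of_real (p h (x, t)) =
         of_real (C / ((2 * pi) powr (real CARD('q) / 2)) ^ k * exp (- (norm x)\<^sup>2 / (4 * h))) *
         (LINT s|Pi\<^sub>M {1..k} (\<lambda>_. lborel :: (real^'q) measure).
            of_real (exp (- (\<Sum>j=1..k. (2 * real j + 1) / (2 * h) * (norm (s j))\<^sup>2))) *
            P_ker U k h (F_map U k x t s)))"
proof (intro exI[of _ "gauss_const CARD('q) CARD('m)"] conjI allI impI gauss_const_pos)
  fix U :: "'m \<Rightarrow> real^'q^'q" and p :: "real \<Rightarrow> (real^'q) \<times> (real^'m) \<Rightarrow> real"
  assume U: "step_two U" and p: "heat_kernel U p"
  fix h :: real and x :: "real^'q" and t :: "real^'m"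
  assume h: "0 < h"
  let ?C = "gauss_const CARD('q) CARD('m)" and ?E = "exp (- (norm x)\<^sup>2 / (4 * h))"
  show 0: "complex_of_real (p h (x, t)) = of_real (?C * ?E) * P_ker U 0 h ((1 / sqrt 2) *\<^sub>R x, t)"
    by (rule heat_kernel_P_ker_0[OF U p h])
  fix k :: nat assume k: "1 \<le> k"
  let ?I = "LINT s|Pi\<^sub>M {1..k} (\<lambda>_. lborel :: (real^'q) measure).
            complex_of_real (exp (- (\<Sum>j=1..k. (2 * real j + 1) / (2 * h) * (norm (s j))\<^sup>2))) * P_ker U k h (F_map U k x t s)"
  define b where "b = (2 * pi) powr (real CARD('q) / 2)"
  have b: "b \<noteq> 0" by (simp add: b_def)
  have "?I = of_real b ^ k * P_ker U 0 h ((1 / sqrt 2) *\<^sub>R x, t)"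
    using P_ker_iterate[OF U h, of k x t] k by (simp add: F_map0_def b_def)
  then have "of_real (?C / b ^ k * ?E) * ?I = of_real (?C * ?E) * P_ker U 0 h ((1 / sqrt 2) *\<^sub>R x, t)"
    using b by simp
  then show "complex_of_real (p h (x, t)) = of_real (?C / ((2 * pi) powr (real CARD('q) / 2)) ^ k * ?E) * ?I"
    using 0 unfolding b_def by simp
qed

end
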